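(* Assume: (i) $\partial\Omega=\Gamma_D\cup\Gamma_N$ is Lipschitz, $\Gamma_D\cap\Gamma_N=\emptyset$, $\mathrm{m}(\Gamma_D)>0$, and $\Gamma_N$ is open in $\partial\Omega$; (ii) $N^{\rm in},P^{\rm in},Q^{\rm in}\in L\log L(\Omega)$ are nonnegative and not identically zero; (iii) $N^D,P^D\ge 0$, $V^D\in\mathbb{R}$ on $\Gamma_D$ admit extensions to $\Omega\cup\Gamma_D$ (denoted by the same symbols) such that $N^D,P^D>0$ in $\Omega$ and $\log N^D-V^D,\ \log P^D+V^D\in W^{1,\infty}(\Omega)$; (iv) $A\in L^2(\Omega)$. Then for $k\in\{1,\ldots,N_T\}$ the fully implicit Scharfetter--Gummel finite-volume scheme described in the context (starting from the discrete initial data $N^0,P^0,Q^0$) admits a solution $(N^k,P^k,Q^k,V^k)\in(\mathbb{R}^{\#\mathcal{T}})^4$ satisfying $$N_K^k>0,\quad P_K^k>0,\quad Q_K^k>0\qquad\text{for } K\in\mathcal{T},\ k=1,\ldots,N_T.$$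
   Context: **Domain and parameters.** $\Omega\subset\mathbb{R}^d$ ($d\ge 1$) is a bounded domain, $\lambda>0$, $T>0$, $N_T\in\mathbb{N}$, $\Delta t=T/N_T$. **Mesh.** $(\mathcal{T},\mathcal{E},(x_K)_{K\in\mathcal{T}})$ is an admissible mesh of $\Omega$ in the sense of Eymard--Gallouët--Herbin: $\mathcal{T}$ is a finite family of open convex polygonal (polyhedral) cells, $\mathcal{E}$ the family of edges (faces), $x_K$ are points associated with the cells, and for neighbours $K,L$ with common edge $\sigma=K|L$ the segment $\overline{x_Kx_L}$ is orthogonal to $\sigma$. $\mathcal{E}=\mathcal{E}_{\rm int}\cup\mathcal{E}_{\rm ext}$ (edges inside $\Omega$, resp. on $\partial\Omega$), $\mathcal{E}_{\rm ext}=\mathcal{E}_{\rm ext}^D\cup\mathcal{E}_{\rm ext}^N$ (edges on $\Gamma_D$, resp. $\Gamma_N$); $\mathcal{E}_K$ is the set of edges of $K$, $\mathcal{E}_{{\rm ext},K}=\mathcal{E}_K\cap\mathcal{E}_{\rm ext}$, $\mathcal{E}_{{\rm ext},K}^N=\mathcal{E}_K\cap\mathcal{E}_{\rm ext}^N$. $\mathrm{m}$ is Lebesgue measure (of the appropriate dimension), $\mathrm{d}_\sigma=d(x_K,x_L)$ if $\sigma=K|L$ and $\mathrm{d}_\sigma=d(x_K,\sigma)$ if $\sigma\in\mathcal{E}_{{\rm ext},K}$; $\tau_\sigma=\mathrm{m}(\sigma)/\mathrm{d}_\sigma$. The mesh satisfies $d(x_K,\sigma)\ge\xi_1\mathrm{d}_\sigma$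 and $\mathrm{d}_\sigma\ge\xi_2\max_{\sigma'\in\mathcal{E}_K}\mathrm{d}_{\sigma'}$ for $K\in\mathcal{T}$, $\sigma\in\mathcal{E}_K$, with fixed $\xi_1,\xi_2>0$. **Difference operator.** $\mathrm{D}_{K,\sigma}v=v_{K,\sigma}-v_K$, where $v_{K,\sigma}=v_L$ if $\sigma=K|L$ and $v_{K,\sigma}=v_\sigma$ (a boundary edge value) if $\sigma\in\mathcal{E}_{{\rm ext},K}$. **Data.** $U_K^0=\mathrm{m}(K)^{-1}\int_K U^{\rm in}dx$ for $U=N,P,Q$; $U_\sigma^D=\mathrm{m}(\sigma)^{-1}\int_\sigma U^D ds$ for $U=N,P,V$; $A_K=\mathrm{m}(K)^{-1}\int_K A\,dx$. **Scheme.** $B(s)=s/(e^s-1)$ for $s\ne0$, $B(0)=1$, and $$\mathcal{F}_{K,\sigma}[u,\phi]=\tau_\sigma\big(B(-\mathrm{D}_{K,\sigma}\phi)u_{K,\sigma}-B(\mathrm{D}_{K,\sigma}\phi)u_K\big).$$ For $K\in\mathcal{T}$ and $k=1,\ldots,N_T$: $$\frac{\mathrm{m}(K)}{\Delta t}(N_K^k-N_K^{k-1})-\sum_{\sigma\in\mathcal{E}_K}\mathcal{F}_{K,\sigma}[N^k,-V^k]=0,$$ $$\frac{\mathrm{m}(K)}{\Delta t}(P_K^k-P_K^{k-1})-\sum_{\sigma\in\mathcal{E}_K}\mathcal{F}_{K,\sigma}[P^k,V^k]=0,$$ $$\frac{\mathrm{m}(K)}{\Delta t}(Q_K^k-Q_K^{k-1})-\sum_{\sigma\in\mathcal{E}_K}\mathcal{F}_{K,\sigma}[Q^k,V^k]=0,$$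 $$\lambda^2\sum_{\sigma\in\mathcal{E}_K}\tau_\sigma\mathrm{D}_{K,\sigma}V^k=\mathrm{m}(K)(N_K^k-P_K^k-Q_K^k+A_K),$$ with boundary edge values determined by: $N_\sigma^k=N_\sigma^D$, $P_\sigma^k=P_\sigma^D$, $V_\sigma^k=V_\sigma^D$ for $\sigma\in\mathcal{E}_{\rm ext}^D$; $\mathcal{F}_{K,\sigma}[N^k,-V^k]=\mathcal{F}_{K,\sigma}[P^k,V^k]=0$, $V_{K,\sigma}^k=V_K^k$ for $\sigma\in\mathcal{E}_{{\rm ext},K}^N$; $\mathcal{F}_{K,\sigma}[Q^k,V^k]=0$ for all $\sigma\in\mathcal{E}_{{\rm ext},K}$. *)

theory Defs
  imports "HOL-Analysis.Analysis"
begin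

section \<open>Surface measure\<close>

text \<open>
  The $(d-1)$-dimensional measure on subsets of a $d$-dimensional Euclidean space is the Hausdorff
  measure, normalised by the volume of the unit ball so that it agrees with Lebesgue measure on
  hyperplanes.  The exponent is a natural number, so that \<open>0 ^ 0 = 1\<close> makes the case of dimension
  zero the counting measure; this is why empty members of a covering are treated separately.
  Coverings are by bounded sets because \<^const>\<open>diameter\<close> is meaningless on unbounded ones.
\<close>

definition hausdorff_premeasure :: "nat \<Rightarrow> real \<Rightarrow> 'a::euclidean_space set \<Rightarrow> ennreal" where
  "hausdorff_premeasure s \<delta> S =
     (INF C \<in> {C :: nat \<Rightarrow> 'a set. S \<subseteq> (\<Union>i. C i) \<and> (\<forall>i. bounded (C i) \<and> diameter (C i) \<le> \<delta>)}.
        \<Sum>i. if C i = {} then 0 else ennreal (unit_ball_vol (real s) * (diameter (C i) / 2) ^ s))"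

definition hausdorff_outer :: "nat \<Rightarrow> 'a::euclidean_space set \<Rightarrow> ennreal" where
  "hausdorff_outer s S = (SUP \<delta>\<in>{0<..}. hausdorff_premeasure s \<delta> S)"

text \<open>The measurable sets are all sets measurable in the sense of Caratheodory.\<close>

definition surface_measure :: "'a::euclidean_space measure" where
  "surface_measure =
     measure_of UNIV (lambda_system UNIV UNIV (hausdorff_outer (DIM('a) - 1)))
       (hausdorff_outer (DIM('a) - 1))"


section \<open>Domains and function spaces\<close>

definition lipschitz_boundary :: "'a::euclidean_space set \<Rightarrow> bool" where
  "lipschitz_boundary \<Omega> \<longleftrightarrow>
     (\<forall>x\<in>frontier \<Omega>. \<exists>r>0. \<exists>e L. \<exists>\<gamma> :: 'a \<Rightarrow> real. norm e = 1 \<and>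
        L-lipschitz_on {y. y \<bullet> e = 0} \<gamma> \<and>
        \<Omega> \<inter> ball x r = {y \<in> ball x r. \<gamma> (y - (y \<bullet> e) *\<^sub>R e) < y \<bullet> e})"

definition LlogL :: "'a::euclidean_space set \<Rightarrow> ('a \<Rightarrow> real) \<Rightarrow> bool" where
  "LlogL \<Omega> f \<longleftrightarrow> f \<in> borel_measurable (lebesgue_on \<Omega>) \<and>
     integrable (lebesgue_on \<Omega>) f \<and>
     integrable (lebesgue_on \<Omega>) (\<lambda>x. \<bar>f x\<bar> * max 0 (ln \<bar>f x\<bar>))"

definition L2 :: "'a::euclidean_space set \<Rightarrow> ('a \<Rightarrow> real) \<Rightarrow> bool" where
  "L2 \<Omega> f \<longleftrightarrow> f \<in> borel_measurable (lebesgue_on \<Omega>) \<and> integrable (lebesgue_on \<Omega>) (\<lambda>x. (f x)\<^sup>2)"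

definition Linf :: "'a::euclidean_space set \<Rightarrow> ('a \<Rightarrow> real) \<Rightarrow> bool" where
  "Linf \<Omega> f \<longleftrightarrow> f \<in> borel_measurable (lebesgue_on \<Omega>) \<and> (\<exists>C. AE x in lebesgue_on \<Omega>. \<bar>f x\<bar> \<le> C)"

primrec Ck :: "nat \<Rightarrow> ('a::euclidean_space \<Rightarrow> real) \<Rightarrow> bool" where
  "Ck 0 f \<longleftrightarrow> continuous_on UNIV f"
| "Ck (Suc n) f \<longleftrightarrow> (\<forall>x. f differentiable (at x)) \<and>
     (\<forall>b\<in>Basis. Ck n (\<lambda>x. frechet_derivative f (at x) b))"

definition test_function :: "'a::euclidean_space set \<Rightarrow> ('a \<Rightarrow> real) \<Rightarrow> bool" where
  "test_function \<Omega> \<phi> \<longleftrightarrow> (\<forall>n. Ck n \<phi>) \<and> (\<exists>S. compact S \<and> S \<subseteq> \<Omega> \<and> (\<forall>x. x \<notin> S \<longrightarrow> \<phi> x = 0))"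

definition weak_partial ::
    "'a::euclidean_space set \<Rightarrow> 'a \<Rightarrow> ('a \<Rightarrow> real) \<Rightarrow> ('a \<Rightarrow> real) \<Rightarrow> bool" where
  "weak_partial \<Omega> b f g \<longleftrightarrow> (\<forall>\<phi>. test_function \<Omega> \<phi> \<longrightarrow>
     (LINT x|lebesgue_on \<Omega>. f x * frechet_derivative \<phi> (at x) b) = - (LINT x|lebesgue_on \<Omega>. g x * \<phi> x))"

definition W1inf :: "'a::euclidean_space set \<Rightarrow> ('a \<Rightarrow> real) \<Rightarrow> bool" where
  "W1inf \<Omega> f \<longleftrightarrow> Linf \<Omega> f \<and> (\<forall>b\<in>Basis. \<exists>g. Linf \<Omega> g \<and> weak_partial \<Omega> b f g)"


section \<open>Admissible meshes\<close>

text \<open>The field \<open>centre\<close> is the family $(x_K)_K$; only its values on cells matter.\<close>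

record 'a fv_mesh =
  cells :: "'a set set"
  edges :: "'a set set"
  centre :: "'a set \<Rightarrow> 'a"

definition cell_edges :: "('a::euclidean_space) fv_mesh \<Rightarrow> 'a set \<Rightarrow> 'a set set" where
  "cell_edges M K = {\<sigma> \<in> edges M. \<sigma> \<subseteq> frontier K}"

text \<open>\<open>separates M \<sigma> K L\<close> says that $\sigma = K|L$.\<close>

definition separates :: "('a::euclidean_space) fv_mesh \<Rightarrow> 'a set \<Rightarrow> 'a set \<Rightarrow> 'a set \<Rightarrow> bool" where
  "separates M \<sigma> K L \<longleftrightarrow> \<sigma> \<in> edges M \<and> K \<in> cells M \<and> L \<in> cells M \<and> K \<noteq> L \<and>
     closure K \<inter> closure L = closure \<sigma>"

text \<open>
  The definition of Eymard, Gallouet and Herbin.  Edges may be taken without their relative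
  boundary, and being polygonal they differ from their closure by a null set, which is all that is
  recorded of their shape (\<open>edge_closure\<close>).  The properties \<open>edge_overlap\<close>, \<open>edge_position\<close> and
  \<open>interior_edge\<close> are tacit in that definition: edges do not overlap, and each of them is either
  on the boundary of the domain or inside it, the latter being those of the form $K|L$.
\<close>

locale admissible_mesh =
  fixes \<Omega> :: "'a::euclidean_space set" and M :: "'a fv_mesh"
  assumes finite_cells: "finite (cells M)"
    and cell: "K \<in> cells M \<Longrightarrow>
      K \<noteq> {} \<and> open K \<and> convex K \<and> polytope (closure K) \<and> K \<subseteq> \<Omega>"
    and cover: "closure (\<Union>(cells M)) = closure \<Omega>"
    and finite_edges: "finite (edges M)"
    and edge_hyperplane: "\<sigma> \<in> edges M \<Longrightarrow>
      \<sigma> \<subseteq> closure \<Omega> \<and> (\<exists>a b. a \<noteq> 0 \<and> \<sigma> \<subseteq> {x. a \<bullet> x = b})"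
    and edge_measure: "\<sigma> \<in> edges M \<Longrightarrow> measure surface_measure \<sigma> > 0"
    and edge_closure: "\<sigma> \<in> edges M \<Longrightarrow> closure \<sigma> - \<sigma> \<in> null_sets surface_measure"
    and cell_boundary: "K \<in> cells M \<Longrightarrow> frontier K = (\<Union>\<sigma>\<in>cell_edges M K. closure \<sigma>)"
    and edges_of_cells: "edges M = (\<Union>K\<in>cells M. cell_edges M K)"
    and cell_intersection: "K \<in> cells M \<Longrightarrow> L \<in> cells M \<Longrightarrow> K \<noteq> L \<Longrightarrow>
      closure K \<inter> closure L \<in> null_sets surface_measure \<or> (\<exists>\<sigma>. separates M \<sigma> K L)"
    and centre: "K \<in> cells M \<Longrightarrow> centre M K \<in> \<Omega> \<inter> closure K"
    and orthogonal: "separates M \<sigma> K L \<Longrightarrow> centre M K \<noteq> centre M L \<and>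
      (\<forall>y\<in>\<sigma>. \<forall>z\<in>\<sigma>. (centre M K - centre M L) \<bullet> (y - z) = 0)"
    and boundary_foot: "K \<in> cells M \<Longrightarrow> \<sigma> \<in> cell_edges M K \<Longrightarrow> \<sigma> \<subseteq> frontier \<Omega> \<Longrightarrow>
      \<exists>y\<in>\<sigma>. \<forall>z\<in>\<sigma>. (y - centre M K) \<bullet> (z - y) = 0"
    and edge_overlap: "\<sigma> \<in> edges M \<Longrightarrow> \<sigma>' \<in> edges M \<Longrightarrow> \<sigma> \<noteq> \<sigma>' \<Longrightarrow>
      \<sigma> \<inter> \<sigma>' \<in> null_sets surface_measure"
    and edge_position: "\<sigma> \<in> edges M \<Longrightarrow> \<sigma> \<subseteq> \<Omega> \<or> \<sigma> \<subseteq> frontier \<Omega>"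
    and interior_edge: "\<sigma> \<in> edges M \<Longrightarrow> \<sigma> \<subseteq> \<Omega> \<longleftrightarrow> (\<exists>K L. separates M \<sigma> K L)"

definition neighbour :: "('a::euclidean_space) fv_mesh \<Rightarrow> 'a set \<Rightarrow> 'a set \<Rightarrow> 'a set" where
  "neighbour M K \<sigma> = (THE L. separates M \<sigma> K L)"

text \<open>
  Here \<open>K\<close> is any cell having \<open>\<sigma>\<close> as an edge; the value does not depend on which of them is taken.
\<close>

definition edge_dist :: "'a::euclidean_space set \<Rightarrow> 'a fv_mesh \<Rightarrow> 'a set \<Rightarrow> 'a set \<Rightarrow> real" where
  "edge_dist \<Omega> M K \<sigma> =
     (if \<sigma> \<subseteq> frontier \<Omega> then infdist (centre M K) \<sigma>
      else dist (centre M K) (centre M (neighbour M K \<sigma>)))"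

definition transmissibility :: "'a::euclidean_space set \<Rightarrow> 'a fv_mesh \<Rightarrow> 'a set \<Rightarrow> 'a set \<Rightarrow> real" where
  "transmissibility \<Omega> M K \<sigma> = measure surface_measure \<sigma> / edge_dist \<Omega> M K \<sigma>"

definition mesh_regular :: "'a::euclidean_space set \<Rightarrow> 'a fv_mesh \<Rightarrow> real \<Rightarrow> real \<Rightarrow> bool" where
  "mesh_regular \<Omega> M \<xi>1 \<xi>2 \<longleftrightarrow> (\<forall>K\<in>cells M. \<forall>\<sigma>\<in>cell_edges M K.
     infdist (centre M K) \<sigma> \<ge> \<xi>1 * edge_dist \<Omega> M K \<sigma> \<and>
     edge_dist \<Omega> M K \<sigma> \<ge> \<xi>2 * (MAX \<sigma>'\<in>cell_edges M K. edge_dist \<Omega> M K \<sigma>'))"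


section \<open>The scheme\<close>

definition cell_mean :: "('a::euclidean_space \<Rightarrow> real) \<Rightarrow> 'a set \<Rightarrow> real" where
  "cell_mean U K = (LINT x|lebesgue_on K. U x) / measure lebesgue K"

definition edge_mean :: "('a::euclidean_space \<Rightarrow> real) \<Rightarrow> 'a set \<Rightarrow> real" where
  "edge_mean U \<sigma> = (LINT x:\<sigma>|surface_measure. U x) / measure surface_measure \<sigma>"

definition bernoulli_fun :: "real \<Rightarrow> real" where
  "bernoulli_fun s = (if s = 0 then 1 else s / (exp s - 1))"

text \<open>
  A discrete function \<open>v\<close> carries its cell values $v_K$ and its boundary edge values $v_\sigma$ in
  a single map on sets.  There is no clash, as cells are open and nonempty whereas edges lie in
  hyperplanes.
\<close>

definition across :: "'a::euclidean_space set \<Rightarrow> 'a fv_mesh \<Rightarrow> ('a set \<Rightarrow> real) \<Rightarrow> 'a set \<Rightarrow> 'a set \<Rightarrow> real" where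
  "across \<Omega> M v K \<sigma> = (if \<sigma> \<subseteq> frontier \<Omega> then v \<sigma> else v (neighbour M K \<sigma>))"

definition difference :: "'a::euclidean_space set \<Rightarrow> 'a fv_mesh \<Rightarrow> ('a set \<Rightarrow> real) \<Rightarrow> 'a set \<Rightarrow> 'a set \<Rightarrow> real" where
  "difference \<Omega> M v K \<sigma> = across \<Omega> M v K \<sigma> - v K"

definition flux ::
    "'a::euclidean_space set \<Rightarrow> 'a fv_mesh \<Rightarrow> ('a set \<Rightarrow> real) \<Rightarrow> ('a set \<Rightarrow> real) \<Rightarrow> 'a set \<Rightarrow> 'a set \<Rightarrow> real" where
  "flux \<Omega> M u \<phi> K \<sigma> = transmissibility \<Omega> M K \<sigma> *
     (bernoulli_fun (- difference \<Omega> M \<phi> K \<sigma>) * across \<Omega> M u K \<sigma>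
      - bernoulli_fun (difference \<Omega> M \<phi> K \<sigma>) * u K)"

text \<open>One implicit time step from \<open>(N0, P0, Q0)\<close> to \<open>(N, P, Q, V)\<close>.\<close>

definition scheme_equations ::
    "'a::euclidean_space set \<Rightarrow> 'a fv_mesh \<Rightarrow> real \<Rightarrow> real \<Rightarrow> ('a \<Rightarrow> real) \<Rightarrow>
     ('a set \<Rightarrow> real) \<Rightarrow> ('a set \<Rightarrow> real) \<Rightarrow> ('a set \<Rightarrow> real) \<Rightarrow>
     ('a set \<Rightarrow> real) \<Rightarrow> ('a set \<Rightarrow> real) \<Rightarrow> ('a set \<Rightarrow> real) \<Rightarrow> ('a set \<Rightarrow> real) \<Rightarrow> bool" where
  "scheme_equations \<Omega> M lam dt A N0 P0 Q0 N P Q V \<longleftrightarrow> (\<forall>K\<in>cells M.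
     measure lebesgue K / dt * (N K - N0 K)
       - (\<Sum>\<sigma>\<in>cell_edges M K. flux \<Omega> M N (\<lambda>s. - V s) K \<sigma>) = 0 \<and>
     measure lebesgue K / dt * (P K - P0 K) - (\<Sum>\<sigma>\<in>cell_edges M K. flux \<Omega> M P V K \<sigma>) = 0 \<and>
     measure lebesgue K / dt * (Q K - Q0 K) - (\<Sum>\<sigma>\<in>cell_edges M K. flux \<Omega> M Q V K \<sigma>) = 0 \<and>
     lam\<^sup>2 * (\<Sum>\<sigma>\<in>cell_edges M K. transmissibility \<Omega> M K \<sigma> * difference \<Omega> M V K \<sigma>)
       = measure lebesgue K * (N K - P K - Q K + cell_mean A K))"

definition scheme_boundary ::
    "'a::euclidean_space set \<Rightarrow> 'a set \<Rightarrow> 'a set \<Rightarrow> 'a fv_mesh \<Rightarrow>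
     ('a \<Rightarrow> real) \<Rightarrow> ('a \<Rightarrow> real) \<Rightarrow> ('a \<Rightarrow> real) \<Rightarrow>
     ('a set \<Rightarrow> real) \<Rightarrow> ('a set \<Rightarrow> real) \<Rightarrow> ('a set \<Rightarrow> real) \<Rightarrow> ('a set \<Rightarrow> real) \<Rightarrow> bool" where
  "scheme_boundary \<Omega> \<Gamma>D \<Gamma>N M ND PD VD N P Q V \<longleftrightarrow>
     (\<forall>K\<in>cells M. \<forall>\<sigma>\<in>cell_edges M K. \<sigma> \<subseteq> frontier \<Omega> \<longrightarrow>
       (\<sigma> \<subseteq> \<Gamma>D \<longrightarrow> N \<sigma> = edge_mean ND \<sigma> \<and> P \<sigma> = edge_mean PD \<sigma> \<and> V \<sigma> = edge_mean VD \<sigma>) \<and>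
       (\<sigma> \<subseteq> \<Gamma>N \<longrightarrow> flux \<Omega> M N (\<lambda>s. - V s) K \<sigma> = 0 \<and> flux \<Omega> M P V K \<sigma> = 0 \<and>
          across \<Omega> M V K \<sigma> = V K) \<and>
       flux \<Omega> M Q V K \<sigma> = 0)"

definition scheme_solution ::
    "'a::euclidean_space set \<Rightarrow> 'a set \<Rightarrow> 'a set \<Rightarrow> 'a fv_mesh \<Rightarrow> real \<Rightarrow> real \<Rightarrow> nat \<Rightarrow>
     ('a \<Rightarrow> real) \<Rightarrow> ('a \<Rightarrow> real) \<Rightarrow> ('a \<Rightarrow> real) \<Rightarrow>
     ('a \<Rightarrow> real) \<Rightarrow> ('a \<Rightarrow> real) \<Rightarrow> ('a \<Rightarrow> real) \<Rightarrow> ('a \<Rightarrow> real) \<Rightarrow>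
     (nat \<Rightarrow> 'a set \<Rightarrow> real) \<Rightarrow> (nat \<Rightarrow> 'a set \<Rightarrow> real) \<Rightarrow> (nat \<Rightarrow> 'a set \<Rightarrow> real) \<Rightarrow>
     (nat \<Rightarrow> 'a set \<Rightarrow> real) \<Rightarrow> bool" where
  "scheme_solution \<Omega> \<Gamma>D \<Gamma>N M lam T NT Nin Pin Qin ND PD VD A N P Q V \<longleftrightarrow>
     (\<forall>K\<in>cells M. N 0 K = cell_mean Nin K \<and> P 0 K = cell_mean Pin K \<and> Q 0 K = cell_mean Qin K) \<and>
     (\<forall>k\<in>{1..NT}.
        scheme_equations \<Omega> M lam (T / real NT) A (N (k - 1)) (P (k - 1)) (Q (k - 1)) (N k) (P k) (Q k) (V k) \<and>
        scheme_boundary \<Omega> \<Gamma>D \<Gamma>N M ND PD VD (N k) (P k) (Q k) (V k))"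

end

theory Submission
  imports Defs "HOL-Homology.Homology"
begin

text \<open>
  One time step is a zero of a continuous map \<open>F\<close> on the finite-dimensional space of the unknowns
  \<open>(N, P, Q, V)\<close>.  As spheres are not contractible, \<open>F\<close> has a zero as soon as the solutions of
  \<open>F x + s * x = 0\<close> with \<open>s \<ge> 0\<close> are bounded uniformly in \<open>s\<close>.  For the bound, test the continuity
  equations with the indicator of \<open>N < 0\<close> (giving \<open>N \<ge> 0\<close>), with \<open>1\<close>, and with the negative part of
  \<open>V\<close>: since \<open>B(s) \<le> 1 + |s|\<close> and \<open>s B(s) \<le> 2\<close> for \<open>s \<ge> 0\<close>, both the mass of \<open>N\<close> and the moment
  \<open>\<Sum> m(K) N\<^sub>K V\<^sub>K\<^sup>-\<close> grow at most linearly in \<open>V\<close>, and symmetrically for \<open>P\<close>, while the mass of \<open>Q\<close> is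
  bounded.  Testing the Poisson equation with \<open>V\<close> then bounds the Dirichlet form of \<open>V\<close>,
  which is quadratic and coercive, by a linear expression in \<open>V\<close>.  Coercivity and strict
  positivity need that the cells are connected through edges and that some edge lies on \<open>\<Gamma>\<^sub>D\<close>.
  Both follow from properties of null sets of the surface measure: they do not disconnect
  an open set, and they do not cover \<open>\<Gamma>\<^sub>D\<close>.
\<close>

section \<open>The Bernoulli function\<close>

text \<open>The obstacle is that mass alone does not close the estimate. Mass enters through the
  Dirichlet edges at a rate growing like |V|, so the pairing of the charge with V is a priori
  quadratic in V: the order of the Dirichlet form, with no small constant. A sign saves the
  argument. With \<rho> the charge density, only N V^-, P V^+ and Q V^+ are harmful in -\<rho> V,
  and the drift works against exactly these moments. A jump that raises one of them goes against the
  drift, at a rate decaying with the potential difference, so for N and P the moment is bounded by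
  masses and a term linear in V, not by masses times V. The term s x of the homotopy acts as a
  linear absorption in each continuity equation and has a favourable sign in the Poisson equation,
  so the estimates carry s from the start. All constants may depend on the mesh and the time step;
  hence a bound on the mass can be read as a bound on each cell value.\<close>

lemma bernoulli_fun_pos: "bernoulli_fun s > 0"
  by (cases "s > 0") (auto simp: bernoulli_fun_def divide_neg_neg)

lemma bernoulli_fun_nonneg: "0 \<le> bernoulli_fun s"
  using bernoulli_fun_pos[of s] by simp

lemma continuous_on_bernoulli_fun: "continuous_on A bernoulli_fun"
proof -
  have "isCont bernoulli_fun s" for s
  proof (cases "s = 0")
    case True
    have "((\<lambda>h::real. (exp h - 1) / h) \<longlongrightarrow> 1) (at 0)"
      using DERIV_exp[of "0::real"] by (simp add: DERIV_def)
    then have "((\<lambda>h::real. inverse ((exp h - 1) / h)) \<longlongrightarrow> inverse 1) (at 0)"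
      by (rule tendsto_inverse) simp
    moreover have "eventually (\<lambda>h::real. inverse ((exp h - 1) / h) = bernoulli_fun h) (at 0)"
      by (auto simp: eventually_at_filter bernoulli_fun_def)
    ultimately show ?thesis
      using True by (auto simp: isCont_def bernoulli_fun_def intro: Lim_transform_eventually)
  next
    case False
    have "isCont (\<lambda>s. s / (exp s - 1)) s"
      using False by (intro continuous_intros) auto
    moreover have "eventually (\<lambda>t. bernoulli_fun t = t / (exp t - 1)) (nhds s)"
      using t1_space_nhds[OF False] by eventually_elim (auto simp: bernoulli_fun_def)
    ultimately show ?thesis
      using isCont_cong[of bernoulli_fun "\<lambda>s. s / (exp s - 1)" s] by blast
  qed
  then show ?thesis by (simp add: continuous_at_imp_continuous_on)
qed

lemma bernoulli_fun_le_1: "s \<ge> 0 \<Longrightarrow> bernoulli_fun s \<le> 1"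
  using exp_ge_add_one_self[of s] by (auto simp: bernoulli_fun_def divide_le_eq_1 le_diff_eq add.commute)

lemma bernoulli_fun_le: "bernoulli_fun s \<le> 1 + \<bar>s\<bar>"
proof (cases "s \<ge> 0")
  case False
  have "bernoulli_fun s = bernoulli_fun (- s) - s"
    using False by (auto simp: bernoulli_fun_def exp_minus field_simps)
  then show ?thesis using bernoulli_fun_le_1[of "-s"] False by auto
qed (use bernoulli_fun_le_1[of s] in auto)

lemma mult_bernoulli_fun_le: "s \<ge> 0 \<Longrightarrow> s * bernoulli_fun s \<le> 2"
proof (cases "s = 0")
  case False
  assume "s \<ge> 0"
  with False have s: "s > 0" by simp
  have "exp s - 1 \<ge> s\<^sup>2 / 2"
    using exp_lower_Taylor_quadratic[of s] s by auto
  moreover have "exp s - 1 > 0" using s by simp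
  ultimately show ?thesis
    using False by (auto simp: bernoulli_fun_def field_simps power2_eq_square)
qed (auto simp: bernoulli_fun_def)

text \<open>At a Dirichlet edge \<open>d\<close> is prescribed while \<open>v\<close> is unknown.
  For very negative \<open>v\<close> the decay of B at \<open>d - v\<close> beats the linear growth
  of \<open>- v\<close>; if \<open>d - v\<close> is negative, then \<open>- v\<close> is itself at
  most |d|. What matters is that the bound does not involve \<open>v\<close>.\<close>

lemma bernoulli_fun_neg_part_le:
  "bernoulli_fun (d - v) * max 0 (- v) \<le> (2 + \<bar>d\<bar>) * (1 + \<bar>d\<bar>)"
proof (cases "v < 0")
  case v: True
  show ?thesis
  proof (cases "d - v \<ge> 0")
    case True
    have eq: "bernoulli_fun (d - v) * max 0 (- v) = (d - v) * bernoulli_fun (d - v) - d * bernoulli_fun (d - v)"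
      using v by (simp add: algebra_simps)
    have "- d * bernoulli_fun (d - v) \<le> \<bar>d\<bar> * 1"
      using bernoulli_fun_le_1[OF True] bernoulli_fun_pos[of "d - v"] by (intro mult_mono) auto
    then have "(d - v) * bernoulli_fun (d - v) - d * bernoulli_fun (d - v) \<le> 2 + \<bar>d\<bar> * 1"
      using mult_bernoulli_fun_le[OF True] by simp
    also have "2 + \<bar>d\<bar> * 1 \<le> (2 + \<bar>d\<bar>) * (1 + \<bar>d\<bar>)"
      by (simp add: algebra_simps)
    finally show ?thesis using eq by simp
  next
    case False
    show ?thesis
      using False v bernoulli_fun_le[of "d - v"] bernoulli_fun_pos[of "d - v"]
      by (intro mult_mono) auto
  qed
qed auto

section \<open>Zeros of maps on finite-dimensional spaces\<close>

text \<open>Dividing a homotopy without zeros by its Euclidean norm turns it into a homotopy of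
  self-maps of the sphere. \<open>S\<close> is the sphere as \<open>nsphere\<close> presents it:
  sequences supported on the first p + 1 coordinates.\<close>

lemma nonvanishing_homotopy_on_sphere:
  fixes p :: nat and h :: "real \<times> (nat \<Rightarrow> real) \<Rightarrow> nat \<Rightarrow> real"
  defines "S \<equiv> {x::nat \<Rightarrow> real. (\<Sum>i\<le>p. (x i)\<^sup>2) = 1 \<and> (\<forall>i>p. x i = 0)}"
    and "\<nu> \<equiv> \<lambda>v::nat \<Rightarrow> real. \<lambda>i. v i / sqrt (\<Sum>j\<le>p. (v j)\<^sup>2)"
  assumes cont: "\<And>i. continuous_on ({0..1} \<times> S) (\<lambda>z. h z i)"
    and zero: "\<And>t x i. x \<in> S \<Longrightarrow> i > p \<Longrightarrow> h (t, x) i = 0"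
    and nz: "\<And>t x. t \<in> {0..1} \<Longrightarrow> x \<in> S \<Longrightarrow> \<exists>i\<le>p. h (t, x) i \<noteq> 0"
  shows "homotopic_with_canon (\<lambda>_. True) S S (\<lambda>x. \<nu> (h (0, x))) (\<lambda>x. \<nu> (h (1, x)))"
proof -
  have pos: "(\<Sum>j\<le>p. (h z j)\<^sup>2) > 0" if z: "z \<in> {0..1} \<times> S" for z
  proof -
    obtain i where "i \<le> p" "h z i \<noteq> 0"
      using nz[of "fst z" "snd z"] z by auto
    then show ?thesis
      by (intro sum_pos2[of _ i]) auto
  qed
  have "continuous_on ({0..1} \<times> S) (\<lambda>z. \<nu> (h z))"
    unfolding \<nu>_def
    using pos by (intro continuous_intros cont) force+
  moreover have "\<nu> (h z) \<in> S" if "z \<in> {0..1} \<times> S" for z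
    using pos[OF that] zero[of "snd z" _ "fst z"] that
    by (auto simp: S_def \<nu>_def power_divide real_sqrt_pow2 simp flip: sum_divide_distrib)
  ultimately show ?thesis
    unfolding homotopic_with_def
    by (intro exI[of _ "\<lambda>z. \<nu> (h z)"]) auto
qed

text \<open>Without a zero, two nonvanishing homotopies can be joined: on the sphere of radius R the
  a priori bound allows a linear deformation of the identity into F, and shrinking the sphere to the
  origin deforms F into a constant. The identity of the sphere would then be null-homotopic.\<close>

lemma exists_zero_of_coercive:
  fixes F :: "('i \<Rightarrow> real) \<Rightarrow> 'i \<Rightarrow> real"
  assumes I: "finite I" "I \<noteq> {}" and R: "R > 0"
    and cont: "\<And>i. i \<in> I \<Longrightarrow> continuous_on UNIV (\<lambda>x. F x i)"
    and apriori: "\<And>s x. s \<ge> 0 \<Longrightarrow> \<forall>i\<in>I. F x i + s * x i = 0 \<Longrightarrow> (\<Sum>i\<in>I. (x i)\<^sup>2) < R\<^sup>2"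
  shows "\<exists>x. \<forall>i\<in>I. F x i = 0"
proof (rule ccontr)
  assume "\<not> ?thesis"
  then have noz: "\<And>x. \<exists>i\<in>I. F x i \<noteq> 0" by blast
  obtain p where p: "card I = Suc p"
    using I by (metis card_eq_0_iff not0_implies_Suc)
  \<comment> \<open>Numbering the index set by 0, ..., p transports the problem to the coordinates
    of \<open>nsphere p\<close>.\<close>
  obtain h where h: "bij_betw h {..p} I"
    using I(1) p by (metis bij_betw_iff_card card_atMost finite_atMost)
  define k where "k = inv_into {..p} h"
  have k: "bij_betw k I {..p}"
    using h unfolding k_def by (rule bij_betw_inv_into)
  have hk: "h (k i) = i" if "i \<in> I" for i
    using that h by (metis bij_betw_def f_inv_into_f k_def)
  have kh: "k (h j) = j" if "j \<le> p" for j
    using that h by (metis atMost_iff bij_betw_inv_into_left k_def)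
  have hI: "h j \<in> I" if "j \<le> p" for j
    using that h by (auto simp: bij_betw_def)
  have kI: "k i \<le> p" if "i \<in> I" for i
    using that k by (auto simp: bij_betw_def)
  define S where "S = {x::nat \<Rightarrow> real. (\<Sum>i\<le>p. (x i)\<^sup>2) = 1 \<and> (\<forall>i>p. x i = 0)}"
  define \<nu> where "\<nu> = (\<lambda>v::nat \<Rightarrow> real. \<lambda>i. v i / sqrt (\<Sum>j\<le>p. (v j)\<^sup>2))"
  define G where "G = (\<lambda>x j. if j \<le> p then F (\<lambda>i. R * x (k i)) (h j) else 0)"
  define h1 where "h1 = (\<lambda>(t::real, x::nat\<Rightarrow>real) j. (1 - t) * x j + t * G x j)"
  define h2 where "h2 = (\<lambda>(t::real, x::nat\<Rightarrow>real). G (\<lambda>j. (1 - t) * x j))"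
  have contG: "continuous_on UNIV (\<lambda>x. G x j)" for j
  proof (cases "j \<le> p")
    case True
    have "continuous_on UNIV (\<lambda>x::nat \<Rightarrow> real. F (\<lambda>i. R * x (k i)) (h j))"
      by (rule continuous_on_compose2[OF cont[OF hI[OF True]]])
        (auto intro!: continuous_on_coordinatewise_then_product continuous_on_mult_left continuous_on_product_coordinates)
    then show ?thesis using True by (simp add: G_def)
  qed (simp add: G_def)
  have csnd: "continuous_on A (\<lambda>z::real \<times> (nat \<Rightarrow> real). snd z j)" for A j
    by (rule continuous_on_compose2[OF continuous_on_product_coordinates[of j]])
      (auto intro: continuous_intros)
  have c1: "continuous_on ({0..1} \<times> S) (\<lambda>z. h1 z j)" for j
  proof -
    have "continuous_on ({0..1} \<times> S) (\<lambda>z. G (snd z) j)"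
      by (rule continuous_on_compose2[OF contG]) (auto intro: continuous_intros)
    then show ?thesis
      unfolding h1_def case_prod_beta by (intro continuous_intros csnd) auto
  qed
  have c2: "continuous_on ({0..1} \<times> S) (\<lambda>z. h2 z j)" for j
    unfolding h2_def case_prod_beta
    by (rule continuous_on_compose2[OF contG]) (auto intro!: continuous_intros csnd)
  have nzG: "\<exists>j\<le>p. G x j \<noteq> 0" for x
  proof -
    obtain i where "i \<in> I" "F (\<lambda>i. R * x (k i)) i \<noteq> 0" using noz by blast
    then show ?thesis by (intro exI[of _ "k i"]) (auto simp: G_def kI hk)
  qed
  have nz1: "\<exists>j\<le>p. h1 (t, x) j \<noteq> 0" if t: "t \<in> {0..1}" and x: "x \<in> S" for t x
  proof (rule ccontr)
    assume "\<not> ?thesis"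
    then have z: "(1 - t) * x j + t * G x j = 0" if "j \<le> p" for j
      using that by (auto simp: h1_def)
    have "t \<noteq> 0"
    proof
      assume "t = 0"
      with z have "\<forall>j\<le>p. x j = 0" by auto
      with x show False by (simp add: S_def)
    qed
    with t have t0: "t > 0" by auto
    define y where "y = (\<lambda>i. R * x (k i))"
    \<comment> \<open>Dividing (1 - t) x + t F (R x) = 0 by t and writing x = y / R gives the
      equation of the a priori bound with s = (1 - t) / (t R).\<close>
    have "\<forall>i\<in>I. F y i + ((1 - t) / (t * R)) * y i = 0"
    proof
      fix i assume i: "i \<in> I"
      have "(1 - t) * x (k i) + t * F y i = 0"
        using z[OF kI[OF i]] kI[OF i] hk[OF i] by (simp add: G_def y_def)
      then have "F y i = - ((1 - t) * x (k i) / t)"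
        using t0 by (simp add: field_simps)
      then show "F y i + ((1 - t) / (t * R)) * y i = 0"
        using R t0 by (simp add: y_def)
    qed
    then have "(\<Sum>i\<in>I. (y i)\<^sup>2) < R\<^sup>2"
      using t t0 R by (intro apriori[of "(1 - t) / (t * R)"]) auto
    moreover have "(\<Sum>i\<in>I. (y i)\<^sup>2) = R\<^sup>2 * (\<Sum>i\<in>I. (x (k i))\<^sup>2)"
      by (simp add: y_def power_mult_distrib sum_distrib_left)
    moreover have "(\<Sum>i\<in>I. (x (k i))\<^sup>2) = (\<Sum>j\<le>p. (x j)\<^sup>2)"
      by (rule sum.reindex_bij_betw[OF k])
    ultimately show False using x by (simp add: S_def)
  qed
  have nz2: "\<exists>j\<le>p. h2 (t, x) j \<noteq> 0" for t x
    using nzG by (simp add: h2_def)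
  have hom1: "homotopic_with_canon (\<lambda>_. True) S S (\<lambda>x. \<nu> (h1 (0, x))) (\<lambda>x. \<nu> (h1 (1, x)))"
    unfolding S_def \<nu>_def
    by (rule nonvanishing_homotopy_on_sphere)
      (use c1 nz1 in \<open>auto simp: S_def h1_def G_def\<close>)
  have hom2: "homotopic_with_canon (\<lambda>_. True) S S (\<lambda>x. \<nu> (h2 (0, x))) (\<lambda>x. \<nu> (h2 (1, x)))"
    unfolding S_def \<nu>_def
  proof (rule nonvanishing_homotopy_on_sphere)
    show "h2 (t, x) i = 0" if "i > p" for t x i
      using that by (simp add: h2_def G_def)
  qed (use c2 nz2 in \<open>simp_all add: S_def\<close>)
  have mid: "(\<lambda>x. \<nu> (h1 (1, x))) = (\<lambda>x. \<nu> (h2 (0, x)))"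
    by (simp add: h1_def h2_def)
  have fin: "(\<lambda>x. \<nu> (h2 (1, x))) = (\<lambda>x. \<nu> (G (\<lambda>j. 0)))"
    by (simp add: h2_def)
  have "homotopic_with_canon (\<lambda>_. True) S S (\<lambda>x. \<nu> (h1 (0, x))) (\<lambda>x. \<nu> (G (\<lambda>j. 0)))"
    using homotopic_with_trans[OF hom1[unfolded mid] hom2] unfolding fin .
  then have "homotopic_with_canon (\<lambda>_. True) S S id (\<lambda>x. \<nu> (G (\<lambda>j. 0)))"
    by (rule homotopic_with_eq) (auto simp: h1_def \<nu>_def S_def)
  then have "contractible_space (top_of_set S)"
    unfolding contractible_space_def by blast
  moreover have "nsphere p = top_of_set S"
    by (simp add: nsphere S_def euclidean_product_topology)
  ultimately show False
    using non_contractible_space_nsphere[of p] by simp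
qed

section \<open>Drift-diffusion on weighted graphs\<close>

lemma real_le_of_square_le_affine:
  fixes L c :: real
  assumes "L\<^sup>2 \<le> c * (1 + L)" "0 \<le> c"
  shows "L \<le> 1 + 2 * c"
proof (rule ccontr)
  assume "\<not> ?thesis"
  then have L: "1 + 2 * c < L" by simp
  then have "1 + L \<le> 2 * L" using assms by simp
  then have "c * (1 + L) \<le> c * (2 * L)" using assms by (intro mult_left_mono)
  also have "\<dots> = (2 * c) * L" by simp
  also have "\<dots> < L * L" using L assms by (intro mult_strict_right_mono) auto
  finally show False using assms by (simp add: power2_eq_square)
qed

text \<open>The Scharfetter-Gummel flux without its transmissibility, with \<psi> = V for N and
  \<psi> = - V for P and Q, so that one theory serves all species. As B(-s) = e^s B(s), it vanishes
  when \<open>u\<close> is a multiple of exp \<psi>: the drift is towards large \<psi>.\<close>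

definition drift_flux :: "('n \<Rightarrow> real) \<Rightarrow> ('n \<Rightarrow> real) \<Rightarrow> 'n \<Rightarrow> 'n \<Rightarrow> real" where
  "drift_flux \<psi> u x y = bernoulli_fun (\<psi> y - \<psi> x) * u y - bernoulli_fun (\<psi> x - \<psi> y) * u x"

lemma drift_flux_swap: "drift_flux \<psi> u y x = - drift_flux \<psi> u x y"
  by (simp add: drift_flux_def)

text \<open>The nodes are the cells \<open>I\<close> and the Dirichlet edges \<open>E\<close>, where values are prescribed.
  Edges without flux simply do not occur, so the insulated species \<open>Q\<close> lives on the same graph
  with \<open>E = {}\<close>.\<close>

locale weighted_graph =
  fixes I E :: "'n set" and w :: "'n \<Rightarrow> 'n \<Rightarrow> real"
  assumes finite_I: "finite I" and finite_E: "finite E" and disjoint: "I \<inter> E = {}"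
    and w_nonneg: "x \<in> I \<Longrightarrow> y \<in> I \<union> E \<Longrightarrow> 0 \<le> w x y"
    and w_sym: "x \<in> I \<Longrightarrow> y \<in> I \<Longrightarrow> w x y = w y x"
begin

lemma sum_nodes: "(\<Sum>y\<in>I \<union> E. f y) = (\<Sum>y\<in>I. f y) + (\<Sum>y\<in>E. f y)" for f :: "'n \<Rightarrow> real"
  by (rule sum.union_disjoint[OF finite_I finite_E disjoint])

text \<open>Symmetry of \<open>w\<close> and antisymmetry of \<open>g\<close> let the sum over
  ordered pairs of cells be averaged with its mirror image, which replaces \<phi> x by (\<phi> x -
  \<phi> y) / 2. A pair of a cell and a Dirichlet edge has no mirror image and stays as it
  is.\<close>

lemma summation_by_parts:
  assumes "\<And>x y. g y x = - g x y"
  shows "(\<Sum>x\<in>I. \<phi> x * (\<Sum>y\<in>I \<union> E. w x y * g x y)) =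
    (\<Sum>x\<in>I. \<Sum>y\<in>I. w x y * (g x y * (\<phi> x - \<phi> y))) / 2 + (\<Sum>x\<in>I. \<Sum>e\<in>E. w x e * (\<phi> x * g x e))"
proof -
  define X where "X = (\<Sum>x\<in>I. \<Sum>y\<in>I. w x y * (\<phi> x * g x y))"
  have "X = (\<Sum>y\<in>I. \<Sum>x\<in>I. w x y * (\<phi> x * g x y))"
    unfolding X_def by (rule sum.swap)
  also have "\<dots> = (\<Sum>x\<in>I. \<Sum>y\<in>I. - (w x y * (\<phi> y * g x y)))"
  proof (intro sum.cong refl)
    fix x y assume "x \<in> I" "y \<in> I"
    then show "w y x * (\<phi> y * g y x) = - (w x y * (\<phi> y * g x y))"
      using assms[of y x] w_sym[of y x] by simp
  qed
  finally have X: "X = (\<Sum>x\<in>I. \<Sum>y\<in>I. - (w x y * (\<phi> y * g x y)))" .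
  have "(\<Sum>x\<in>I. \<Sum>y\<in>I. w x y * (g x y * (\<phi> x - \<phi> y))) = 
      (\<Sum>x\<in>I. \<Sum>y\<in>I. w x y * (\<phi> x * g x y)) + (\<Sum>x\<in>I. \<Sum>y\<in>I. - (w x y * (\<phi> y * g x y)))"
    unfolding sum.distrib[symmetric] by (intro sum.cong refl) (simp add: algebra_simps)
  also have "\<dots> = 2 * X"
    using X X_def by linarith
  finally have *: "(\<Sum>x\<in>I. \<Sum>y\<in>I. w x y * (g x y * (\<phi> x - \<phi> y))) = 2 * X" .
  have "(\<Sum>x\<in>I. \<phi> x * (\<Sum>y\<in>I \<union> E. w x y * g x y)) = X + (\<Sum>x\<in>I. \<Sum>e\<in>E. w x e * (\<phi> x * g x e))"
    unfolding X_def sum_nodes distrib_left sum_distrib_left sum.distrib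
    by (simp add: mult.left_commute)
  then show ?thesis using * by simp
qed

text \<open>The parameter \<open>s\<close> is that of the homotopy \<open>F x + s * x\<close> in \<open>exists_zero_of_coercive\<close>;
  the scheme itself is the case \<open>s = 0\<close>.\<close>

definition species :: "('n \<Rightarrow> real) \<Rightarrow> real \<Rightarrow> ('n \<Rightarrow> real) \<Rightarrow> ('n \<Rightarrow> real) \<Rightarrow> ('n \<Rightarrow> real) \<Rightarrow> bool" where
  "species a s u0 \<psi> u \<longleftrightarrow>
    (\<forall>x\<in>I. a x * (u x - u0 x) + s * u x = (\<Sum>y\<in>I \<union> E. w x y * drift_flux \<psi> u x y))"

section \<open>Sign, mass and moment of a single species\<close>

lemma species_tested:
  assumes "species a s u0 \<psi> u"
  shows "(\<Sum>x\<in>I. \<phi> x * (a x * (u x - u0 x) + s * u x)) =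
    (\<Sum>x\<in>I. \<Sum>y\<in>I. w x y * (drift_flux \<psi> u x y * (\<phi> x - \<phi> y))) / 2
    + (\<Sum>x\<in>I. \<Sum>e\<in>E. w x e * (\<phi> x * drift_flux \<psi> u x e))"
  using assms summation_by_parts[of "drift_flux \<psi> u" \<phi>, OF drift_flux_swap]
  by (simp add: species_def)

text \<open>Only B > 0 is used: each of the two terms of the flux takes its sign from its own
  density, so across the border of the region u < 0 the flux points inwards whatever the potential
  does. A nonnegative total inflow contradicts the strictly negative left-hand side of the tested
  equation.\<close>

lemma species_nonneg:
  assumes eq: "species a s u0 \<psi> u" and a: "\<And>x. x \<in> I \<Longrightarrow> 0 < a x" and s: "0 \<le> s"
    and u0: "\<And>x. x \<in> I \<Longrightarrow> 0 \<le> u0 x" and uE: "\<And>e. e \<in> E \<Longrightarrow> 0 \<le> u e" and x: "x \<in> I"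
  shows "0 \<le> u x"
proof (rule ccontr)
  assume neg: "\<not> 0 \<le> u x"
  define \<phi> where "\<phi> = (\<lambda>x. if u x < 0 then 1 else 0 :: real)"
  define l where "l = (\<lambda>z. \<phi> z * (a z * (u z - u0 z) + s * u z))"
  have l_neg: "l z < 0" if "z \<in> I" "u z < 0" for z
  proof -
    have "a z * (u z - u0 z) < 0"
      using that a[of z] u0[of z] by (intro mult_pos_neg) auto
    moreover have "s * u z \<le> 0"
      using that s by (intro mult_nonneg_nonpos) auto
    ultimately show ?thesis using that by (simp add: l_def \<phi>_def)
  qed
  have l_nonpos: "l z \<le> 0" if "z \<in> I" for z
    using l_neg[OF that] by (cases "u z < 0") (auto simp: l_def \<phi>_def)
  have "sum l I < 0"
    using sum_strict_mono_ex1[OF finite_I, of l "\<lambda>_. 0"] l_nonpos l_neg[OF x] neg x by auto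
  moreover have B: "(0 \<le> u y \<longrightarrow> 0 \<le> bernoulli_fun r * u y) \<and>
      (u y < 0 \<longrightarrow> bernoulli_fun r * u y < 0)" for y r
    using bernoulli_fun_pos[of r] by (simp add: mult_pos_neg)
  have nn1: "0 \<le> drift_flux \<psi> u z y * (\<phi> z - \<phi> y)" for z y
    using B[of y "\<psi> y - \<psi> z"] B[of z "\<psi> z - \<psi> y"]
    by (cases "u z < 0"; cases "u y < 0") (simp_all add: drift_flux_def \<phi>_def)
  have nn2: "0 \<le> \<phi> z * drift_flux \<psi> u z e" if "e \<in> E" for z e
    using B[of e "\<psi> e - \<psi> z"] B[of z "\<psi> z - \<psi> e"] uE[OF that]
    by (cases "u z < 0") (simp_all add: drift_flux_def \<phi>_def)
  have "0 \<le> (\<Sum>z\<in>I. \<Sum>y\<in>I. w z y * (drift_flux \<psi> u z y * (\<phi> z - \<phi> y)))"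
    by (rule sum_nonneg, rule sum_nonneg, rule mult_nonneg_nonneg[OF w_nonneg nn1]) blast+
  moreover have "0 \<le> (\<Sum>z\<in>I. \<Sum>e\<in>E. w z e * (\<phi> z * drift_flux \<psi> u z e))"
    by (rule sum_nonneg, rule sum_nonneg, rule mult_nonneg_nonneg[OF w_nonneg nn2]) blast+
  ultimately show False
    using species_tested[OF eq, of \<phi>] unfolding l_def by linarith
qed

text \<open>Tested with 1, the fluxes between cells cancel. The outflow through Dirichlet edges has
  a favourable sign and is dropped, so the potential survives only in the rate of inflow.\<close>

lemma species_mass:
  assumes eq: "species a s u0 \<psi> u" and s: "0 \<le> s" and u: "\<And>x. x \<in> I \<union> E \<Longrightarrow> 0 \<le> u x"
  shows "(\<Sum>x\<in>I. a x * u x) \<le>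
    (\<Sum>x\<in>I. a x * u0 x) + (\<Sum>x\<in>I. \<Sum>e\<in>E. w x e * (bernoulli_fun (\<psi> e - \<psi> x) * u e))"
proof -
  have "(\<Sum>x\<in>I. a x * (u x - u0 x)) \<le> (\<Sum>x\<in>I. a x * (u x - u0 x) + s * u x)"
    using s u by (intro sum_mono) auto
  also have "\<dots> = (\<Sum>x\<in>I. \<Sum>e\<in>E. w x e * drift_flux \<psi> u x e)"
    using species_tested[OF eq, of "\<lambda>_. 1"] by simp
  also have "\<dots> \<le> (\<Sum>x\<in>I. \<Sum>e\<in>E. w x e * (bernoulli_fun (\<psi> e - \<psi> x) * u e))"
    using u bernoulli_fun_nonneg
    by (intro sum_mono mult_left_mono w_nonneg) (simp_all add: drift_flux_def)
  finally show ?thesis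
    by (simp add: right_diff_distrib sum_subtractf)
qed

text \<open>By antisymmetry \<psi> x may be taken as the smaller value. Jumps from x to y have a
  rate that grows with the potential difference s, but they lower the moment and are dropped. Jumps
  from y to x raise it by at most s, at rate B(s), and s B(s) is bounded.\<close>

lemma drift_flux_moment_le:
  assumes "0 \<le> u x" "0 \<le> u y"
  shows "drift_flux \<psi> u x y * (max 0 (- \<psi> x) - max 0 (- \<psi> y)) \<le> 2 * (u x + u y)"
proof -
  have *: "drift_flux \<psi> u x y * (max 0 (- \<psi> x) - max 0 (- \<psi> y)) \<le> 2 * u y"
    if "\<psi> x \<le> \<psi> y" "0 \<le> u x" "0 \<le> u y" for x y
  proof -
    define d where "d = max 0 (- \<psi> x) - max 0 (- \<psi> y)"
    have d: "0 \<le> d" "d \<le> \<psi> y - \<psi> x" using that by (auto simp: d_def)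
    have "drift_flux \<psi> u x y * d \<le> bernoulli_fun (\<psi> y - \<psi> x) * u y * d"
      using that d bernoulli_fun_pos[of "\<psi> x - \<psi> y"]
      by (intro mult_right_mono) (auto simp: drift_flux_def)
    also have "\<dots> \<le> bernoulli_fun (\<psi> y - \<psi> x) * u y * (\<psi> y - \<psi> x)"
      using that d bernoulli_fun_pos[of "\<psi> y - \<psi> x"] by (intro mult_left_mono) auto
    also have "\<dots> = ((\<psi> y - \<psi> x) * bernoulli_fun (\<psi> y - \<psi> x)) * u y"
      by simp
    also have "\<dots> \<le> 2 * u y"
      using that mult_bernoulli_fun_le[of "\<psi> y - \<psi> x"] by (intro mult_right_mono) auto
    finally show ?thesis by (simp add: d_def)
  qed
  show ?thesis
  proof (cases "\<psi> x \<le> \<psi> y")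
    case True
    with *[OF True assms] assms show ?thesis by simp
  next
    case False
    then have "drift_flux \<psi> u y x * (max 0 (- \<psi> y) - max 0 (- \<psi> x)) \<le> 2 * u x"
      using assms by (intro *) auto
    moreover have "drift_flux \<psi> u y x * (max 0 (- \<psi> y) - max 0 (- \<psi> x)) =
        drift_flux \<psi> u x y * (max 0 (- \<psi> x) - max 0 (- \<psi> y))"
      using drift_flux_swap[of \<psi> u x y] by (simp add: algebra_simps)
    ultimately show ?thesis using assms by simp
  qed
qed

text \<open>The unknown potential survives on the right only in the initial term, and there
  linearly: jumps between cells are paid for by \<open>drift_flux_moment_le\<close>, inflow at
  Dirichlet edges by \<open>bernoulli_fun_neg_part_le\<close>.\<close>

lemma species_moment:
  assumes eq: "species a s u0 \<psi> u" and s: "0 \<le> s" and u: "\<And>x. x \<in> I \<union> E \<Longrightarrow> 0 \<le> u x"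
  shows "(\<Sum>x\<in>I. a x * u x * max 0 (- \<psi> x)) \<le>
    (\<Sum>x\<in>I. a x * u0 x * max 0 (- \<psi> x)) + (\<Sum>x\<in>I. \<Sum>y\<in>I. w x y * (u x + u y))
    + (\<Sum>x\<in>I. \<Sum>e\<in>E. w x e * ((2 + \<bar>\<psi> e\<bar>) * (1 + \<bar>\<psi> e\<bar>) * u e))"
proof -
  define \<phi> where "\<phi> = (\<lambda>x. max 0 (- \<psi> x))"
  have "(\<Sum>x\<in>I. \<phi> x * (a x * (u x - u0 x))) \<le> (\<Sum>x\<in>I. \<phi> x * (a x * (u x - u0 x) + s * u x))"
    using s u by (intro sum_mono mult_left_mono) (auto simp: \<phi>_def)
  also have "\<dots> = (\<Sum>x\<in>I. \<Sum>y\<in>I. w x y * (drift_flux \<psi> u x y * (\<phi> x - \<phi> y))) / 2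
    + (\<Sum>x\<in>I. \<Sum>e\<in>E. w x e * (\<phi> x * drift_flux \<psi> u x e))"
    by (rule species_tested[OF eq])
  also have "\<dots> \<le> (\<Sum>x\<in>I. \<Sum>y\<in>I. w x y * (2 * (u x + u y))) / 2
    + (\<Sum>x\<in>I. \<Sum>e\<in>E. w x e * ((2 + \<bar>\<psi> e\<bar>) * (1 + \<bar>\<psi> e\<bar>) * u e))"
  proof (intro add_mono divide_right_mono sum_mono mult_left_mono w_nonneg)
    show "drift_flux \<psi> u x y * (\<phi> x - \<phi> y) \<le> 2 * (u x + u y)" if "x \<in> I" "y \<in> I" for x y
      unfolding \<phi>_def using that u by (intro drift_flux_moment_le) auto
    show "\<phi> x * drift_flux \<psi> u x e \<le> (2 + \<bar>\<psi> e\<bar>) * (1 + \<bar>\<psi> e\<bar>) * u e" if "x \<in> I" "e \<in> E" for x e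
    proof -
      have "\<phi> x * drift_flux \<psi> u x e \<le> \<phi> x * (bernoulli_fun (\<psi> e - \<psi> x) * u e)"
        using that u bernoulli_fun_pos[of "\<psi> x - \<psi> e"]
        by (intro mult_left_mono) (auto simp: drift_flux_def \<phi>_def)
      also have "\<dots> = (bernoulli_fun (\<psi> e - \<psi> x) * max 0 (- \<psi> x)) * u e"
        by (simp add: \<phi>_def)
      also have "\<dots> \<le> (2 + \<bar>\<psi> e\<bar>) * (1 + \<bar>\<psi> e\<bar>) * u e"
        using that u by (intro mult_right_mono bernoulli_fun_neg_part_le) auto
      finally show ?thesis .
    qed
  qed auto
  also have "(\<Sum>x\<in>I. \<Sum>y\<in>I. w x y * (2 * (u x + u y))) / 2 = (\<Sum>x\<in>I. \<Sum>y\<in>I. w x y * (u x + u y))"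
    unfolding sum_divide_distrib by (intro sum.cong refl) simp
  finally show ?thesis
    by (simp add: \<phi>_def right_diff_distrib sum_subtractf algebra_simps)
qed

text \<open>The constant is chosen before \<open>s\<close>, \<psi> and \<open>u\<close>, as the
  homotopy requires. Mass comes first: divided by \<open>a x\<close> it bounds each value, and these
  bounds feed the jump terms of the moment.\<close>

lemma species_bounds:
  assumes a: "\<And>x. x \<in> I \<Longrightarrow> 0 < a x" and u0: "\<And>x. x \<in> I \<Longrightarrow> 0 \<le> u0 x"
    and uE: "\<And>e. e \<in> E \<Longrightarrow> 0 \<le> uE e"
  shows "\<exists>C\<ge>0. \<forall>s \<psi> u. 0 \<le> s \<longrightarrow> (\<forall>e\<in>E. \<psi> e = \<psi>E e \<and> u e = uE e) \<longrightarrow> species a s u0 \<psi> u \<longrightarrow>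
    (\<forall>x\<in>I. 0 \<le> u x) \<and> (\<Sum>x\<in>I. a x * u x) \<le> C * (1 + (\<Sum>x\<in>I. \<bar>\<psi> x\<bar>)) \<and>
    (\<Sum>x\<in>I. a x * u x * max 0 (- \<psi> x)) \<le> C * (1 + (\<Sum>x\<in>I. \<bar>\<psi> x\<bar>))"
proof -
  \<comment> \<open>Up to a factor 1 + L, where L is the sum of |\<psi> x|, \<open>C1\<close> bounds
    the mass by initial mass and inflow, \<open>C2\<close> the jumps between cells with
    \<open>u x\<close> replaced by its bound \<open>C1 / a x\<close>, and \<open>C3\<close> the
    moment brought in at Dirichlet edges.\<close>
  define C0 where "C0 = (\<Sum>x\<in>I. a x * u0 x)"
  define C1 where "C1 = C0 + (\<Sum>x\<in>I. \<Sum>e\<in>E. w x e * ((1 + \<bar>\<psi>E e\<bar>) * uE e))"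
  define C2 where "C2 = (\<Sum>x\<in>I. \<Sum>y\<in>I. w x y * (C1 / a x + C1 / a y))"
  define C3 where "C3 = (\<Sum>x\<in>I. \<Sum>e\<in>E. w x e * ((2 + \<bar>\<psi>E e\<bar>) * (1 + \<bar>\<psi>E e\<bar>) * uE e))"
  have C0: "0 \<le> C0"
    unfolding C0_def by (intro sum_nonneg mult_nonneg_nonneg less_imp_le[OF a] u0)
  have C1: "0 \<le> C1"
    unfolding C1_def by (intro add_nonneg_nonneg C0 sum_nonneg mult_nonneg_nonneg w_nonneg uE) auto
  have C2: "0 \<le> C2"
    unfolding C2_def
    by (intro add_nonneg_nonneg sum_nonneg mult_nonneg_nonneg w_nonneg divide_nonneg_pos C1 a) auto
  have C3: "0 \<le> C3"
    unfolding C3_def by (intro sum_nonneg mult_nonneg_nonneg w_nonneg uE) auto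
  define C where "C = C1 + (C0 + C2 + C3)"
  have "(\<forall>x\<in>I. 0 \<le> u x) \<and> (\<Sum>x\<in>I. a x * u x) \<le> C * (1 + (\<Sum>x\<in>I. \<bar>\<psi> x\<bar>)) \<and>
    (\<Sum>x\<in>I. a x * u x * max 0 (- \<psi> x)) \<le> C * (1 + (\<Sum>x\<in>I. \<bar>\<psi> x\<bar>))"
    if s: "0 \<le> s" and bd: "\<forall>e\<in>E. \<psi> e = \<psi>E e \<and> u e = uE e" and eq: "species a s u0 \<psi> u"
    for s \<psi> u
  proof -
    define L where "L = (\<Sum>x\<in>I. \<bar>\<psi> x\<bar>)"
    have L: "0 \<le> L" by (simp add: L_def sum_nonneg)
    have xL: "\<bar>\<psi> x\<bar> \<le> L" if "x \<in> I" for x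
      unfolding L_def using member_le_sum[OF that, of "\<lambda>x. \<bar>\<psi> x\<bar>"] finite_I by auto
    have uI: "0 \<le> u x" if "x \<in> I" for x
      using species_nonneg[OF eq a s u0 _ that] uE bd by auto
    then have u: "0 \<le> u x" if "x \<in> I \<union> E" for x
      using that uE bd by auto
    have "(\<Sum>x\<in>I. a x * u x) \<le>
        C0 + (\<Sum>x\<in>I. \<Sum>e\<in>E. w x e * (bernoulli_fun (\<psi> e - \<psi> x) * u e))"
      unfolding C0_def by (rule species_mass[OF eq s u])
    also have "\<dots> \<le> C0 * (1 + L) + (\<Sum>x\<in>I. \<Sum>e\<in>E. w x e * ((1 + \<bar>\<psi>E e\<bar>) * uE e * (1 + L)))"
    proof (intro add_mono sum_mono mult_left_mono w_nonneg)
      show "C0 \<le> C0 * (1 + L)" using C0 L by (simp add: distrib_left)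
      fix x e assume x: "x \<in> I" and e: "e \<in> E"
      have "bernoulli_fun (\<psi> e - \<psi> x) \<le> 1 + \<bar>\<psi> e - \<psi> x\<bar>"
        by (rule bernoulli_fun_le)
      also have "\<dots> \<le> 1 + \<bar>\<psi>E e\<bar> + L"
        using xL[OF x] bd e abs_triangle_ineq4[of "\<psi> e" "\<psi> x"] by auto
      also have "\<dots> \<le> (1 + \<bar>\<psi>E e\<bar>) * (1 + L)"
        using L by (simp add: algebra_simps)
      finally have "bernoulli_fun (\<psi> e - \<psi> x) * uE e \<le> ((1 + \<bar>\<psi>E e\<bar>) * (1 + L)) * uE e"
        using uE[OF e] by (rule mult_right_mono)
      then show "bernoulli_fun (\<psi> e - \<psi> x) * u e \<le> (1 + \<bar>\<psi>E e\<bar>) * uE e * (1 + L)"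
        using bd e by (simp add: mult_ac)
    qed auto
    also have "\<dots> = C1 * (1 + L)"
      unfolding C1_def distrib_right[of C0] sum_distrib_right by (simp add: mult_ac)
    finally have mass: "(\<Sum>x\<in>I. a x * u x) \<le> C1 * (1 + L)" .
    have uC1: "u x \<le> C1 / a x * (1 + L)" if "x \<in> I" for x
    proof -
      have "a x * u x \<le> (\<Sum>x\<in>I. a x * u x)"
        using member_le_sum[OF that, of "\<lambda>x. a x * u x"] finite_I uI a by (auto simp: less_imp_le)
      with mass have "a x * u x \<le> C1 * (1 + L)" by simp
      then show ?thesis using a[OF that] by (simp add: field_simps)
    qed
    have "(\<Sum>x\<in>I. a x * u x * max 0 (- \<psi> x)) \<le>
        (\<Sum>x\<in>I. a x * u0 x * max 0 (- \<psi> x)) + (\<Sum>x\<in>I. \<Sum>y\<in>I. w x y * (u x + u y))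
        + (\<Sum>x\<in>I. \<Sum>e\<in>E. w x e * ((2 + \<bar>\<psi> e\<bar>) * (1 + \<bar>\<psi> e\<bar>) * u e))"
      by (rule species_moment[OF eq s u])
    also have "(\<Sum>x\<in>I. \<Sum>e\<in>E. w x e * ((2 + \<bar>\<psi> e\<bar>) * (1 + \<bar>\<psi> e\<bar>) * u e)) = C3"
      unfolding C3_def using bd by (intro sum.cong refl) auto
    also have "(\<Sum>x\<in>I. a x * u0 x * max 0 (- \<psi> x)) + (\<Sum>x\<in>I. \<Sum>y\<in>I. w x y * (u x + u y)) + C3
      \<le> (\<Sum>x\<in>I. a x * u0 x * (1 + L)) + (\<Sum>x\<in>I. \<Sum>y\<in>I. w x y * ((C1 / a x + C1 / a y) * (1 + L)))
        + C3 * (1 + L)"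
    proof (intro add_mono sum_mono mult_left_mono w_nonneg)
      show "max 0 (- \<psi> x) \<le> 1 + L" if "x \<in> I" for x
        using xL[OF that] L by auto
      show "u x + u y \<le> (C1 / a x + C1 / a y) * (1 + L)" if "x \<in> I" "y \<in> I" for x y
        using uC1[OF that(1)] uC1[OF that(2)] by (simp add: distrib_right)
      show "C3 \<le> C3 * (1 + L)" using C3 L by (simp add: distrib_left)
      show "0 \<le> a x * u0 x" if "x \<in> I" for x
        using a[OF that] u0[OF that] by simp
    qed auto
    also have "\<dots> = (C0 + C2 + C3) * (1 + L)"
      unfolding C0_def C2_def distrib_right[of "_ + _" _ "1 + L"] distrib_right[of "sum _ _" _ "1 + L"] 
        sum_distrib_right by (simp only: mult.assoc)
    finally have moment: "(\<Sum>x\<in>I. a x * u x * max 0 (- \<psi> x)) \<le> (C0 + C2 + C3) * (1 + L)" .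
    have "C1 * (1 + L) \<le> C * (1 + L)" "(C0 + C2 + C3) * (1 + L) \<le> C * (1 + L)"
      using L C0 C1 C2 C3 by (intro mult_right_mono; simp add: C_def)+
    with mass moment uI show ?thesis
      unfolding L_def by force
  qed
  moreover have "0 \<le> C" using C0 C1 C2 C3 by (simp add: C_def)
  ultimately show ?thesis by blast
qed

section \<open>Coercivity and strict positivity from connectedness\<close>

text \<open>A discrete Poincare inequality without explicit constant. The form controls V at the
  cell \<open>x0\<close> touching a Dirichlet edge, and control passes from x to y along a positive
  weight through (V y)^2 <= 2 (V x)^2 + 2 (V y - V x)^2. By connectedness the controlled set cannot
  stop short of all cells.\<close>

lemma dirichlet_form_coercive:
  assumes conn: "\<And>S. S \<subseteq> I \<Longrightarrow> S \<noteq> {} \<Longrightarrow> S \<noteq> I \<Longrightarrow> \<exists>x\<in>S. \<exists>y\<in>I - S. 0 < w x y"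
    and ground: "x0 \<in> I" "e0 \<in> E" "0 < w x0 e0"
  shows "\<exists>K\<ge>0. \<forall>V. \<forall>x\<in>I. (V x)\<^sup>2 \<le>
    K * ((\<Sum>x\<in>I. \<Sum>y\<in>I. w x y * (V y - V x)\<^sup>2) + (\<Sum>x\<in>I. \<Sum>e\<in>E. w x e * (V x)\<^sup>2))"
proof -
  define \<Phi> where "\<Phi> = (\<lambda>V. (\<Sum>x\<in>I. \<Sum>y\<in>I. w x y * (V y - V x)\<^sup>2) + (\<Sum>x\<in>I. \<Sum>e\<in>E. w x e * (V x)\<^sup>2))"
  have int: "w x y * (V y - V x)\<^sup>2 \<le> \<Phi> V" if "x \<in> I" "y \<in> I" for V x y
  proof -
    have "w x y * (V y - V x)\<^sup>2 \<le> (\<Sum>y\<in>I. w x y * (V y - V x)\<^sup>2)"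
      using that finite_I w_nonneg by (intro member_le_sum) auto
    also have "\<dots> \<le> (\<Sum>x\<in>I. \<Sum>y\<in>I. w x y * (V y - V x)\<^sup>2)"
      using that finite_I w_nonneg by (intro member_le_sum sum_nonneg) auto
    also have "\<dots> \<le> \<Phi> V"
      unfolding \<Phi>_def using w_nonneg by (auto intro!: sum_nonneg)
    finally show ?thesis .
  qed
  have ext: "w x e * (V x)\<^sup>2 \<le> \<Phi> V" if "x \<in> I" "e \<in> E" for V x e
  proof -
    have "w x e * (V x)\<^sup>2 \<le> (\<Sum>e\<in>E. w x e * (V x)\<^sup>2)"
      using that finite_E w_nonneg by (intro member_le_sum[where f = "\<lambda>e. w x e * (V x)\<^sup>2"]) auto
    also have "\<dots> \<le> (\<Sum>x\<in>I. \<Sum>e\<in>E. w x e * (V x)\<^sup>2)"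
      using that finite_I w_nonneg
      by (intro member_le_sum[where f = "\<lambda>x. \<Sum>e\<in>E. w x e * (V x)\<^sup>2"] sum_nonneg) auto
    also have "\<dots> \<le> \<Phi> V"
      unfolding \<Phi>_def using w_nonneg by (auto intro!: sum_nonneg)
    finally show ?thesis .
  qed
  have \<Phi>: "0 \<le> \<Phi> V" for V
    unfolding \<Phi>_def using w_nonneg by (intro add_nonneg_nonneg sum_nonneg mult_nonneg_nonneg) auto
  define S where "S = {x\<in>I. \<exists>K\<ge>0. \<forall>V. (V x)\<^sup>2 \<le> K * \<Phi> V}"
  have "x0 \<in> S"
    unfolding S_def using ground ext[OF ground(1,2)]
    by (auto intro!: exI[of _ "1 / w x0 e0"] simp: field_simps)
  have "S = I"
  proof (rule ccontr)
    assume "S \<noteq> I"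
    moreover have "S \<subseteq> I" by (auto simp: S_def)
    ultimately obtain x y where xy: "x \<in> S" "y \<in> I - S" "0 < w x y"
      using conn[of S] \<open>x0 \<in> S\<close> by blast
    then obtain K where K: "K \<ge> 0" "\<And>V. (V x)\<^sup>2 \<le> K * \<Phi> V" by (auto simp: S_def)
    have "(V y)\<^sup>2 \<le> (2 * K + 2 / w x y) * \<Phi> V" for V
    proof -
      have "(V y)\<^sup>2 = (V x + (V y - V x))\<^sup>2" by simp
      also have "\<dots> \<le> 2 * (V x)\<^sup>2 + 2 * (V y - V x)\<^sup>2"
        using sum_squares_ge_zero[of "V x - (V y - V x)" 0] by (simp add: power2_eq_square algebra_simps)
      also have "(V y - V x)\<^sup>2 \<le> \<Phi> V / w x y"
        using int[of x y V] xy by (auto simp: S_def field_simps)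
      also have "(V x)\<^sup>2 \<le> K * \<Phi> V" by (rule K)
      finally show ?thesis by (simp add: algebra_simps)
    qed
    then have "y \<in> S"
      using xy K by (auto simp: S_def intro!: exI[of _ "2 * K + 2 / w x y"])
    with xy show False by blast
  qed
  then have "\<forall>x\<in>I. \<exists>K\<ge>0. \<forall>V. (V x)\<^sup>2 \<le> K * \<Phi> V"
    by (auto simp: S_def)
  then obtain k where k: "\<And>x. x \<in> I \<Longrightarrow> 0 \<le> k x" "\<And>x V. x \<in> I \<Longrightarrow> (V x)\<^sup>2 \<le> k x * \<Phi> V"
    by metis
  have "(V x)\<^sup>2 \<le> sum k I * \<Phi> V" if "x \<in> I" for x V
  proof -
    have "k x * \<Phi> V \<le> sum k I * \<Phi> V"
      using that k finite_I \<Phi> by (intro mult_right_mono member_le_sum) auto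
    with k(2)[OF that, of V] show ?thesis by simp
  qed
  then show ?thesis
    unfolding \<Phi>_def using k by (intro exI[of _ "sum k I"]) (auto intro: sum_nonneg)
qed

text \<open>A discrete strong maximum principle. Where \<open>u\<close> vanishes there is no
  outflow, and the balance equates minus the initial content with the inflow; both must be zero. So
  the zero set has no neighbour with positive density and carries no initial mass, and connectedness
  would make it all of \<open>I\<close>.\<close>

lemma species_pos:
  assumes conn: "\<And>S. S \<subseteq> I \<Longrightarrow> S \<noteq> {} \<Longrightarrow> S \<noteq> I \<Longrightarrow> \<exists>x\<in>S. \<exists>y\<in>I - S. 0 < w x y"
    and eq: "species a 0 u0 \<psi> u" and a: "\<And>x. x \<in> I \<Longrightarrow> 0 < a x"
    and u0: "\<And>x. x \<in> I \<Longrightarrow> 0 \<le> u0 x" "\<exists>x\<in>I. 0 < u0 x"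
    and u: "\<And>x. x \<in> I \<union> E \<Longrightarrow> 0 \<le> u x" and x: "x \<in> I"
  shows "0 < u x"
proof (rule ccontr)
  define Z where "Z = {x\<in>I. u x = 0}"
  assume "\<not> 0 < u x"
  then have "x \<in> Z" using u[of x] x by (auto simp: Z_def)
  have bal: "- (a z * u0 z) = (\<Sum>y\<in>I \<union> E. w z y * (bernoulli_fun (\<psi> y - \<psi> z) * u y))" if "z \<in> Z" for z
    using eq that by (auto simp: species_def Z_def drift_flux_def)
  have nn: "0 \<le> w z y * (bernoulli_fun (\<psi> y - \<psi> z) * u y)" if "z \<in> I" "y \<in> I \<union> E" for z y
    using w_nonneg[OF that] u[OF that(2)] bernoulli_fun_nonneg by simp
  have null: "u0 z = 0" if "z \<in> Z" for z
  proof -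
    have "0 \<le> (\<Sum>y\<in>I \<union> E. w z y * (bernoulli_fun (\<psi> y - \<psi> z) * u y))"
      using that nn by (intro sum_nonneg) (auto simp: Z_def)
    with bal[OF that] have "a z * u0 z \<le> 0" by simp
    then show ?thesis
      using that a[of z] u0(1)[of z] by (auto simp: Z_def mult_le_0_iff)
  qed
  with u0 have "Z \<noteq> I" by force
  then obtain z y where zy: "z \<in> Z" "y \<in> I - Z" "0 < w z y"
    using conn[of Z] \<open>x \<in> Z\<close> by (auto simp: Z_def)
  have "0 < w z y * (bernoulli_fun (\<psi> y - \<psi> z) * u y)"
    using zy u[of y] bernoulli_fun_pos by (intro mult_pos_pos) (auto simp: Z_def less_le)
  also have "\<dots> \<le> (\<Sum>y\<in>I \<union> E. w z y * (bernoulli_fun (\<psi> y - \<psi> z) * u y))"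
    using zy nn finite_I finite_E
    by (intro member_le_sum[where f = "\<lambda>y. w z y * (bernoulli_fun (\<psi> y - \<psi> z) * u y)"]) (auto simp: Z_def)
  finally show False
    using bal[OF zy(1)] null[OF zy(1)] by simp
qed

section \<open>The Poisson equation and the coupled system\<close>

text \<open>The homotopy term stands on the side of the charge, so that testing with
  \<open>V\<close> produces s V^2 with the sign that helps the energy estimate.\<close>

definition poisson ::
    "real \<Rightarrow> ('n \<Rightarrow> real) \<Rightarrow> real \<Rightarrow> ('n \<Rightarrow> real) \<Rightarrow> ('n \<Rightarrow> real) \<Rightarrow> bool" where
  "poisson \<kappa> m s \<rho> V \<longleftrightarrow>
    (\<forall>x\<in>I. \<kappa> * (\<Sum>y\<in>I \<union> E. w x y * (V y - V x)) = m x * \<rho> x + s * V x)"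

text \<open>After testing with V, Young's inequality for V x * V e moves the boundary data to the
  right and leaves half of (V x)^2 on the left, which is what grounds the form. The factor 2
  reflects that each pair of cells is counted twice.\<close>

lemma poisson_energy:
  assumes eq: "poisson \<kappa> m s \<rho> V" and \<kappa>: "0 < \<kappa>" and s: "0 \<le> s"
  shows "(\<Sum>x\<in>I. \<Sum>y\<in>I. w x y * (V y - V x)\<^sup>2) + (\<Sum>x\<in>I. \<Sum>e\<in>E. w x e * (V x)\<^sup>2)
    \<le> (\<Sum>x\<in>I. \<Sum>e\<in>E. w x e * (V e)\<^sup>2) - 2 / \<kappa> * (\<Sum>x\<in>I. m x * \<rho> x * V x)"
proof -
  define a where "a = (\<Sum>x\<in>I. \<Sum>y\<in>I. w x y * (V y - V x)\<^sup>2)"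
  define b where "b = (\<Sum>x\<in>I. \<Sum>e\<in>E. w x e * (V x)\<^sup>2)"
  define c where "c = (\<Sum>x\<in>I. \<Sum>e\<in>E. w x e * (V e)\<^sup>2)"
  have "(\<Sum>x\<in>I. V x * (\<Sum>y\<in>I \<union> E. w x y * (V y - V x))) =
      (\<Sum>x\<in>I. \<Sum>y\<in>I. w x y * ((V y - V x) * (V x - V y))) / 2
      + (\<Sum>x\<in>I. \<Sum>e\<in>E. w x e * (V x * (V e - V x)))"
    by (rule summation_by_parts) simp
  also have "(\<Sum>x\<in>I. \<Sum>y\<in>I. w x y * ((V y - V x) * (V x - V y))) = - a"
    unfolding a_def sum_negf[symmetric]
    by (intro sum.cong refl) (simp add: power2_eq_square algebra_simps)
  also have "(\<Sum>x\<in>I. \<Sum>e\<in>E. w x e * (V x * (V e - V x))) \<le>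
      (\<Sum>x\<in>I. \<Sum>e\<in>E. w x e * ((V e)\<^sup>2 / 2 - (V x)\<^sup>2 / 2))"
  proof (intro sum_mono mult_left_mono w_nonneg)
    show "V x * (V e - V x) \<le> (V e)\<^sup>2 / 2 - (V x)\<^sup>2 / 2" for x e
      using sum_squares_ge_zero[of "V e - V x" 0] by (simp add: power2_eq_square algebra_simps)
  qed auto
  also have "\<dots> = c / 2 - b / 2"
    by (simp add: b_def c_def sum_divide_distrib right_diff_distrib sum_subtractf)
  finally have le: "(\<Sum>x\<in>I. V x * (\<Sum>y\<in>I \<union> E. w x y * (V y - V x))) \<le> - a / 2 + (c / 2 - b / 2)"
    by simp
  have "(\<Sum>x\<in>I. m x * \<rho> x * V x) \<le> (\<Sum>x\<in>I. V x * (m x * \<rho> x + s * V x))"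
    using s by (intro sum_mono) (auto simp: algebra_simps)
  also have "\<dots> = (\<Sum>x\<in>I. \<kappa> * (V x * (\<Sum>y\<in>I \<union> E. w x y * (V y - V x))))"
    using eq by (intro sum.cong refl) (simp add: poisson_def)
  also have "\<dots> \<le> \<kappa> * (- a / 2 + (c / 2 - b / 2))"
    unfolding sum_distrib_left[symmetric] using \<kappa> le by (intro mult_left_mono) auto
  finally have "2 / \<kappa> * (\<Sum>x\<in>I. m x * \<rho> x * V x) \<le> 2 / \<kappa> * (\<kappa> * (- a / 2 + (c / 2 - b / 2)))"
    using \<kappa> by (intro mult_left_mono) auto
  also have "\<dots> = c - a - b"
    using \<kappa> by (simp add: algebra_simps)
  finally show ?thesis
    by (simp add: a_def b_def c_def)
qed

text \<open>In the pairing of charge and potential the N and P terms are covered by their moments,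
  the Q term by the mass bound \<open>CQ\<close>, which is free of the potential since
  \<open>E\<close> is empty there, and the doping term directly. All are linear in V, while the
  energy is quadratic, so V is bounded; the densities then follow from their masses.\<close>

lemma scheme_apriori:
  fixes A N0 P0 Q0 nE pE vE :: "'n \<Rightarrow> real"
  assumes conn: "\<And>S. S \<subseteq> I \<Longrightarrow> S \<noteq> {} \<Longrightarrow> S \<noteq> I \<Longrightarrow> \<exists>x\<in>S. \<exists>y\<in>I - S. 0 < w x y"
    and ground: "x0 \<in> I" "e0 \<in> E" "0 < w x0 e0"
    and \<kappa>: "0 < \<kappa>" and dt: "0 < dt" and m: "\<And>x. x \<in> I \<Longrightarrow> 0 < m x"
    and init: "\<And>x. x \<in> I \<Longrightarrow> 0 \<le> N0 x" "\<And>x. x \<in> I \<Longrightarrow> 0 \<le> P0 x" "\<And>x. x \<in> I \<Longrightarrow> 0 \<le> Q0 x"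
    and bdry: "\<And>e. e \<in> E \<Longrightarrow> 0 \<le> nE e" "\<And>e. e \<in> E \<Longrightarrow> 0 \<le> pE e"
  shows "\<exists>R. \<forall>s N P Q V. 0 \<le> s \<longrightarrow> (\<forall>e\<in>E. N e = nE e \<and> P e = pE e \<and> V e = vE e) \<longrightarrow>
    species (\<lambda>x. m x / dt) s N0 V N \<longrightarrow>
    species (\<lambda>x. m x / dt) s P0 (\<lambda>x. - V x) P \<longrightarrow>
    weighted_graph.species I {} w (\<lambda>x. m x / dt) s Q0 (\<lambda>x. - V x) Q \<longrightarrow>
    poisson \<kappa> m s (\<lambda>x. N x - P x - Q x + A x) V \<longrightarrow>
    (\<forall>x\<in>I. \<bar>N x\<bar> \<le> R \<and> \<bar>P x\<bar> \<le> R \<and> \<bar>Q x\<bar> \<le> R \<and> \<bar>V x\<bar> \<le> R)"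
proof -
  interpret insulated: weighted_graph I "{}" w
  proof (rule weighted_graph.intro)
    show "w x y = w y x" if "x \<in> I" "y \<in> I" for x y
      by (rule w_sym[OF that])
  qed (auto simp: finite_I w_nonneg)
  define a where "a = (\<lambda>x. m x / dt)"
  have a: "0 < a x" if "x \<in> I" for x using m[OF that] dt by (simp add: a_def)
  have ma: "m x = dt * a x" for x using dt by (simp add: a_def)
  have "\<exists>C\<ge>0. \<forall>s \<psi> u. 0 \<le> s \<longrightarrow> (\<forall>e\<in>E. \<psi> e = vE e \<and> u e = nE e) \<longrightarrow> species a s N0 \<psi> u \<longrightarrow>
    (\<forall>x\<in>I. 0 \<le> u x) \<and> (\<Sum>x\<in>I. a x * u x) \<le> C * (1 + (\<Sum>x\<in>I. \<bar>\<psi> x\<bar>)) \<and>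
    (\<Sum>x\<in>I. a x * u x * max 0 (- \<psi> x)) \<le> C * (1 + (\<Sum>x\<in>I. \<bar>\<psi> x\<bar>))"
    by (rule species_bounds; fact a init(1) bdry(1))
  then obtain CN where CN: "0 \<le> CN" "\<forall>s \<psi> u. 0 \<le> s \<longrightarrow> (\<forall>e\<in>E. \<psi> e = vE e \<and> u e = nE e) \<longrightarrow> species a s N0 \<psi> u \<longrightarrow>
    (\<forall>x\<in>I. 0 \<le> u x) \<and> (\<Sum>x\<in>I. a x * u x) \<le> CN * (1 + (\<Sum>x\<in>I. \<bar>\<psi> x\<bar>)) \<and>
    (\<Sum>x\<in>I. a x * u x * max 0 (- \<psi> x)) \<le> CN * (1 + (\<Sum>x\<in>I. \<bar>\<psi> x\<bar>))"
    by (elim exE conjE) (rule that)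
  have "\<exists>C\<ge>0. \<forall>s \<psi> u. 0 \<le> s \<longrightarrow> (\<forall>e\<in>E. \<psi> e = - vE e \<and> u e = pE e) \<longrightarrow> species a s P0 \<psi> u \<longrightarrow>
    (\<forall>x\<in>I. 0 \<le> u x) \<and> (\<Sum>x\<in>I. a x * u x) \<le> C * (1 + (\<Sum>x\<in>I. \<bar>\<psi> x\<bar>)) \<and>
    (\<Sum>x\<in>I. a x * u x * max 0 (- \<psi> x)) \<le> C * (1 + (\<Sum>x\<in>I. \<bar>\<psi> x\<bar>))"
    by (rule species_bounds; fact a init(2) bdry(2))
  then obtain CP where CP: "0 \<le> CP" "\<forall>s \<psi> u. 0 \<le> s \<longrightarrow> (\<forall>e\<in>E. \<psi> e = - vE e \<and> u e = pE e) \<longrightarrow> species a s P0 \<psi> u \<longrightarrow>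
    (\<forall>x\<in>I. 0 \<le> u x) \<and> (\<Sum>x\<in>I. a x * u x) \<le> CP * (1 + (\<Sum>x\<in>I. \<bar>\<psi> x\<bar>)) \<and>
    (\<Sum>x\<in>I. a x * u x * max 0 (- \<psi> x)) \<le> CP * (1 + (\<Sum>x\<in>I. \<bar>\<psi> x\<bar>))"
    by (elim exE conjE) (rule that)
  have "\<exists>K\<ge>0. \<forall>V. \<forall>x\<in>I. (V x)\<^sup>2 \<le>
    K * ((\<Sum>x\<in>I. \<Sum>y\<in>I. w x y * (V y - V x)\<^sup>2) + (\<Sum>x\<in>I. \<Sum>e\<in>E. w x e * (V x)\<^sup>2))"
    by (rule dirichlet_form_coercive[OF _ ground]; fact conn)
  then obtain K where K: "0 \<le> K" "\<forall>V. \<forall>x\<in>I. (V x)\<^sup>2 \<le>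
    K * ((\<Sum>x\<in>I. \<Sum>y\<in>I. w x y * (V y - V x)\<^sup>2) + (\<Sum>x\<in>I. \<Sum>e\<in>E. w x e * (V x)\<^sup>2))"
    by (elim exE conjE) (rule that)
  define CQ where "CQ = (\<Sum>x\<in>I. a x * Q0 x)"
  define CA where "CA = (\<Sum>x\<in>I. m x * \<bar>A x\<bar>)"
  define CE where "CE = (\<Sum>x\<in>I. \<Sum>e\<in>E. w x e * (vE e)\<^sup>2)"
  \<comment> \<open>With L the sum of |V x|, the energy is at most C (1 + L), whence L^2 <= c (1 +
    L). In \<open>c\<close> one factor \<open>card I\<close> comes from Cauchy-Schwarz, the other
    from summing the coercivity estimate over the cells.\<close>
  define C where "C = CE + 2 / \<kappa> * (dt * CN + dt * CP + dt * CQ + CA)"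
  define c where "c = real (card I) * (real (card I) * (K * C))"
  define L0 where "L0 = 1 + 2 * c"
  define r where "r = (\<Sum>x\<in>I. 1 / a x)"
  define R where "R = L0 + (CN * (1 + L0) + CP * (1 + L0) + CQ) * r"
  have pos: "0 \<le> CQ" "0 \<le> CA" "0 \<le> CE" "0 \<le> r"
    unfolding CQ_def CA_def CE_def r_def using w_nonneg
    by (auto intro!: sum_nonneg mult_nonneg_nonneg less_imp_le[OF a] less_imp_le[OF m] init)
  have C: "0 \<le> C" using pos CN CP \<kappa> dt by (simp add: C_def)
  have c: "0 \<le> c" using C K by (simp add: c_def)
  have "\<bar>N x\<bar> \<le> R \<and> \<bar>P x\<bar> \<le> R \<and> \<bar>Q x\<bar> \<le> R \<and> \<bar>V x\<bar> \<le> R"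
    if s: "0 \<le> s" and bd: "\<forall>e\<in>E. N e = nE e \<and> P e = pE e \<and> V e = vE e"
      and eqs: "species a s N0 V N" "species a s P0 (\<lambda>x. - V x) P"
        "insulated.species a s Q0 (\<lambda>x. - V x) Q" 
        "poisson \<kappa> m s (\<lambda>x. N x - P x - Q x + A x) V"
      and x: "x \<in> I"
    for s N P Q V x
  proof -
    define L where "L = (\<Sum>x\<in>I. \<bar>V x\<bar>)"
    have L: "0 \<le> L" by (simp add: L_def sum_nonneg)
    have xL: "\<bar>V x\<bar> \<le> L" if "x \<in> I" for x
      unfolding L_def using member_le_sum[OF that, of "\<lambda>x. \<bar>V x\<bar>"] finite_I by auto
    have N: "\<forall>x\<in>I. 0 \<le> N x" "(\<Sum>x\<in>I. a x * N x) \<le> CN * (1 + L)"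
      "(\<Sum>x\<in>I. a x * N x * max 0 (- V x)) \<le> CN * (1 + L)"
      using CN(2)[rule_format, OF s _ eqs(1)] bd by (auto simp: L_def)
    have P: "\<forall>x\<in>I. 0 \<le> P x" "(\<Sum>x\<in>I. a x * P x) \<le> CP * (1 + L)"
      "(\<Sum>x\<in>I. a x * P x * max 0 (V x)) \<le> CP * (1 + L)"
      using CP(2)[rule_format, OF s _ eqs(2)] bd by (auto simp: L_def)
    have Q: "\<forall>x\<in>I. 0 \<le> Q x"
      using insulated.species_nonneg[OF eqs(3) a s init(3)] by auto
    have Qm: "(\<Sum>x\<in>I. a x * Q x) \<le> CQ"
      using insulated.species_mass[OF eqs(3) s] Q by (simp add: CQ_def)
    have "- (\<Sum>x\<in>I. m x * (N x - P x - Q x + A x) * V x) \<le>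
        (\<Sum>x\<in>I. dt * (a x * N x * max 0 (- V x)) + dt * (a x * P x * max 0 (V x))
          + dt * (a x * Q x) * L + (m x * \<bar>A x\<bar>) * L)"
      unfolding sum_negf[symmetric]
    proof (rule sum_mono)
      fix x assume x: "x \<in> I"
      have "- (m x * (N x - P x - Q x + A x) * V x) =
          (m x * N x) * (- V x) + (m x * P x) * V x + (m x * Q x) * V x + m x * (- A x * V x)"
        by (simp add: algebra_simps)
      also have "\<dots> \<le> (m x * N x) * max 0 (- V x) + (m x * P x) * max 0 (V x)
          + (m x * Q x) * L + m x * (\<bar>A x\<bar> * L)"
      proof (intro add_mono mult_left_mono)
        have "- A x * V x \<le> \<bar>A x\<bar> * \<bar>V x\<bar>"
          by (metis abs_ge_minus_self abs_mult mult_minus_left)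
        also have "\<dots> \<le> \<bar>A x\<bar> * L" using xL[OF x] by (intro mult_left_mono) auto
        finally show "- A x * V x \<le> \<bar>A x\<bar> * L" .
      qed (use xL[OF x] m[OF x] x N P Q in \<open>auto simp: less_imp_le\<close>)
      also have "\<dots> = dt * (a x * N x * max 0 (- V x)) + dt * (a x * P x * max 0 (V x))
          + dt * (a x * Q x) * L + (m x * \<bar>A x\<bar>) * L"
        by (simp add: ma)
      finally show "- (m x * (N x - P x - Q x + A x) * V x) \<le> \<dots>" .
    qed
    also have "\<dots> = dt * (\<Sum>x\<in>I. a x * N x * max 0 (- V x)) + dt * (\<Sum>x\<in>I. a x * P x * max 0 (V x))
          + dt * (\<Sum>x\<in>I. a x * Q x) * L + CA * L"
      by (simp add: sum.distrib sum_distrib_left sum_distrib_right CA_def)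
    also have "\<dots> \<le> dt * (CN * (1 + L)) + dt * (CP * (1 + L)) + dt * CQ * (1 + L) + CA * (1 + L)"
      using N(3) P(3) Qm dt L pos by (intro add_mono mult_mono mult_left_mono) auto
    also have "\<dots> = (dt * CN + dt * CP + dt * CQ + CA) * (1 + L)"
      by (simp add: algebra_simps)
    finally have charge: "- (\<Sum>x\<in>I. m x * (N x - P x - Q x + A x) * V x) \<le>
      (dt * CN + dt * CP + dt * CQ + CA) * (1 + L)" .
    define \<Phi> where "\<Phi> = (\<Sum>x\<in>I. \<Sum>y\<in>I. w x y * (V y - V x)\<^sup>2) + (\<Sum>x\<in>I. \<Sum>e\<in>E. w x e * (V x)\<^sup>2)"
    have "\<Phi> \<le> (\<Sum>x\<in>I. \<Sum>e\<in>E. w x e * (V e)\<^sup>2) - 2 / \<kappa> * (\<Sum>x\<in>I. m x * (N x - P x - Q x + A x) * V x)"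
      unfolding \<Phi>_def by (rule poisson_energy[OF eqs(4) \<kappa> s])
    also have "(\<Sum>x\<in>I. \<Sum>e\<in>E. w x e * (V e)\<^sup>2) = CE"
      unfolding CE_def using bd by (intro sum.cong refl) auto
    also have "CE - 2 / \<kappa> * (\<Sum>x\<in>I. m x * (N x - P x - Q x + A x) * V x) =
        CE + 2 / \<kappa> * (- (\<Sum>x\<in>I. m x * (N x - P x - Q x + A x) * V x))"
      by simp
    also have "\<dots> \<le> CE * (1 + L) + 2 / \<kappa> * ((dt * CN + dt * CP + dt * CQ + CA) * (1 + L))"
      using charge \<kappa> pos L by (intro add_mono mult_left_mono) (auto simp: distrib_left)
    also have "\<dots> = C * (1 + L)"
      unfolding C_def distrib_right[of CE] by (simp only: mult.assoc)
    finally have \<Phi>: "\<Phi> \<le> C * (1 + L)" .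
    have V2: "(\<bar>V x\<bar>)\<^sup>2 \<le> K * (C * (1 + L))" if "x \<in> I" for x
      using K(2)[rule_format, OF that, of V] mult_left_mono[OF \<Phi> K(1)] by (simp add: \<Phi>_def)
    have "L\<^sup>2 \<le> (\<Sum>x\<in>I. \<bar>V x\<bar>\<^sup>2) * card I"
      unfolding L_def by (rule sum_squared_le_sum_of_squares)
    also have "\<dots> \<le> (real (card I) * (K * (C * (1 + L)))) * card I"
      using sum_bounded_above[OF V2, of I] by (intro mult_right_mono) auto
    also have "\<dots> = c * (1 + L)" by (simp add: c_def)
    finally have LL0: "L \<le> L0"
      unfolding L0_def using c by (rule real_le_of_square_le_affine)
    have L0: "0 \<le> L0" using L LL0 by simp
    have cons: "\<bar>u x\<bar> \<le> B * r" if "\<forall>x\<in>I. 0 \<le> u x" "(\<Sum>x\<in>I. a x * u x) \<le> B" for u B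
    proof -
      have "0 \<le> B" using that a
        by (intro order_trans[OF _ that(2)] sum_nonneg) (auto simp: less_imp_le)
      have "a x * u x \<le> (\<Sum>x\<in>I. a x * u x)"
        using member_le_sum[OF x, of "\<lambda>x. a x * u x"] finite_I that a by (auto simp: less_imp_le)
      with that have "a x * u x \<le> B" by simp
      then have "u x \<le> B * (1 / a x)" using a[OF x] by (simp add: field_simps)
      also have "1 / a x \<le> r"
        unfolding r_def using member_le_sum[OF x, of "\<lambda>x. 1 / a x"] finite_I a by (auto simp: less_imp_le)
      finally show ?thesis using \<open>0 \<le> B\<close> that x by (auto simp: mult_left_mono)
    qed
    have "CN * (1 + L) \<le> CN * (1 + L0)" "CP * (1 + L) \<le> CP * (1 + L0)"
      using LL0 CN CP by (auto intro: mult_left_mono)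
    then have "\<bar>N x\<bar> \<le> CN * (1 + L0) * r" "\<bar>P x\<bar> \<le> CP * (1 + L0) * r" "\<bar>Q x\<bar> \<le> CQ * r"
      using N P Q Qm by (auto intro!: cons)
    moreover have "0 \<le> CN * (1 + L0) * r" "0 \<le> CP * (1 + L0) * r" "0 \<le> CQ * r"
      using pos CN CP L0 by auto
    ultimately show ?thesis
      using xL[OF x] LL0 L0 unfolding R_def distrib_right by linarith
  qed
  then show ?thesis
    unfolding a_def by blast
qed

lemma scheme_step_exists:
  fixes A N0 P0 Q0 nE pE vE :: "'n \<Rightarrow> real"
  assumes conn: "\<And>S. S \<subseteq> I \<Longrightarrow> S \<noteq> {} \<Longrightarrow> S \<noteq> I \<Longrightarrow> \<exists>x\<in>S. \<exists>y\<in>I - S. 0 < w x y"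
    and ground: "x0 \<in> I" "e0 \<in> E" "0 < w x0 e0"
    and \<kappa>: "0 < \<kappa>" and dt: "0 < dt" and m: "\<And>x. x \<in> I \<Longrightarrow> 0 < m x"
    and init: "\<And>x. x \<in> I \<Longrightarrow> 0 \<le> N0 x" "\<And>x. x \<in> I \<Longrightarrow> 0 \<le> P0 x" "\<And>x. x \<in> I \<Longrightarrow> 0 \<le> Q0 x"
    and nontrivial: "\<exists>x\<in>I. 0 < N0 x" "\<exists>x\<in>I. 0 < P0 x" "\<exists>x\<in>I. 0 < Q0 x"
    and bdry: "\<And>e. e \<in> E \<Longrightarrow> 0 \<le> nE e" "\<And>e. e \<in> E \<Longrightarrow> 0 \<le> pE e"
  shows "\<exists>N P Q V. (\<forall>e\<in>E. N e = nE e \<and> P e = pE e \<and> V e = vE e) \<and>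
    species (\<lambda>x. m x / dt) 0 N0 V N \<and>
    species (\<lambda>x. m x / dt) 0 P0 (\<lambda>x. - V x) P \<and>
    weighted_graph.species I {} w (\<lambda>x. m x / dt) 0 Q0 (\<lambda>x. - V x) Q \<and>
    poisson \<kappa> m 0 (\<lambda>x. N x - P x - Q x + A x) V \<and>
    (\<forall>x\<in>I. 0 < N x \<and> 0 < P x \<and> 0 < Q x)"
proof -
  interpret insulated: weighted_graph I "{}" w
  proof (rule weighted_graph.intro)
    show "w x y = w y x" if "x \<in> I" "y \<in> I" for x y
      by (rule w_sym[OF that])
  qed (auto simp: finite_I w_nonneg)
  define a where "a = (\<lambda>x. m x / dt)"
  have a: "0 < a x" if "x \<in> I" for x using m[OF that] dt by (simp add: a_def)
  have "\<exists>R. \<forall>s N P Q V. 0 \<le> s \<longrightarrow> (\<forall>e\<in>E. N e = nE e \<and> P e = pE e \<and> V e = vE e) \<longrightarrow>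
    species a s N0 V N \<longrightarrow> species a s P0 (\<lambda>x. - V x) P \<longrightarrow>
    insulated.species a s Q0 (\<lambda>x. - V x) Q \<longrightarrow>
    poisson \<kappa> m s (\<lambda>x. N x - P x - Q x + A x) V \<longrightarrow>
    (\<forall>x\<in>I. \<bar>N x\<bar> \<le> R \<and> \<bar>P x\<bar> \<le> R \<and> \<bar>Q x\<bar> \<le> R \<and> \<bar>V x\<bar> \<le> R)"
    unfolding a_def by (rule scheme_apriori; fact conn ground \<kappa> dt m init bdry)
  then obtain R where R: "\<forall>s N P Q V. 0 \<le> s \<longrightarrow> (\<forall>e\<in>E. N e = nE e \<and> P e = pE e \<and> V e = vE e) \<longrightarrow>
    species a s N0 V N \<longrightarrow> species a s P0 (\<lambda>x. - V x) P \<longrightarrow>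
    insulated.species a s Q0 (\<lambda>x. - V x) Q \<longrightarrow>
    poisson \<kappa> m s (\<lambda>x. N x - P x - Q x + A x) V \<longrightarrow>
    (\<forall>x\<in>I. \<bar>N x\<bar> \<le> R \<and> \<bar>P x\<bar> \<le> R \<and> \<bar>Q x\<bar> \<le> R \<and> \<bar>V x\<bar> \<le> R)"
    by (elim exE) (rule that)
  \<comment> \<open>An argument \<open>z\<close> lists four values per cell, labelled 0 to 3 for N,
    P, Q, V. Overwriting it at Dirichlet edges makes the boundary data hold for every
    \<open>z\<close>, so only the cell equations remain to be solved.\<close>
  define ext where "ext = (\<lambda>(b :: 'n \<Rightarrow> real) (z :: 'n \<times> nat \<Rightarrow> real) j y. if y \<in> E then b y else z (y, j))"
  define N where "N = (\<lambda>z. ext nE z 0)"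
  define P where "P = (\<lambda>z. ext pE z 1)"
  define Q where "Q = (\<lambda>z :: 'n \<times> nat \<Rightarrow> real. \<lambda>y. z (y, 2))"
  define V where "V = (\<lambda>z. ext vE z 3)"
  define res where "res = (\<lambda>X u0 \<psi> u x. a x * (u x - u0 x) - (\<Sum>y\<in>X. w x y * drift_flux \<psi> u x y))"
  \<comment> \<open>The last residual is charge minus the discrete Laplacian, not the reverse:
    adding s V to it must give \<open>poisson\<close> with its sign of s.\<close>
  define F where "F = (\<lambda>z (x, j::nat). if j = 0 then res (I \<union> E) N0 (V z) (N z) x
    else if j = 1 then res (I \<union> E) P0 (\<lambda>y. - V z y) (P z) x
    else if j = 2 then res I Q0 (\<lambda>y. - V z y) (Q z) x
    else m x * (N z x - P z x - Q z x + A x) - \<kappa> * (\<Sum>y\<in>I \<union> E. w x y * (V z y - V z x)))"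
  define J where "J = I \<times> {0, 1, 2, 3::nat}"
  have ext_I: "N z x = z (x, 0)" "P z x = z (x, 1)" "Q z x = z (x, 2)" "V z x = z (x, 3)" if "x \<in> I" for x z
    using that disjoint by (auto simp: N_def P_def Q_def V_def ext_def)
  have ext_E: "\<forall>e\<in>E. N z e = nE e \<and> P z e = pE e \<and> V z e = vE e" for z
    by (auto simp: N_def P_def V_def ext_def)
  have cont_z: "continuous_on UNIV (\<lambda>z :: 'n \<times> nat \<Rightarrow> real. z i)" for i
    by (rule continuous_on_product_coordinates)
  have cont_ext: "continuous_on UNIV (\<lambda>z. ext b z j y)" for b j y
    by (cases "y \<in> E") (simp_all add: ext_def cont_z)
  have cont_u: "continuous_on UNIV (\<lambda>z. N z y)" "continuous_on UNIV (\<lambda>z. P z y)"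
      "continuous_on UNIV (\<lambda>z. Q z y)" "continuous_on UNIV (\<lambda>z. V z y)" for y
    unfolding N_def P_def Q_def V_def by (rule cont_ext cont_z)+
  have cont_B: "continuous_on UNIV (\<lambda>z. bernoulli_fun (f z))" if "continuous_on UNIV f"
    for f :: "('n \<times> nat \<Rightarrow> real) \<Rightarrow> real"
    by (rule continuous_on_compose2[OF continuous_on_bernoulli_fun[of UNIV] that]) auto
  have cont_res: "continuous_on UNIV (\<lambda>z. res X u0 (\<psi> z) (u z) x)"
    if "\<And>y. continuous_on UNIV (\<lambda>z. \<psi> z y)" "\<And>y. continuous_on UNIV (\<lambda>z. u z y)"
    for X u0 x and \<psi> u :: "('n \<times> nat \<Rightarrow> real) \<Rightarrow> 'n \<Rightarrow> real"
    unfolding res_def drift_flux_def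
    by (intro continuous_on_diff continuous_on_mult continuous_on_sum continuous_on_const cont_B that)
  have cont: "continuous_on UNIV (\<lambda>z. F z i)" for i
  proof (cases i)
    case (Pair x j)
    define f0 where "f0 = (\<lambda>z. res (I \<union> E) N0 (V z) (N z) x)"
    define f1 where "f1 = (\<lambda>z. res (I \<union> E) P0 (\<lambda>y. - V z y) (P z) x)"
    define f2 where "f2 = (\<lambda>z. res I Q0 (\<lambda>y. - V z y) (Q z) x)"
    define f3 where "f3 = (\<lambda>z. m x * (N z x - P z x - Q z x + A x)
        - \<kappa> * (\<Sum>y\<in>I \<union> E. w x y * (V z y - V z x)))"
    have "continuous_on UNIV f0" "continuous_on UNIV f1" "continuous_on UNIV f2"
      unfolding f0_def f1_def f2_def
      by (rule cont_res continuous_on_minus cont_u)+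
    moreover have "continuous_on UNIV f3"
      unfolding f3_def
      by (intro continuous_on_add continuous_on_diff continuous_on_mult continuous_on_sum
          continuous_on_const cont_u)
    moreover have "(\<lambda>z. F z i) = (if j = 0 then f0 else if j = 1 then f1 else if j = 2 then f2 else f3)"
      unfolding F_def Pair f0_def f1_def f2_def f3_def by auto
    ultimately show ?thesis by presburger
  qed
  have eqs: "species a s N0 (V z) (N z)" "species a s P0 (\<lambda>x. - V z x) (P z)"
      "insulated.species a s Q0 (\<lambda>x. - V z x) (Q z)"
      "poisson \<kappa> m s (\<lambda>x. N z x - P z x - Q z x + A x) (V z)"
    if z: "\<forall>i\<in>J. F z i + s * z i = 0" for s z
  proof -
    have eq: "F z (x, j) + s * z (x, j) = 0" if "x \<in> I" "j \<in> {0, 1, 2, 3}" for x j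
      using z that by (auto simp: J_def)
    have res0: "res X u0 \<psi> u x + s * u x = 0 \<Longrightarrow>
        a x * (u x - u0 x) + s * u x = (\<Sum>y\<in>X. w x y * drift_flux \<psi> u x y)" for X u0 \<psi> u x
      unfolding res_def by linarith
    have "res (I \<union> E) N0 (V z) (N z) x + s * N z x = 0" if "x \<in> I" for x
      using eq[OF that, of 0] unfolding ext_I(1)[OF that, of z, symmetric] by (simp add: F_def)
    then show "species a s N0 (V z) (N z)"
      unfolding species_def using res0 by blast
    have "res (I \<union> E) P0 (\<lambda>x. - V z x) (P z) x + s * P z x = 0" if "x \<in> I" for x
      using eq[OF that, of 1] unfolding ext_I(2)[OF that, of z, symmetric] by (simp add: F_def)
    then show "species a s P0 (\<lambda>x. - V z x) (P z)"
      unfolding species_def using res0 by blast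
    have "res I Q0 (\<lambda>x. - V z x) (Q z) x + s * Q z x = 0" if "x \<in> I" for x
      using eq[OF that, of 2] unfolding ext_I(3)[OF that, of z, symmetric] by (simp add: F_def)
    then show "insulated.species a s Q0 (\<lambda>x. - V z x) (Q z)"
      unfolding insulated.species_def Un_empty_right using res0 by blast
    have v: "m x * (N z x - P z x - Q z x + A x) - \<kappa> * (\<Sum>y\<in>I \<union> E. w x y * (V z y - V z x))
        + s * V z x = 0" if "x \<in> I" for x
      using eq[OF that, of 3] unfolding ext_I(4)[OF that, of z, symmetric] by (simp add: F_def)
    have "\<kappa> * (\<Sum>y\<in>I \<union> E. w x y * (V z y - V z x)) =
        m x * (N z x - P z x - Q z x + A x) + s * V z x" if "x \<in> I" for x
      using v[OF that] by linarith
    then show "poisson \<kappa> m s (\<lambda>x. N z x - P z x - Q z x + A x) (V z)"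
      unfolding poisson_def by blast
  qed
  have finJ: "finite J" using finite_I by (simp add: J_def)
  \<comment> \<open>The zero criterion asks for a strict bound by a square; since r is at least 1, r
    <= r^2 supplies one without a root.\<close>
  define r where "r = 1 + real (card J) * R\<^sup>2"
  have "\<exists>z. \<forall>i\<in>J. F z i = 0"
  proof (rule exists_zero_of_coercive[OF finJ])
    show "J \<noteq> {}" using ground by (auto simp: J_def)
    show "0 < r" unfolding r_def by (intro add_pos_nonneg) auto
    fix s z assume s: "(0::real) \<le> s" and z: "\<forall>i\<in>J. F z i + s * z i = 0"
    have bd: "\<bar>N z x\<bar> \<le> R \<and> \<bar>P z x\<bar> \<le> R \<and> \<bar>Q z x\<bar> \<le> R \<and> \<bar>V z x\<bar> \<le> R" if "x \<in> I" for x
      by (rule R[rule_format, OF s ext_E[rule_format] eqs[OF z] that])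
    have "(z i)\<^sup>2 \<le> R\<^sup>2" if "i \<in> J" for i
    proof -
      obtain x j where i: "i = (x, j)" "x \<in> I" "j \<in> {0, 1, 2, 3}" using \<open>i \<in> J\<close> unfolding J_def by blast
      then have "\<bar>z i\<bar> \<le> R" using bd[OF i(2)] ext_I[OF i(2), of z] by auto
      then show ?thesis
        using power_mono[of "\<bar>z i\<bar>" R 2] by simp
    qed
    then have "(\<Sum>i\<in>J. (z i)\<^sup>2) \<le> real (card J) * R\<^sup>2"
      by (rule sum_bounded_above)
    also have "\<dots> < r" by (simp add: r_def)
    also have "r \<le> r\<^sup>2"
      by (rule self_le_power) (simp_all add: r_def)
    finally show "(\<Sum>i\<in>J. (z i)\<^sup>2) < r\<^sup>2" .
  qed (rule cont)
  then obtain z where "\<forall>i\<in>J. F z i = 0" by blast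
  then have z: "\<forall>i\<in>J. F z i + 0 * z i = 0" by simp
  have nonneg: "0 \<le> N z x" "0 \<le> P z x" if "x \<in> I \<union> E" for x
    using that species_nonneg[OF eqs(1)[OF z] a _ init(1)] species_nonneg[OF eqs(2)[OF z] a _ init(2)]
      bdry ext_E[of z] by auto
  have nonneg_Q: "0 \<le> Q z x" if "x \<in> I \<union> {}" for x
    using that insulated.species_nonneg[OF eqs(3)[OF z] a _ init(3)] by auto
  have "0 < N z x" if "x \<in> I" for x
    by (rule species_pos[OF _ eqs(1)[OF z] a init(1) nontrivial(1) nonneg(1) that]; (fact conn | assumption))
  moreover have "0 < P z x" if "x \<in> I" for x
    by (rule species_pos[OF _ eqs(2)[OF z] a init(2) nontrivial(2) nonneg(2) that]; (fact conn | assumption))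
  moreover have "0 < Q z x" if "x \<in> I" for x
    by (rule insulated.species_pos[OF _ eqs(3)[OF z] a init(3) nontrivial(3) nonneg_Q that]; (fact conn | assumption))
  ultimately show ?thesis
    using ext_E[of z] eqs[OF z] unfolding a_def by blast
qed

end

section \<open>Null sets of the Hausdorff measure\<close>

text \<open>\<open>measure_of\<close> falls back to the zero measure when the given set function is
  not a measure on the generated sigma-algebra. A single set of nonzero measure excludes this case,
  so Caratheodory's theorem for the Hausdorff outer measure need not be invoked.\<close>

lemma emeasure_surface_measure_eq:
  fixes X Z :: "'a::euclidean_space set"
  assumes "emeasure (surface_measure :: 'a measure) X \<noteq> 0" and "Z \<in> sets surface_measure"
  shows "emeasure surface_measure Z = hausdorff_outer (DIM('a) - 1) Z"
  using assms unfolding surface_measure_def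
  by (auto simp: emeasure_measure_of_conv sets_measure_of split: if_splits)

text \<open>About 1 / \<eta> balls of radius comparable to \<eta>, strung along a segment from one
  point of \<open>C\<close>, cover all translates; each has volume of order \<eta>^d. A separate
  positive \<eta> is used because the diameter of \<open>C\<close> may be zero.\<close>

lemma segment_cylinder_cover:
  fixes C :: "'a::euclidean_space set"
  assumes C: "bounded C" "diameter C \<le> \<eta>" and \<eta>: "0 < \<eta>" "\<eta> \<le> 2"
  shows "\<exists>T. T \<in> sets borel \<and> (\<forall>z\<in>C. \<forall>t\<in>{0..1}. z - t *\<^sub>R v \<in> T) \<and>
    emeasure lborel T \<le> ennreal (5 * unit_ball_vol (DIM('a)) * (1 + norm v) ^ DIM('a) * \<eta> ^ (DIM('a) - 1))"
proof (cases "C = {}")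
  case False
  then obtain c where c: "c \<in> C" by blast
  \<comment> \<open>A parameter spacing 1 / m <= \<eta> keeps every point within \<eta> + \<eta> |v|
    of a centre. The m + 1 centres number at most 1 / \<eta> + 2 <= 5 / \<eta>, because \<eta> <=
    2.\<close>
  define m where "m = nat \<lceil>1 / \<eta>\<rceil>"
  have m: "1 / \<eta> \<le> real m" "real m \<le> 1 / \<eta> + 1" "0 < m"
    using \<eta> by (auto simp: m_def)
  define r where "r = \<eta> * (1 + norm v)"
  have r: "0 \<le> r" using \<eta> by (simp add: r_def)
  define T where "T = (\<Union>j\<in>{..m}. cball (c - (real j / real m) *\<^sub>R v) r)"
  have T: "T \<in> sets borel" unfolding T_def by (intro sets.finite_UN) auto
  have "z - t *\<^sub>R v \<in> T" if z: "z \<in> C" and t: "t \<in> {0..1}" for z t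
  proof -
    define j where "j = nat \<lfloor>t * m\<rfloor>"
    have tm: "0 \<le> t * m" "t * m \<le> 1 * m" using t m by (auto intro: mult_right_mono)
    have j: "real j \<le> t * m" "t * m \<le> real j + 1"
      using tm unfolding j_def by linarith+
    have "j \<le> m" using j tm by simp
    have "j / m \<le> t" "t \<le> (j + 1) / m"
      using j m by (simp_all add: pos_divide_le_eq pos_le_divide_eq add.commute)
    then have "0 \<le> t - j / m" "t - j / m \<le> 1 / m"
      by (simp_all add: add_divide_distrib)
    moreover have "1 / m \<le> \<eta>" using m \<eta> by (simp add: field_simps)
    ultimately have tj: "\<bar>t - j / m\<bar> \<le> \<eta>" by linarith
    have "norm (z - t *\<^sub>R v - (c - (j / m) *\<^sub>R v)) = norm ((z - c) - (t - j / m) *\<^sub>R v)"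
      by (simp add: algebra_simps)
    also have "\<dots> \<le> norm (z - c) + \<bar>t - j / m\<bar> * norm v"
      by (metis norm_scaleR norm_triangle_ineq4)
    also have "norm (z - c) \<le> \<eta>"
      using diameter_bounded_bound[OF C(1) z c] C(2) by (simp add: dist_norm)
    also have "\<bar>t - j / m\<bar> * norm v \<le> \<eta> * norm v"
      using tj by (intro mult_right_mono) auto
    finally have "norm (z - t *\<^sub>R v - (c - (j / m) *\<^sub>R v)) \<le> r"
      by (simp add: r_def algebra_simps)
    then show ?thesis
      unfolding T_def using \<open>j \<le> m\<close> by (intro UN_I[of j]) (auto simp: dist_norm norm_minus_commute)
  qed
  moreover have "emeasure lborel T \<le> ennreal (5 * unit_ball_vol (DIM('a)) * (1 + norm v) ^ DIM('a) * \<eta> ^ (DIM('a) - 1))"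
  proof -
    have "emeasure lborel T \<le> (\<Sum>j\<in>{..m}. emeasure lborel (cball (c - (real j / real m) *\<^sub>R v) r))"
      unfolding T_def by (rule emeasure_subadditive_finite) auto
    also have "\<dots> = (\<Sum>j\<in>{..m}. ennreal (unit_ball_vol (DIM('a)) * r ^ DIM('a)))"
      by (simp add: emeasure_cball r)
    also have "\<dots> = ennreal (real (Suc m) * (unit_ball_vol (DIM('a)) * r ^ DIM('a)))"
      using r by (simp add: ennreal_mult' flip: ennreal_of_nat_eq_real_of_nat)
    also have "\<dots> \<le> ennreal (5 / \<eta> * (unit_ball_vol (DIM('a)) * r ^ DIM('a)))"
    proof (intro ennreal_leI mult_right_mono)
      have "2 \<le> 4 / \<eta>" using \<eta> by (simp add: field_simps)
      with m show "real (Suc m) \<le> 5 / \<eta>" by (simp add: field_simps)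
    qed (use r in auto)
    also have "5 / \<eta> * (unit_ball_vol (DIM('a)) * r ^ DIM('a)) =
        5 * unit_ball_vol (DIM('a)) * (1 + norm v) ^ DIM('a) * \<eta> ^ (DIM('a) - 1)"
    proof -
      obtain d where d: "DIM('a) = Suc d" using DIM_positive[where 'a = 'a] gr0_conv_Suc by auto
      show ?thesis unfolding d r_def power_mult_distrib using \<eta> by simp
    qed
    finally show ?thesis .
  qed
  ultimately show ?thesis using T by blast
qed (auto intro!: exI[of _ "{}"])

text \<open>The outer measure is a supremum over scales, so scale 1 is already null. Diameters of at
  most 1 leave room to enlarge them and still stay below the bound 2 of
  \<open>segment_cylinder_cover\<close>.\<close>

lemma hausdorff_null_imp_small_cover:
  fixes Z :: "'a::euclidean_space set"
  assumes "hausdorff_outer s Z = 0" and "0 < \<epsilon>"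
  obtains C where "Z \<subseteq> (\<Union>i::nat. C i)" "\<And>i. bounded (C i)" "\<And>i. diameter (C i) \<le> 1"
    "suminf (\<lambda>i. if C i = {} then 0 else ennreal (unit_ball_vol (real s) * (diameter (C i) / 2) ^ s)) < \<epsilon>"
proof -
  have "hausdorff_premeasure s 1 Z \<le> hausdorff_outer s Z"
    unfolding hausdorff_outer_def by (rule SUP_upper) simp
  then have "hausdorff_premeasure s 1 Z < \<epsilon>"
    using assms by simp
  then show ?thesis
    unfolding hausdorff_premeasure_def INF_less_iff using that by auto
qed

text \<open>A neighbourhood of size \<open>\<delta>\<close> of a segment has volume of order \<open>\<delta> ^ (d - 1)\<close>, so a
  covering of \<open>Z\<close> of small \<open>(d - 1)\<close>-dimensional content becomes a covering of the cylinder of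
  small volume.\<close>

lemma negligible_cylinder_over_hausdorff_null:
  fixes Z :: "'a::euclidean_space set"
  assumes null: "hausdorff_outer (DIM('a) - 1) Z = 0"
  shows "negligible {z - t *\<^sub>R v | z t. z \<in> Z \<and> t \<in> {0..1}}"
  unfolding negligible_outer_le
proof (intro allI impI)
  fix e :: real assume e: "0 < e"
  define s where "s = DIM('a) - 1"
  define K where "K = 5 * unit_ball_vol (DIM('a)) * (1 + norm v) ^ DIM('a)"
  \<comment> \<open>K \<eta>^s is \<open>k\<close> times the weight in the premeasure of a set of
    diameter \<eta>. The choices of \<epsilon> and \<theta> below each spend at most half of
    \<open>e\<close>.\<close>
  define k where "k = K * 2 ^ s / unit_ball_vol (real s)"
  have K: "0 \<le> K" unfolding K_def by (intro mult_nonneg_nonneg) auto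
  have k: "0 \<le> k" unfolding k_def using K by (intro divide_nonneg_pos mult_nonneg_nonneg) auto
  define \<epsilon> where "\<epsilon> = e / (2 * (k + 1))"
  define \<theta> where "\<theta> = e / (2 * (K + 1))"
  have \<epsilon>: "0 < \<epsilon>" "0 < \<theta>" using e k K by (auto simp: \<epsilon>_def \<theta>_def)
  obtain C where C: "Z \<subseteq> (\<Union>i::nat. C i)" "\<And>i. bounded (C i)" "\<And>i. diameter (C i) \<le> 1"
    and small: "suminf (\<lambda>i. if C i = {} then 0 else ennreal (unit_ball_vol (real s) * (diameter (C i) / 2) ^ s)) < ennreal \<epsilon>"
    using hausdorff_null_imp_small_cover[of s Z "ennreal \<epsilon>"] null \<epsilon> unfolding s_def by auto
  define c where "c = (\<lambda>i. if C i = {} then 0 else ennreal (unit_ball_vol (real s) * (diameter (C i) / 2) ^ s))"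
  have "\<exists>T. T \<in> sets borel \<and> (\<forall>z\<in>C i. \<forall>t\<in>{0..1}. z - t *\<^sub>R v \<in> T) \<and>
      emeasure lborel T \<le> ennreal k * c i + ennreal (K * \<theta>) * ennreal ((1 / 2) ^ Suc i)" for i
  proof (cases "C i = {}")
    case True
    then show ?thesis by (intro exI[of _ "{}"]) auto
  next
    case False
    define d where "d = diameter (C i)"
    have d: "0 \<le> d" "d \<le> 1" using C diameter_ge_0 by (auto simp: d_def)
    \<comment> \<open>The diameter is enlarged to a positive \<eta>; continuity keeps the cost of
      this below \<theta> times the i-th term of a geometric series of sum 1.\<close>
    have "isCont (\<lambda>x. x ^ s) d" by (intro continuous_intros)
    moreover have "0 < \<theta> * (1 / 2) ^ Suc i" using \<epsilon> by simp
    ultimately obtain \<delta> where \<delta>: "0 < \<delta>" "\<And>x. \<bar>x - d\<bar> < \<delta> \<Longrightarrow> \<bar>x ^ s - d ^ s\<bar> < \<theta> * (1 / 2) ^ Suc i"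
      unfolding continuous_at_eps_delta dist_real_def by blast
    define \<eta> where "\<eta> = d + min 1 (\<delta> / 2)"
    have \<eta>: "0 < \<eta>" "\<eta> \<le> 2" "d \<le> \<eta>" "\<bar>\<eta> - d\<bar> < \<delta>"
      using d \<delta> by (auto simp: \<eta>_def)
    obtain T where T: "T \<in> sets borel" "\<forall>z\<in>C i. \<forall>t\<in>{0..1}. z - t *\<^sub>R v \<in> T"
        "emeasure lborel T \<le> ennreal (K * \<eta> ^ s)"
      using segment_cylinder_cover[OF C(2)[of i] _ \<eta>(1,2), of v] \<eta>(3)
      unfolding K_def s_def d_def by blast
    have "\<eta> ^ s \<le> d ^ s + \<theta> * (1 / 2) ^ Suc i"
      using \<delta>(2)[OF \<eta>(4)] by linarith
    then have "K * \<eta> ^ s \<le> K * (d ^ s + \<theta> * (1 / 2) ^ Suc i)"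
      using K by (rule mult_left_mono)
    also have "\<dots> = k * (unit_ball_vol (real s) * (d / 2) ^ s) + K * \<theta> * (1 / 2) ^ Suc i"
      using unit_ball_vol_pos[of "real s", THEN less_imp_neq] by (simp add: k_def power_divide distrib_left)
    finally have "emeasure lborel T \<le> ennreal (k * (unit_ball_vol (real s) * (d / 2) ^ s) + K * \<theta> * (1 / 2) ^ Suc i)"
      by (intro order_trans[OF T(3)] ennreal_leI)
    also have "\<dots> = ennreal k * c i + ennreal (K * \<theta>) * ennreal ((1 / 2) ^ Suc i)"
    proof -
      define p q r where "p = unit_ball_vol (real s) * (d / 2) ^ s" and "q = K * \<theta>"
        and "r = (1 / 2 :: real) ^ Suc i"
      have "0 \<le> p" "0 \<le> q" "0 \<le> r" using d K \<epsilon> by (auto simp: p_def q_def r_def)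
      then have "ennreal (k * p + q * r) = ennreal k * ennreal p + ennreal q * ennreal r"
        using k by (simp add: ennreal_plus ennreal_mult)
      moreover have "c i = ennreal p" using False by (simp add: c_def p_def d_def)
      ultimately show ?thesis by (simp only: p_def q_def r_def)
    qed
    finally show ?thesis using T by blast
  qed
  then obtain T where T: "\<And>i. T i \<in> sets borel" "\<And>i z t. z \<in> C i \<Longrightarrow> t \<in> {0..1} \<Longrightarrow> z - t *\<^sub>R v \<in> T i"
      "\<And>i. emeasure lborel (T i) \<le> ennreal k * c i + ennreal (K * \<theta>) * ennreal ((1 / 2) ^ Suc i)"
    by metis
  define U where "U = (\<Union>i. T i)"
  have U: "U \<in> sets borel" using T(1) by (auto simp: U_def)
  have "suminf (\<lambda>i. ennreal ((1 / 2) ^ Suc i)) = ennreal 1"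
    by (rule suminf_ennreal_eq[OF _ power_half_series]) simp
  then have geo: "suminf (\<lambda>i. ennreal ((1 / 2) ^ Suc i)) = 1"
    unfolding ennreal_1 .
  have "emeasure lborel U \<le> suminf (\<lambda>i. emeasure lborel (T i))"
    unfolding U_def using T(1) by (intro emeasure_subadditive_countably) auto
  also have "\<dots> \<le> suminf (\<lambda>i. ennreal k * c i + ennreal (K * \<theta>) * ennreal ((1 / 2) ^ Suc i))"
    using T(3) by (intro suminf_le) auto
  also have "\<dots> = suminf (\<lambda>i. ennreal k * c i) + suminf (\<lambda>i. ennreal (K * \<theta>) * ennreal ((1 / 2) ^ Suc i))"
    by (intro suminf_add[symmetric]) auto
  also have "\<dots> = ennreal k * suminf (\<lambda>i. c i) + ennreal (K * \<theta>)"
    unfolding ennreal_suminf_cmult geo by simp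
  also have "\<dots> \<le> ennreal k * ennreal \<epsilon> + ennreal (K * \<theta>)"
    using less_imp_le[OF small] unfolding c_def by (intro add_mono mult_left_mono) auto
  also have "\<dots> = ennreal (k * \<epsilon> + K * \<theta>)"
    using k K \<epsilon> by (simp add: ennreal_plus ennreal_mult)
  also have "\<dots> \<le> ennreal e"
  proof (rule ennreal_leI)
    have "k * \<epsilon> \<le> e / 2" "K * \<theta> \<le> e / 2"
      using k K e mult_nonneg_nonneg[of k e] mult_nonneg_nonneg[of K e]
      by (simp_all add: \<epsilon>_def \<theta>_def divide_le_eq distrib_left mult.commute)
    then show "k * \<epsilon> + K * \<theta> \<le> e" by simp
  qed
  finally have meas: "emeasure lborel U \<le> ennreal e" .
  show "\<exists>T. {z - t *\<^sub>R v | z t. z \<in> Z \<and> t \<in> {0..1}} \<subseteq> T \<and> T \<in> lmeasurable \<and> measure lebesgue T \<le> e"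
  proof (intro exI[of _ U] conjI)
    show "{z - t *\<^sub>R v | z t. z \<in> Z \<and> t \<in> {0..1}} \<subseteq> U"
      using C(1) T(2) unfolding U_def by blast
    have *: "emeasure lebesgue U = emeasure lborel U" using U by simp
    show "U \<in> lmeasurable"
      using U meas * by (intro fmeasurableI) (auto simp: intro: le_less_trans)
    show "measure lebesgue U \<le> e"
      using meas * e unfolding measure_def by (simp add: enn2real_leI)
  qed
qed

section \<open>Flat sets of low dimension\<close>

lemma hausdorff_premeasure_le_finite_cover:
  fixes S :: "'a::euclidean_space set"
  assumes G: "finite G" and cover: "S \<subseteq> (\<Union>g\<in>G. C g)"
    and C: "\<And>g. g \<in> G \<Longrightarrow> bounded (C g) \<and> diameter (C g) \<le> d" and d: "0 \<le> d" "d \<le> \<delta>"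
  shows "hausdorff_premeasure s \<delta> S \<le> ennreal (real (card G) * (unit_ball_vol (real s) * (d / 2) ^ s))"
proof -
  obtain e where e: "bij_betw e {..<card G} G"
    using ex_bij_betw_nat_finite[OF G] by (auto simp: atLeast0LessThan)
  \<comment> \<open>Padding by empty sets is free even for s = 0, where a point would have positive
    weight.\<close>
  define D where "D = (\<lambda>i. if i < card G then C (e i) else {})"
  define t where "t = (\<lambda>i. if D i = {} then 0 else ennreal (unit_ball_vol (real s) * (diameter (D i) / 2) ^ s))"
  have eG: "e i \<in> G" if "i < card G" for i using e that by (auto simp: bij_betw_def)
  have "S \<subseteq> (\<Union>i. D i)"
  proof
    fix x assume "x \<in> S"
    then obtain g where g: "g \<in> G" "x \<in> C g" using cover by blast
    then obtain i where "i < card G" "g = e i" using e by (auto simp: bij_betw_def)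
    with g show "x \<in> (\<Union>i. D i)" by (auto simp: D_def)
  qed
  moreover have "bounded (D i) \<and> diameter (D i) \<le> \<delta>" for i
    using C[OF eG, of i] d by (auto simp: D_def)
  ultimately have "hausdorff_premeasure s \<delta> S \<le> suminf (\<lambda>i. t i)"
    unfolding hausdorff_premeasure_def t_def by (intro INF_lower) auto
  also have "\<dots> = (\<Sum>i<card G. t i)"
    by (rule suminf_finite) (auto simp: t_def D_def)
  also have "\<dots> \<le> (\<Sum>i<card G. ennreal (unit_ball_vol (real s) * (d / 2) ^ s))"
  proof (rule sum_mono)
    fix i assume i: "i \<in> {..<card G}"
    have "diameter (D i) \<le> d" "0 \<le> diameter (D i)"
      using C[OF eG, of i] i diameter_ge_0 by (auto simp: D_def)
    then show "t i \<le> ennreal (unit_ball_vol (real s) * (d / 2) ^ s)"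
      unfolding t_def by (auto intro!: ennreal_leI mult_left_mono power_mono)
  qed
  also have "\<dots> = ennreal (real (card G) * (unit_ball_vol (real s) * (d / 2) ^ s))"
    using d by (simp add: ennreal_mult' flip: ennreal_of_nat_eq_real_of_nat)
  finally show ?thesis .
qed

text \<open>The set lies in an affine space of dimension k < s. Cutting a box around it into about
  n^k pieces of diameter of order 1 / n gives a sum of order n^(k - s), which tends to 0.\<close>

lemma hausdorff_outer_low_dim:
  fixes S :: "'a::euclidean_space set"
  assumes S: "bounded S" and dim: "aff_dim S < int s"
  shows "hausdorff_outer s S = 0"
proof (cases "S = {}")
  case True
  have "hausdorff_premeasure s \<delta> S \<le> 0" if "0 < \<delta>" for \<delta>
    using hausdorff_premeasure_le_finite_cover[of "{}" S "\<lambda>_. {}" 0 \<delta> s] that True by simp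
  then show ?thesis unfolding hausdorff_outer_def by (auto intro!: antisym SUP_least)
next
  case False
  then obtain a where a: "a \<in> S" by blast
  define W where "W = span ((\<lambda>x. x - a) ` S)"
  obtain B where B: "pairwise orthogonal B" "\<And>b. b \<in> B \<Longrightarrow> norm b = 1" "independent B"
      "card B = dim W" "span B = W"
    using orthonormal_basis_subspace[of W] unfolding W_def by (metis subspace_span)
  define k where "k = card B"
  have finB: "finite B" using B(3) independent_imp_finite by blast
  have k: "Suc k \<le> s"
    using dim aff_dim_eq_dim_subtract[of a S] a hull_inc[of a S affine] B(4) by (simp add: k_def W_def)
  obtain D where D: "0 < D" "\<And>x. x \<in> S \<Longrightarrow> norm (x - a) \<le> D"
    using S a unfolding bounded_any_center[where a = a]
    by (metis dist_commute dist_norm less_eq_real_def less_max_iff_disj max.bounded_iff max.cobounded1 order_trans zero_less_one linorder_le_less_linear)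
  \<comment> \<open>The power of 2 comes from n + 1 <= 2 n in each of k directions, and k D / n is
    half the diameter bound of a piece.\<close>
  define c where "c = 2 ^ k * (unit_ball_vol (real s) * (k * D) ^ s)"
  have c: "0 \<le> c" unfolding c_def using D by auto
  have le: "hausdorff_premeasure s \<delta> S \<le> ennreal (c / n)" if n: "0 < n" "2 * D * k / n \<le> \<delta>" for \<delta> and n :: nat
  proof -
    \<comment> \<open>Indices run up to n and not n - 1: a coordinate at the upper end of the box is
      scaled to n and has floor n.\<close>
    define G where "G = PiE B (\<lambda>_. {..n})"
    define C where "C = (\<lambda>g. {x\<in>S. \<forall>b\<in>B. real (g b) \<le> ((x - a) \<bullet> b + D) / (2 * D) * n \<and>
      ((x - a) \<bullet> b + D) / (2 * D) * n \<le> real (g b) + 1})"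
    have finG: "finite G" unfolding G_def using finB by (intro finite_PiE) auto
    have cardG: "card G = Suc n ^ k" unfolding G_def k_def by (simp add: card_PiE finB)
    have "S \<subseteq> (\<Union>g\<in>G. C g)"
    proof
      fix x assume x: "x \<in> S"
      define u where "u = (\<lambda>b. ((x - a) \<bullet> b + D) / (2 * D) * n)"
      define g where "g = restrict (\<lambda>b. nat \<lfloor>u b\<rfloor>) B"
      have u: "0 \<le> u b" "u b \<le> n" if "b \<in> B" for b
      proof -
        have "\<bar>(x - a) \<bullet> b\<bar> \<le> D"
          using Cauchy_Schwarz_ineq2[of "x - a" b] D(2)[OF x] B(2)[OF that] by simp
        then have "0 \<le> ((x - a) \<bullet> b + D) / (2 * D)" "((x - a) \<bullet> b + D) / (2 * D) \<le> 1"
          using D by auto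
        then show "0 \<le> u b" "u b \<le> n"
          unfolding u_def using mult_right_mono[of "((x - a) \<bullet> b + D) / (2 * D)" 1 "real n"]
          by (auto intro: mult_nonneg_nonneg simp del: times_divide_eq_left)
      qed
      have fl: "real (nat \<lfloor>u b\<rfloor>) \<le> u b" "u b \<le> real (nat \<lfloor>u b\<rfloor>) + 1" if "b \<in> B" for b
        using u[OF that] by linarith+
      have "nat \<lfloor>u b\<rfloor> \<le> n" if "b \<in> B" for b
        using fl(1)[OF that] u(2)[OF that] by linarith
      then have "g \<in> G"
        unfolding G_def g_def by auto
      moreover have "x \<in> C g"
        unfolding C_def g_def using x fl by (simp add: u_def)
      ultimately show "x \<in> (\<Union>g\<in>G. C g)" by blast
    qed
    moreover have "bounded (C g) \<and> diameter (C g) \<le> 2 * D * k / n" for g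
    proof
      show "bounded (C g)" by (rule bounded_subset[OF S]) (auto simp: C_def)
      show "diameter (C g) \<le> 2 * D * k / n"
      proof (rule diameter_le)
        fix x y assume x: "x \<in> C g" and y: "y \<in> C g"
        have "x - y = (x - a) - (y - a)" by simp
        also have "\<dots> \<in> span B"
          unfolding B(5) W_def using x y by (intro span_diff span_base) (auto simp: C_def)
        finally have "x - y = (\<Sum>b\<in>B. ((x - y) \<bullet> b) *\<^sub>R b)"
          using orthonormal_basis_expand[OF B(1,2) _ finB] by simp
        then have "norm (x - y) \<le> (\<Sum>b\<in>B. norm (((x - y) \<bullet> b) *\<^sub>R b))"
          by (metis norm_sum)
        also have "\<dots> \<le> (\<Sum>b\<in>B. 2 * D / n)"
        proof (rule sum_mono)
          fix b assume b: "b \<in> B"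
          define p where "p = ((x - a) \<bullet> b + D) / (2 * D) * n"
          define q where "q = ((y - a) \<bullet> b + D) / (2 * D) * n"
          have "real (g b) \<le> p" "p \<le> real (g b) + 1" "real (g b) \<le> q" "q \<le> real (g b) + 1"
            using x y b by (simp_all add: C_def p_def q_def)
          then have "\<bar>p - q\<bar> \<le> 1" by linarith
          moreover have "p - q = (x - y) \<bullet> b / (2 * D) * n"
            unfolding p_def q_def by (simp add: algebra_simps diff_divide_distrib add_divide_distrib)
          ultimately have "\<bar>(x - y) \<bullet> b\<bar> / (2 * D) * n \<le> 1"
            using D by (simp add: abs_mult)
          then show "norm (((x - y) \<bullet> b) *\<^sub>R b) \<le> 2 * D / n"
            using B(2)[OF b] D n by (simp add: field_simps)
        qed
        also have "\<dots> = 2 * D * k / n" by (simp add: k_def)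
        finally show "norm (x - y) \<le> 2 * D * k / n" .
      qed (use D in auto)
    qed
    ultimately have "hausdorff_premeasure s \<delta> S \<le>
        ennreal (real (card G) * (unit_ball_vol (real s) * (2 * D * k / n / 2) ^ s))"
      using D n by (intro hausdorff_premeasure_le_finite_cover[OF finG]) auto
    also have "\<dots> \<le> ennreal (c / n)"
    proof (rule ennreal_leI)
      have "real (Suc n) ^ k \<le> (2 * real n) ^ k"
        using n by (intro power_mono) auto
      then have "real (card G) * (unit_ball_vol (real s) * (2 * D * k / n / 2) ^ s)
          \<le> (2 * real n) ^ k * (unit_ball_vol (real s) * (2 * D * k / n / 2) ^ s)"
        unfolding cardG using D by (intro mult_right_mono) auto
      also have "\<dots> = c * (real n ^ k / real n ^ s)"
        by (simp add: c_def power_mult_distrib power_divide mult_ac)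
      also have "real n ^ k / real n ^ s \<le> real n ^ k / real n ^ Suc k"
        using n k by (intro divide_left_mono power_increasing) auto
      also have "real n ^ k / real n ^ Suc k = 1 / n"
        using n by simp
      finally show "real (card G) * (unit_ball_vol (real s) * (2 * D * k / n / 2) ^ s) \<le> c / n"
        using c by (simp add: mult_left_mono)
    qed
    finally show ?thesis .
  qed
  have "hausdorff_premeasure s \<delta> S \<le> 0" if \<delta>: "0 < \<delta>" for \<delta>
  proof (rule ennreal_le_epsilon)
    fix e :: real assume e: "0 < e"
    obtain n :: nat where n: "max (2 * D * k / \<delta>) (c / e) < n" using reals_Archimedean2 by blast
    then have n0: "0 < n" using D \<delta>
      by (metis (no_types) divide_nonneg_pos less_max_iff_disj max.strict_boundedE mult_nonneg_nonneg of_nat_0_le_iff of_nat_0_less_iff order_le_less_trans less_imp_le zero_le_numeral)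
    have "2 * D * k / n \<le> \<delta>" "c / n \<le> e"
      using n n0 \<delta> e by (simp_all add: field_simps)
    then show "hausdorff_premeasure s \<delta> S \<le> 0 + ennreal e"
      using le[OF n0] by (auto intro: order_trans ennreal_leI)
  qed
  then show ?thesis unfolding hausdorff_outer_def by (auto intro!: antisym SUP_least)
qed

section \<open>Admissible meshes\<close>

text \<open>Near a relative interior point of \<open>S\<close> both convex sets contain the half ball on the side
  of the hyperplane on which they have points.\<close>

lemma convex_sets_on_same_side_meet:
  fixes K L S :: "'a::euclidean_space set"
  assumes K: "open K" "convex K" "S \<subseteq> closure K" and L: "open L" "convex L" "S \<subseteq> closure L"
    and S: "S \<subseteq> {x. a \<bullet> x = b}" "aff_dim S = int (DIM('a)) - 1" and a: "a \<noteq> 0"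
    and p: "p \<in> K" "a \<bullet> p < b" and q: "q \<in> L" "a \<bullet> q < b"
  shows "K \<inter> L \<noteq> {}"
proof -
  define H where "H = {x. a \<bullet> x = b}"
  define T where "T = convex hull S"
  have "affine hull S = affine hull H"
    using S aff_dim_eq_full_gen[of S H] aff_dim_hyperplane[OF a, of b] by (simp add: H_def)
  also have "affine hull H = H"
    unfolding H_def by (intro hull_same affine_hyperplane)
  finally have hull: "affine hull T = H"
    by (simp add: T_def affine_hull_convex_hull)
  have TK: "T \<subseteq> closure K" "T \<subseteq> closure L"
    unfolding T_def using K L by (simp_all add: hull_minimal convex_closure)
  have "S \<noteq> {}"
    using S(2) DIM_positive[where 'a = 'a] by auto
  then obtain s where "s \<in> rel_interior T"
    using rel_interior_eq_empty[of T] by (auto simp: T_def)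
  then obtain e where s: "s \<in> T" and e: "0 < e" "ball s e \<inter> H \<subseteq> T"
    unfolding mem_rel_interior_ball hull by auto
  have sH: "a \<bullet> s = b"
    using s hull hull_subset[of T affine] by (auto simp: H_def)
  \<comment> \<open>The ratio of the depths of p and q below the hyperplane makes \<open>w\<close>
    parallel to it. The same point \<open>y\<close> is then reached from \<open>s\<close> towards
    \<open>p\<close> and from a shifted base point \<open>s'\<close> in the hyperplane towards
    \<open>q\<close>.\<close>
  define \<alpha> where "\<alpha> = (b - a \<bullet> p) / (b - a \<bullet> q)"
  have \<alpha>: "0 < \<alpha>" "\<alpha> * (b - a \<bullet> q) = b - a \<bullet> p"
    using p q by (auto simp: \<alpha>_def)
  define w where "w = (p - s) - \<alpha> *\<^sub>R (q - s)"
  \<comment> \<open>The three bounds make \<epsilon> an admissible shrinking factor towards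
    \<open>p\<close>, keep the factor \<beta> towards \<open>q\<close> at most 1/2, and keep
    \<open>s'\<close> in the ball where the hyperplane lies in \<open>T\<close>.\<close>
  define \<epsilon> where "\<epsilon> = Min {1, 1 / (2 * \<alpha>), e / (4 * (1 + norm w))}"
  have n: "0 < 1 + norm w" by (intro add_pos_nonneg) auto
  have \<epsilon>: "0 < \<epsilon>" "\<epsilon> \<le> 1" "\<epsilon> \<le> 1 / (2 * \<alpha>)" "\<epsilon> \<le> e / (4 * (1 + norm w))"
    using \<alpha> e n by (auto simp: \<epsilon>_def)
  define \<beta> where "\<beta> = \<epsilon> * \<alpha>"
  have \<beta>: "0 < \<beta>" "\<beta> \<le> 1 / 2"
    using \<epsilon> \<alpha> by (auto simp: \<beta>_def field_simps)
  define s' where "s' = s + (\<epsilon> / (1 - \<beta>)) *\<^sub>R w"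
  define y where "y = s - \<epsilon> *\<^sub>R (s - p)"
  have "(1 - \<beta>) *\<^sub>R (s' - s) = \<epsilon> *\<^sub>R w"
    using \<beta> by (simp add: s'_def)
  then have y': "y = s' - \<beta> *\<^sub>R (s' - q)"
    by (simp add: y_def w_def \<beta>_def algebra_simps)
  have "a \<bullet> w = 0"
    using \<alpha>(2) sH by (simp add: w_def inner_diff_right inner_add_right algebra_simps)
  then have s'H: "s' \<in> H"
    using sH by (simp add: H_def s'_def inner_add_right)
  have "norm (s' - s) = \<epsilon> / (1 - \<beta>) * norm w"
    using \<epsilon> \<beta> by (simp add: s'_def)
  also have "\<dots> \<le> (2 * \<epsilon>) * (1 + norm w)"
    using \<epsilon> \<beta> by (intro mult_mono) (auto simp: field_simps)
  also have "\<dots> \<le> e / 2"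
    using \<epsilon>(4) n by (simp add: field_simps)
  also have "\<dots> < e" using e by simp
  finally have "s' \<in> T"
    using e(2) s'H by (auto simp: dist_norm norm_minus_commute)
  have "y \<in> interior K"
    unfolding y_def using K p s TK \<epsilon>
    by (intro mem_interior_closure_convex_shrink) (auto simp: interior_open)
  moreover have "y \<in> interior L"
    unfolding y' using L q \<open>s' \<in> T\<close> TK \<beta>
    by (intro mem_interior_closure_convex_shrink) (auto simp: interior_open)
  ultimately show ?thesis
    using K L by (auto simp: interior_open)
qed

text \<open>Each open set has a point off the hyperplane, and there are only two sides, so two of
  the three sets share a side and meet. This is what makes the neighbour across an edge
  unique.\<close>

lemma no_three_disjoint_convex_at_facet:
  fixes K1 K2 K3 S :: "'a::euclidean_space set"
  assumes K: "\<And>K. K \<in> {K1, K2, K3} \<Longrightarrow> open K \<and> convex K \<and> S \<subseteq> closure K"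
    and disj: "K1 \<inter> K2 = {}" "K1 \<inter> K3 = {}" "K2 \<inter> K3 = {}"
    and S: "S \<subseteq> {x. a \<bullet> x = b}" "aff_dim S = int (DIM('a)) - 1" and a: "a \<noteq> 0"
  shows False
proof -
  have "S \<noteq> {}"
    using S(2) DIM_positive[where 'a = 'a] by auto
  have "\<exists>p\<in>K. a \<bullet> p < b \<or> - a \<bullet> p < - b" if "K \<in> {K1, K2, K3}" for K
  proof (rule ccontr)
    assume "\<not> ?thesis"
    then have "K \<subseteq> {x. a \<bullet> x = b}" by force
    then have "interior K \<subseteq> {}"
      using interior_mono[of K "{x. a \<bullet> x = b}"] a by simp
    then have "K = {}" using K[OF that] by (simp add: interior_open)
    then show False using K[OF that] \<open>S \<noteq> {}\<close> by simp
  qed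
  moreover have "K \<inter> L \<noteq> {}" if "K \<in> {K1, K2, K3}" "L \<in> {K1, K2, K3}"
      "p \<in> K" "q \<in> L" "a \<bullet> p < b \<and> a \<bullet> q < b \<or> - a \<bullet> p < - b \<and> - a \<bullet> q < - b" for K L p q
    using that(5)
  proof
    assume "a \<bullet> p < b \<and> a \<bullet> q < b"
    then show ?thesis
      using K[OF that(1)] K[OF that(2)] that(3,4) S a
      by (intro convex_sets_on_same_side_meet[of K S L a b p q]) auto
  next
    assume "- a \<bullet> p < - b \<and> - a \<bullet> q < - b"
    then show ?thesis
      using K[OF that(1)] K[OF that(2)] that(3,4) S a
      by (intro convex_sets_on_same_side_meet[of K S L "- a" "- b" p q]) auto
  qed
  ultimately show False
    using disj by (metis Int_commute insertI1 insertI2)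
qed

lemma closure_finite_Union: "finite F \<Longrightarrow> closure (\<Union>F) = (\<Union>K\<in>F. closure K)"
  by (induction F rule: finite_induct) auto

lemma separates_sym: "separates M \<sigma> K L \<longleftrightarrow> separates M \<sigma> L K"
  by (auto simp: separates_def)

context admissible_mesh begin

section \<open>How cells and edges meet\<close>

lemma bounded_cell: "K \<in> cells M \<Longrightarrow> bounded K"
  by (meson bounded_subset cell closure_subset polytope_imp_bounded)

text \<open>\<open>measure\<close> is 0 on sets that are not measurable, so its positivity on edges
  contains their measurability.\<close>

lemma edge_in_sets:
  assumes "\<sigma> \<in> edges M"
  shows "\<sigma> \<in> sets surface_measure" "emeasure surface_measure \<sigma> \<noteq> 0"
proof -
  have "measure surface_measure \<sigma> \<noteq> 0" using edge_measure[OF assms] by simp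
  then show "\<sigma> \<in> sets surface_measure" "emeasure surface_measure \<sigma> \<noteq> 0"
    unfolding measure_def by (metis emeasure_notin_sets enn2real_0, metis enn2real_0)
qed

lemma edge_not_subset_null: "\<sigma> \<in> edges M \<Longrightarrow> Z \<in> null_sets surface_measure \<Longrightarrow> \<not> \<sigma> \<subseteq> Z"
  using edge_in_sets null_sets_subset[of Z surface_measure \<sigma>] by auto

lemma edge_nonempty: "\<sigma> \<in> edges M \<Longrightarrow> \<sigma> \<noteq> {}"
  using edge_not_subset_null[of \<sigma> "{}"] by auto

lemma exists_edge: "K \<in> cells M \<Longrightarrow> \<exists>\<sigma>. \<sigma> \<in> cell_edges M K"
  using cell_boundary[of K] frontier_eq_empty[of K] cell[of K] bounded_cell[of K] not_bounded_UNIV by auto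

text \<open>The cell only serves to provide an edge, the set of nonzero measure that identifies the
  surface measure with the Hausdorff outer measure.\<close>

lemma null_set_imp_hausdorff_null:
  fixes Z :: "'a set"
  assumes "K \<in> cells M" and Z: "Z \<in> null_sets surface_measure"
  shows "hausdorff_outer (DIM('a) - 1) Z = 0"
proof -
  obtain \<sigma> where "\<sigma> \<in> edges M" using exists_edge[OF assms(1)] by (auto simp: cell_edges_def)
  from emeasure_surface_measure_eq[OF edge_in_sets(2)[OF this], of Z] Z show ?thesis
    by (simp add: null_sets_def)
qed

text \<open>The degenerate cylinder in direction 0 over a set is the set itself, so surface null
  sets are Lebesgue null.\<close>

lemma open_subset_null:
  fixes U Z :: "'a set"
  assumes "K \<in> cells M" and Z: "Z \<in> null_sets surface_measure" and U: "open U" "U \<subseteq> Z"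
  shows "U = {}"
proof -
  have "negligible {z - t *\<^sub>R 0 | z t. z \<in> Z \<and> t \<in> {0..1::real}}"
    by (rule negligible_cylinder_over_hausdorff_null[OF null_set_imp_hausdorff_null[OF assms(1) Z]])
  moreover have "U \<subseteq> {z - t *\<^sub>R 0 | z t. z \<in> Z \<and> t \<in> {0..1::real}}"
    using U by (fastforce intro: exI[of _ 0])
  ultimately have "negligible U" by (rule negligible_subset)
  with U show ?thesis using open_not_negligible by blast
qed

lemma open_subset_edge_closure:
  assumes \<sigma>: "\<sigma> \<in> edges M" and U: "open U" "U \<subseteq> closure \<sigma>"
  shows "U = {}"
proof -
  obtain a b where ab: "a \<noteq> 0" "\<sigma> \<subseteq> {x. a \<bullet> x = b}" using edge_hyperplane[OF \<sigma>] by blast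
  have "closure \<sigma> \<subseteq> {x. a \<bullet> x = b}"
    using ab by (intro closure_minimal closed_hyperplane)
  with U have "U \<subseteq> interior {x. a \<bullet> x = b}"
    by (intro interior_maximal) auto
  then show ?thesis using ab by simp
qed

text \<open>The mesh conditions speak of closures only. An overlap of two cells would be a nonempty
  open set inside a surface null set or inside the closure of an edge; neither exists.\<close>

lemma cells_disjoint:
  assumes "K \<in> cells M" "L \<in> cells M" "K \<noteq> L"
  shows "K \<inter> L = {}"
proof -
  have sub: "K \<inter> L \<subseteq> closure K \<inter> closure L" using closure_subset by blast
  have op: "open (K \<inter> L)" using cell[OF assms(1)] cell[OF assms(2)] by (intro open_Int) simp_all
  from cell_intersection[OF assms] show ?thesis
  proof
    assume "closure K \<inter> closure L \<in> null_sets surface_measure"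
    from open_subset_null[OF assms(1) this op sub] show ?thesis .
  next
    assume "\<exists>\<sigma>. separates M \<sigma> K L"
    then obtain \<sigma> where \<sigma>: "\<sigma> \<in> edges M" "closure K \<inter> closure L = closure \<sigma>"
      by (auto simp: separates_def)
    show ?thesis
      by (rule open_subset_edge_closure[OF \<sigma>(1) op sub[unfolded \<sigma>(2)]])
  qed
qed

lemma cell_not_edge: "K \<in> cells M \<Longrightarrow> K \<notin> edges M"
  using open_subset_edge_closure[of K K] cell[of K] closure_subset[of K] by auto

text \<open>The hyperplane bounds the dimension from above; from below, a bounded set of lower
  dimension would have Hausdorff measure zero.\<close>

lemma edge_aff_dim:
  assumes \<sigma>: "\<sigma> \<in> edges M" and ab: "a \<noteq> 0" "\<sigma> \<subseteq> {x. a \<bullet> x = b}"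
  shows "aff_dim \<sigma> = int (DIM('a)) - 1"
proof -
  obtain K where K: "K \<in> cells M" "\<sigma> \<subseteq> frontier K"
  proof -
    have "\<sigma> \<in> (\<Union>K\<in>cells M. cell_edges M K)" using \<sigma> by (subst edges_of_cells[symmetric])
    then show ?thesis using that by (auto simp: cell_edges_def)
  qed
  have "bounded \<sigma>"
    using bounded_subset[OF bounded_closure[OF bounded_cell[OF K(1)]], of \<sigma>] K(2)
    by (auto simp: frontier_def)
  moreover have "hausdorff_outer (DIM('a) - 1) \<sigma> \<noteq> 0"
    using emeasure_surface_measure_eq[of \<sigma> \<sigma>] edge_in_sets[OF \<sigma>] by simp
  ultimately have "\<not> aff_dim \<sigma> < int (DIM('a) - 1)"
    using hausdorff_outer_low_dim[of \<sigma> "DIM('a) - 1"] by linarith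
  moreover have "aff_dim \<sigma> \<le> int (DIM('a)) - 1"
    using aff_dim_subset[OF ab(2)] aff_dim_hyperplane[OF ab(1), of b] by simp
  ultimately show ?thesis
    using DIM_positive[where 'a = 'a] by (simp add: of_nat_diff Suc_leI)
qed

lemma edge_at_most_two_cells:
  assumes \<sigma>: "\<sigma> \<in> edges M" and K: "K1 \<in> cells M" "K2 \<in> cells M" "K3 \<in> cells M"
    and neq: "K1 \<noteq> K2" "K1 \<noteq> K3" "K2 \<noteq> K3"
    and sub: "\<sigma> \<subseteq> closure K1" "\<sigma> \<subseteq> closure K2" "\<sigma> \<subseteq> closure K3"
  shows False
proof -
  obtain a b where ab: "a \<noteq> 0" "\<sigma> \<subseteq> {x. a \<bullet> x = b}" using edge_hyperplane[OF \<sigma>] by blast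
  show False
  proof (rule no_three_disjoint_convex_at_facet)
    show "open K \<and> convex K \<and> \<sigma> \<subseteq> closure K" if "K \<in> {K1, K2, K3}" for K
      using that K sub cell by blast
    show "K1 \<inter> K2 = {}" "K1 \<inter> K3 = {}" "K2 \<inter> K3 = {}"
      using cells_disjoint K neq by blast+
  qed (fact ab edge_aff_dim[OF \<sigma> ab])+
qed

lemma separates_imp_cell_edge:
  assumes "separates M \<sigma> K L"
  shows "\<sigma> \<in> cell_edges M K"
proof -
  have *: "\<sigma> \<in> edges M" "K \<in> cells M" "L \<in> cells M" "K \<noteq> L" "closure K \<inter> closure L = closure \<sigma>"
    using assms by (auto simp: separates_def)
  then have sub: "\<sigma> \<subseteq> closure K" "\<sigma> \<subseteq> closure L" using closure_subset[of \<sigma>] by auto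
  have "K \<inter> closure L = {}"
    using cells_disjoint[OF *(2,3,4)] cell[OF *(2)] by (simp add: open_Int_closure_eq_empty)
  with sub have "\<sigma> \<subseteq> frontier K"
    using cell[OF *(2)] by (auto simp: frontier_def interior_open)
  with * show ?thesis by (simp add: cell_edges_def)
qed

text \<open>The closures meet in more than a null set, so the mesh provides some edge \<sigma>'
  between the cells. If it were not \<sigma>, then \<sigma> would lie in the null overlap of the two
  edges and the null rim of \<sigma>'.\<close>

lemma common_edge_separates:
  assumes \<sigma>: "\<sigma> \<in> edges M" and K: "K \<in> cells M" "L \<in> cells M" "K \<noteq> L"
    and sub: "\<sigma> \<subseteq> closure K" "\<sigma> \<subseteq> closure L"
  shows "separates M \<sigma> K L"
proof -
  have "closure K \<inter> closure L \<notin> null_sets surface_measure"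
    using edge_not_subset_null[OF \<sigma>] sub by blast
  then obtain \<sigma>' where \<sigma>': "separates M \<sigma>' K L" using cell_intersection[OF K] by blast
  then have e: "\<sigma>' \<in> edges M" "closure K \<inter> closure L = closure \<sigma>'" by (auto simp: separates_def)
  have "\<sigma> = \<sigma>'"
  proof (rule ccontr)
    assume "\<sigma> \<noteq> \<sigma>'"
    then have "\<sigma> \<inter> \<sigma>' \<union> (closure \<sigma>' - \<sigma>') \<in> null_sets surface_measure"
      using edge_overlap[OF \<sigma> e(1)] edge_closure[OF e(1)] by blast
    moreover have "\<sigma> \<subseteq> \<sigma> \<inter> \<sigma>' \<union> (closure \<sigma>' - \<sigma>')" using sub e by auto
    ultimately show False using edge_not_subset_null[OF \<sigma>] by blast
  qed
  with \<sigma>' show ?thesis by simp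
qed

lemma neighbour_eq:
  assumes "separates M \<sigma> K L"
  shows "neighbour M K \<sigma> = L"
  unfolding neighbour_def
proof (rule the_equality)
  fix L' assume L': "separates M \<sigma> K L'"
  show "L' = L"
  proof (rule ccontr)
    assume "L' \<noteq> L"
    then show False
      using assms L' closure_subset[of \<sigma>]
      by (intro edge_at_most_two_cells[of \<sigma> K L L']) (auto simp: separates_def)
  qed
qed (rule assms)

lemma cell_edge_subset_closure: "\<sigma> \<in> cell_edges M K \<Longrightarrow> \<sigma> \<in> edges M \<and> \<sigma> \<subseteq> closure K"
  by (auto simp: cell_edges_def frontier_def)

text \<open>The mesh gives some pair of cells separated by \<sigma>; since no third cell can touch
  \<sigma> along all of it, K is one of the pair.\<close>

lemma interior_cell_edge:
  assumes K: "K \<in> cells M" and \<sigma>: "\<sigma> \<in> cell_edges M K" "\<not> \<sigma> \<subseteq> frontier \<Omega>"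
  shows "separates M \<sigma> K (neighbour M K \<sigma>)"
proof -
  have e: "\<sigma> \<in> edges M" "\<sigma> \<subseteq> closure K" using cell_edge_subset_closure[OF \<sigma>(1)] by auto
  then obtain K' L' where s: "separates M \<sigma> K' L'"
    using edge_position[OF e(1)] \<sigma>(2) interior_edge[OF e(1)] by blast
  have sub: "\<sigma> \<subseteq> closure K'" "\<sigma> \<subseteq> closure L'" and c: "K' \<in> cells M" "L' \<in> cells M" "K' \<noteq> L'"
    using s closure_subset[of \<sigma>] by (auto simp: separates_def)
  have "K = K' \<or> K = L'"
    using edge_at_most_two_cells[OF e(1) K c(1,2) _ _ c(3) e(2) sub] by blast
  then obtain L where L: "separates M \<sigma> K L" using s separates_sym[of M \<sigma> K' L'] by blast
  with neighbour_eq[OF L] show ?thesis by simp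
qed

lemma separates_not_boundary:
  assumes "open \<Omega>" "separates M \<sigma> K L"
  shows "\<not> \<sigma> \<subseteq> frontier \<Omega>"
proof -
  have \<sigma>: "\<sigma> \<in> edges M" using assms by (auto simp: separates_def)
  then have "\<sigma> \<subseteq> \<Omega>" using interior_edge[OF \<sigma>] assms(2) by blast
  then show ?thesis
    using assms(1) edge_nonempty[OF \<sigma>] by (auto simp: frontier_def interior_open)
qed

text \<open>This lets an edge value on the boundary be defined from the values of the one cell
  behind it.\<close>

lemma boundary_edge_unique_cell:
  assumes "open \<Omega>" and K: "K \<in> cells M" "L \<in> cells M"
    and \<sigma>: "\<sigma> \<in> cell_edges M K" "\<sigma> \<in> cell_edges M L" "\<sigma> \<subseteq> frontier \<Omega>"
  shows "K = L"
  using common_edge_separates[of \<sigma> K L] cell_edge_subset_closure[OF \<sigma>(1)] cell_edge_subset_closure[OF \<sigma>(2)]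
    separates_not_boundary[OF assms(1), of \<sigma> K L] K \<sigma>(3) by blast

lemma transmissibility_pos:
  assumes op: "open \<Omega>" and K: "K \<in> cells M" and \<sigma>: "\<sigma> \<in> cell_edges M K"
  shows "0 < transmissibility \<Omega> M K \<sigma>"
proof -
  have e: "\<sigma> \<in> edges M" using \<sigma> by (simp add: cell_edges_def)
  have "0 < edge_dist \<Omega> M K \<sigma>"
  proof (cases "\<sigma> \<subseteq> frontier \<Omega>")
    case True
    then have "closure \<sigma> \<subseteq> frontier \<Omega>" by (intro closure_minimal) auto
    moreover have "centre M K \<notin> frontier \<Omega>"
      using centre[OF K] op by (auto simp: frontier_def interior_open)
    ultimately have "infdist (centre M K) \<sigma> \<noteq> 0"
      using in_closure_iff_infdist_zero[OF edge_nonempty[OF e], of "centre M K"] by auto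
    then show ?thesis
      using True infdist_nonneg[of "centre M K" \<sigma>] by (simp add: edge_dist_def)
  next
    case False
    then show ?thesis
      using orthogonal[OF interior_cell_edge[OF K \<sigma> False]] by (simp add: edge_dist_def)
  qed
  then show ?thesis
    using edge_measure[OF e] by (simp add: transmissibility_def)
qed

section \<open>Covering, connectedness and the Dirichlet boundary\<close>

lemma domain_covered:
  shows "closure \<Omega> = (\<Union>K\<in>cells M. closure K)"
  unfolding cover[symmetric] by (rule closure_finite_Union[OF finite_cells])

text \<open>If no edge joined the two families, the closures of their unions would meet in
  a \<open>(d - 1)\<close>-null set only, but almost every parallel segment leading from one
  family to the other inside the domain avoids such a set.\<close>

lemma cells_connected:
  assumes op: "open \<Omega>" and conn: "connected \<Omega>" and S: "S \<subseteq> cells M" "S \<noteq> {}" "S \<noteq> cells M"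
  shows "\<exists>K\<in>S. \<exists>L\<in>cells M - S. \<exists>\<sigma>. separates M \<sigma> K L"
proof (rule ccontr)
  assume none: "\<not> ?thesis"
  define U where "U = (\<Union>K\<in>S. closure K)"
  define W where "W = (\<Union>L\<in>cells M - S. closure L)"
  define Z where "Z = U \<inter> W"
  have finS: "finite S" using S(1) finite_cells finite_subset by blast
  obtain K0 L0 where K0: "K0 \<in> S" and L0: "L0 \<in> cells M" "L0 \<notin> S" using S by blast
  have Z: "Z = (\<Union>K\<in>S. \<Union>L\<in>cells M - S. closure K \<inter> closure L)"
    by (auto simp: Z_def U_def W_def)
  have "closure K \<inter> closure L \<in> null_sets surface_measure" if "K \<in> S" "L \<in> cells M - S" for K L
    using cell_intersection[of K L] none that S(1) by blast
  then have Znull: "Z \<in> null_sets surface_measure"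
    unfolding Z using finS finite_cells by (intro null_sets.finite_UN finite_Diff)
  have closed: "closed U" "closed W"
    unfolding U_def W_def using finS finite_cells by auto
  have cov: "\<Omega> \<subseteq> U \<union> W"
  proof
    fix x assume "x \<in> \<Omega>"
    then have "x \<in> (\<Union>K\<in>cells M. closure K)"
      using closure_subset[of \<Omega>] unfolding domain_covered by (rule subsetD[rotated])
    then show "x \<in> U \<union> W" unfolding U_def W_def by blast
  qed
  have K0': "K0 \<in> cells M" using K0 S(1) by blast
  have "K0 \<subseteq> U" "L0 \<subseteq> W"
    using K0 L0 closure_subset[of K0] closure_subset[of L0] by (auto simp: U_def W_def)
  then have "U \<inter> \<Omega> \<noteq> {}" "W \<inter> \<Omega> \<noteq> {}"
    using cell[OF K0'] cell[OF L0(1)] by blast+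
  \<comment> \<open>Connectedness of the domain yields a common point of the two closed unions
    inside it; a ball around it in the domain contains points of cells of both families.\<close>
  then obtain x where x: "x \<in> U" "x \<in> W" "x \<in> \<Omega>"
    using conn closed cov unfolding connected_closed by blast
  obtain r where r: "0 < r" "ball x r \<subseteq> \<Omega>" using op x(3) open_contains_ball by blast
  obtain K where K: "K \<in> S" "x \<in> closure K" using x by (auto simp: U_def)
  obtain L where L: "L \<in> cells M" "L \<notin> S" "x \<in> closure L" using x by (auto simp: W_def)
  have opKL: "open K" "open L"
    using cell[of K] cell[OF L(1)] subsetD[OF S(1) K(1)] by simp_all
  obtain p where p: "p \<in> K" "p \<in> ball x r"
    using K(2) r(1) by (auto simp: closure_approachable dist_commute)
  obtain q where q: "q \<in> L" "q \<in> ball x r"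
    using L(3) r(1) by (auto simp: closure_approachable dist_commute)
  have "open (K \<inter> ball x r)" "p \<in> K \<inter> ball x r" using p opKL by auto
  then obtain \<rho>1 where \<rho>1: "0 < \<rho>1" "ball p \<rho>1 \<subseteq> K \<inter> ball x r"
    by (rule openE)
  have "open (L \<inter> ball x r)" "q \<in> L \<inter> ball x r" using q opKL by auto
  then obtain \<rho>2 where \<rho>2: "0 < \<rho>2" "ball q \<rho>2 \<subseteq> L \<inter> ball x r"
    by (rule openE)
  define \<rho> where "\<rho> = min \<rho>1 \<rho>2"
  define v where "v = q - p"
  \<comment> \<open>Each segment from y near p to y + v near q stays in the domain and passes from
    \<open>U\<close> to \<open>W\<close>, so it hits \<open>Z\<close>. Thus a whole ball lies in the
    negligible cylinder over \<open>Z\<close>.\<close>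
  have "ball p \<rho> \<subseteq> {z - t *\<^sub>R v | z t. z \<in> Z \<and> t \<in> {0..1}}"
  proof
    fix y assume y: "y \<in> ball p \<rho>"
    have "dist q (y + v) = dist p y" by (simp add: v_def dist_norm algebra_simps)
    with y have "y \<in> ball p \<rho>1" "y + v \<in> ball q \<rho>2" by (simp_all add: \<rho>_def)
    then have y1: "y \<in> K" "y \<in> ball x r" and y2: "y + v \<in> L" "y + v \<in> ball x r"
      using \<rho>1(2) \<rho>2(2) by blast+
    define s where "s = closed_segment y (y + v)"
    have "s \<subseteq> ball x r" unfolding s_def using y1 y2 by (intro closed_segment_subset) auto
    then have "s \<subseteq> U \<union> W" using r cov by blast
    moreover have "y \<in> U \<inter> s" "y + v \<in> W \<inter> s"
      using y1 y2 K L closure_subset[of K] closure_subset[of L] by (auto simp: U_def W_def s_def)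
    moreover have "connected s" by (simp add: s_def)
    ultimately have "U \<inter> W \<inter> s \<noteq> {}"
      using closed unfolding connected_closed by blast
    then obtain z where z: "z \<in> Z" "z \<in> s" by (auto simp: Z_def)
    then obtain t where t: "0 \<le> t" "t \<le> 1" "z = (1 - t) *\<^sub>R y + t *\<^sub>R (y + v)"
      by (auto simp: s_def in_segment)
    then have "y = z - t *\<^sub>R v" by (simp add: algebra_simps)
    then show "y \<in> {z - t *\<^sub>R v | z t. z \<in> Z \<and> t \<in> {0..1}}" using z t by auto
  qed
  moreover have "negligible {z - t *\<^sub>R v | z t. z \<in> Z \<and> t \<in> {0..1}}"
    by (rule negligible_cylinder_over_hausdorff_null[OF null_set_imp_hausdorff_null[OF L(1) Znull]])
  ultimately have "negligible (ball p \<rho>)" using negligible_subset by blast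
  moreover have "0 < \<rho>" using \<rho>1 \<rho>2 by (simp add: \<rho>_def)
  ultimately show False
    using open_not_negligible[of "ball p \<rho>"] by simp
qed

text \<open>Every boundary point lies in the closure of an edge. Without Dirichlet edges, a point of
  \<Gamma>D could only lie on the rims of edges, finitely many null sets.\<close>

lemma exists_dirichlet_edge:
  assumes op: "open \<Omega>" and fr: "frontier \<Omega> = \<Gamma>D \<union> \<Gamma>N" "\<Gamma>D \<inter> \<Gamma>N = {}"
    and pos: "emeasure surface_measure \<Gamma>D > 0"
    and edge: "\<And>\<sigma>. \<sigma> \<in> edges M \<Longrightarrow> \<sigma> \<subseteq> frontier \<Omega> \<Longrightarrow> \<sigma> \<subseteq> \<Gamma>D \<or> \<sigma> \<subseteq> \<Gamma>N"
  shows "\<exists>\<sigma>\<in>edges M. \<sigma> \<subseteq> frontier \<Omega> \<and> \<sigma> \<subseteq> \<Gamma>D"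
proof (rule ccontr)
  assume none: "\<not> ?thesis"
  define Z where "Z = (\<Union>\<sigma>\<in>edges M. closure \<sigma> - \<sigma>)"
  have Z: "Z \<in> null_sets surface_measure"
    unfolding Z_def using finite_edges edge_closure by (intro null_sets.finite_UN) auto
  have "\<Gamma>D \<subseteq> Z"
  proof
    fix x assume x: "x \<in> \<Gamma>D"
    then have "x \<in> frontier \<Omega>" using fr(1) by blast
    then have "x \<in> closure \<Omega>" and "x \<notin> \<Omega>"
      using op by (simp_all add: frontier_def interior_open)
    then obtain K where K: "K \<in> cells M" "x \<in> closure K" unfolding domain_covered by blast
    then have "x \<in> frontier K"
      using cell[OF K(1)] \<open>x \<notin> \<Omega>\<close> by (auto simp: frontier_def interior_open)
    then have "x \<in> (\<Union>\<sigma>\<in>cell_edges M K. closure \<sigma>)"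
      unfolding cell_boundary[OF K(1)] .
    then obtain \<sigma> where \<sigma>: "\<sigma> \<in> edges M" "x \<in> closure \<sigma>"
      by (auto simp: cell_edges_def)
    have "\<sigma> \<subseteq> \<Omega> \<or> \<sigma> \<subseteq> \<Gamma>N"
      using edge_position[OF \<sigma>(1)] edge[OF \<sigma>(1)] none \<sigma>(1) by auto
    then have "x \<notin> \<sigma>"
      using x \<open>x \<notin> \<Omega>\<close> fr(2) by auto
    with \<sigma> show "x \<in> Z" by (auto simp: Z_def)
  qed
  then have "emeasure surface_measure \<Gamma>D \<le> emeasure surface_measure Z"
    using Z by (intro emeasure_mono) auto
  with Z pos show False by auto
qed

lemma cell_measure_pos: "K \<in> cells M \<Longrightarrow> 0 < measure lebesgue K"
  using open_not_negligible[of K] cell[of K] lmeasurable_open[OF bounded_cell[of K]]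
  by (auto simp: negligible_iff_measure zero_less_measure_iff less_le)

text \<open>If all means vanish, \<open>U\<close> is zero almost everywhere on every cell, and the
  cells miss only their frontiers, which are negligible because the cells are convex.\<close>

lemma cell_mean_nonneg_nontrivial:
  assumes op: "open \<Omega>" and int: "integrable (lebesgue_on \<Omega>) U"
    and nonneg: "AE x in lebesgue_on \<Omega>. 0 \<le> U x" and nz: "\<not> (AE x in lebesgue_on \<Omega>. U x = 0)"
  shows "\<And>K. K \<in> cells M \<Longrightarrow> 0 \<le> cell_mean U K" and "\<exists>K\<in>cells M. 0 < cell_mean U K"
proof -
  have AE_on: "(AE x in lebesgue_on S. P x) \<longleftrightarrow> (AE x in lebesgue. x \<in> S \<longrightarrow> P x)"
    if "open S" for S :: "'a set" and P
    by (rule AE_restrict_space_iff) (use that in simp)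
  have opK: "open K" "K \<subseteq> \<Omega>" if "K \<in> cells M" for K using cell[OF that] by auto
  have nnK: "AE x in lebesgue_on K. 0 \<le> U x" if "K \<in> cells M" for K
    using nonneg unfolding AE_on[OF op] AE_on[OF opK(1)[OF that]]
    by eventually_elim (use opK(2)[OF that] in blast)
  have intK: "integrable (lebesgue_on K) U" if "K \<in> cells M" for K
  proof -
    have "set_integrable lebesgue \<Omega> U"
      using int op by (simp add: integrable_restrict_space set_integrable_def)
    then have "set_integrable lebesgue K U"
      by (rule set_integrable_subset) (use opK[OF that] in auto)
    then show ?thesis
      using opK(1)[OF that] by (simp add: integrable_restrict_space set_integrable_def)
  qed
  have LINT: "0 \<le> (LINT x|lebesgue_on K. U x)" if "K \<in> cells M" for K
    by (rule integral_nonneg_AE[OF nnK[OF that]])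
  then show mean: "0 \<le> cell_mean U K" if "K \<in> cells M" for K
    using that by (simp add: cell_mean_def)
  show "\<exists>K\<in>cells M. 0 < cell_mean U K"
  proof (rule ccontr)
    assume none: "\<not> ?thesis"
    have "AE x in lebesgue. x \<in> K \<longrightarrow> U x = 0" if "K \<in> cells M" for K
    proof -
      have "cell_mean U K = 0" using none mean that by force
      then have "(LINT x|lebesgue_on K. U x) = 0"
        using cell_measure_pos[OF that] by (simp add: cell_mean_def)
      then have "AE x in lebesgue_on K. U x = 0"
        using integral_nonneg_eq_0_iff_AE[OF intK[OF that] nnK[OF that]] by simp
      then show ?thesis unfolding AE_on[OF opK(1)[OF that]] .
    qed
    then have "AE x in lebesgue. \<forall>K\<in>cells M. x \<in> K \<longrightarrow> U x = 0"
      by (intro AE_finite_allI finite_cells)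
    moreover have "negligible (\<Union>K\<in>cells M. frontier K)"
      using finite_cells cell by (intro negligible_Union finite_imageI) (auto intro: negligible_convex_frontier)
    then have "AE x in lebesgue. x \<notin> (\<Union>K\<in>cells M. frontier K)"
      unfolding negligible_iff_null_sets by (rule AE_not_in)
    ultimately have "AE x in lebesgue. x \<in> \<Omega> \<longrightarrow> U x = 0"
    proof eventually_elim
      case (elim x)
      show ?case
      proof
        assume "x \<in> \<Omega>"
        then have "x \<in> (\<Union>K\<in>cells M. closure K)"
          using closure_subset[of \<Omega>] unfolding domain_covered by (rule subsetD[rotated])
        then obtain K where K: "K \<in> cells M" "x \<in> closure K" by blast
        with elim(2) have "x \<in> K" using opK(1)[OF K(1)] by (auto simp: frontier_def interior_open)
        with elim(1) K show "U x = 0" by blast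
      qed
    qed
    with nz show False unfolding AE_on[OF op] by blast
  qed
qed

section \<open>The mesh as a weighted graph\<close>

text \<open>Between cells, summing over the separating edges avoids choosing one, gives 0 when there
  is none, and is visibly symmetric. \<open>E\<close> holds the Dirichlet edges, which occur as
  second argument only.\<close>

definition mesh_weight :: "'a set set \<Rightarrow> 'a set \<Rightarrow> 'a set \<Rightarrow> real" where
  "mesh_weight E x y =
    (if y \<in> E then (if y \<in> cell_edges M x then transmissibility \<Omega> M x y else 0)
     else (\<Sum>\<sigma> | separates M \<sigma> x y. measure surface_measure \<sigma> / dist (centre M x) (centre M y)))"

lemma finite_cell_edges: "finite (cell_edges M K)"
  using finite_edges by (simp add: cell_edges_def)

lemma finite_separates: "finite {\<sigma>. separates M \<sigma> K L}"
  using finite_edges by (rule finite_subset[rotated]) (auto simp: separates_def)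

lemma mesh_weight_sym: "x \<notin> E \<Longrightarrow> y \<notin> E \<Longrightarrow> mesh_weight E x y = mesh_weight E y x"
  unfolding mesh_weight_def by (simp add: separates_sym[of M _ x y] dist_commute)

lemma mesh_weight_pos:
  assumes "separates M \<sigma> K L" "L \<notin> E"
  shows "0 < mesh_weight E K L"
proof -
  have "0 < (\<Sum>\<sigma> | separates M \<sigma> K L. measure surface_measure \<sigma> / dist (centre M K) (centre M L))"
  proof (rule sum_pos[OF finite_separates])
    show "{\<sigma>. separates M \<sigma> K L} \<noteq> {}" using assms(1) by blast
    fix \<sigma>' assume "\<sigma>' \<in> {\<sigma>. separates M \<sigma> K L}"
    then have "\<sigma>' \<in> edges M" by (simp add: separates_def)
    then show "0 < measure surface_measure \<sigma>' / dist (centre M K) (centre M L)"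
      using edge_measure orthogonal[OF assms(1)] by simp
  qed
  with assms(2) show ?thesis by (simp add: mesh_weight_def)
qed

lemma mesh_weight_nonneg:
  assumes "open \<Omega>" "K \<in> cells M"
  shows "0 \<le> mesh_weight E K y"
proof (cases "y \<in> E")
  case True
  then show ?thesis using transmissibility_pos[OF assms, of y] by (auto simp: mesh_weight_def less_imp_le)
next
  case False
  then show ?thesis by (simp add: mesh_weight_def sum_nonneg)
qed

text \<open>The interior edges of K are grouped by the cell on their other side; this turns the sum
  over edges of the scheme into the sum over nodes of the graph.\<close>

lemma sum_interior_edges:
  assumes op: "open \<Omega>" and K: "K \<in> cells M" and E: "E \<inter> cells M = {}"
  shows "(\<Sum>\<sigma> | \<sigma> \<in> cell_edges M K \<and> \<not> \<sigma> \<subseteq> frontier \<Omega>. transmissibility \<Omega> M K \<sigma> * h (neighbour M K \<sigma>)) =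
    (\<Sum>L\<in>cells M. mesh_weight E K L * h L)"
proof -
  define S where "S = {\<sigma>. \<sigma> \<in> cell_edges M K \<and> \<not> \<sigma> \<subseteq> frontier \<Omega>}"
  have sep: "separates M \<sigma> K (neighbour M K \<sigma>)" if "\<sigma> \<in> S" for \<sigma>
    using that interior_cell_edge[OF K] by (simp add: S_def)
  have SL: "{\<sigma> \<in> S. neighbour M K \<sigma> = L} = {\<sigma>. separates M \<sigma> K L}" for L
    using sep separates_imp_cell_edge[of _ K L] separates_not_boundary[OF op, of _ K L] neighbour_eq[of _ K L]
    by (auto simp: S_def)
  have "(\<Sum>\<sigma>\<in>S. transmissibility \<Omega> M K \<sigma> * h (neighbour M K \<sigma>)) =
      (\<Sum>L\<in>cells M. \<Sum>\<sigma> | \<sigma> \<in> S \<and> neighbour M K \<sigma> = L. transmissibility \<Omega> M K \<sigma> * h (neighbour M K \<sigma>))"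
    using sep finite_cell_edges[of K]
    by (intro sum.group[symmetric] finite_cells) (auto simp: S_def separates_def)
  also have "\<dots> = (\<Sum>L\<in>cells M. mesh_weight E K L * h L)"
  proof (rule sum.cong[OF refl])
    fix L assume "L \<in> cells M"
    then have "L \<notin> E" using E by blast
    have "(\<Sum>\<sigma> | \<sigma> \<in> S \<and> neighbour M K \<sigma> = L. transmissibility \<Omega> M K \<sigma> * h (neighbour M K \<sigma>)) =
        (\<Sum>\<sigma> | separates M \<sigma> K L. measure surface_measure \<sigma> / dist (centre M K) (centre M L) * h L)"
    proof (rule sum.cong[OF SL])
      fix \<sigma> assume "\<sigma> \<in> {\<sigma>. separates M \<sigma> K L}"
      then have "separates M \<sigma> K L" by simp
      from neighbour_eq[OF this] separates_not_boundary[OF op this]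
      show "transmissibility \<Omega> M K \<sigma> * h (neighbour M K \<sigma>) =
          measure surface_measure \<sigma> / dist (centre M K) (centre M L) * h L"
        by (simp add: transmissibility_def edge_dist_def)
    qed
    also have "\<dots> = mesh_weight E K L * h L"
      using \<open>L \<notin> E\<close> by (simp add: mesh_weight_def sum_distrib_right)
    finally show "(\<Sum>\<sigma> | \<sigma> \<in> S \<and> neighbour M K \<sigma> = L. transmissibility \<Omega> M K \<sigma> * h (neighbour M K \<sigma>)) =
      mesh_weight E K L * h L" .
  qed
  finally show ?thesis unfolding S_def .
qed

text \<open>Boundary edges where \<open>h\<close> vanishes drop out. \<open>D\<close> is
  \<open>E\<close> for N, P and V and empty for Q, while the weights keep the parameter
  \<open>E\<close>, so that both graphs share one \<open>w\<close>.\<close>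

lemma sum_cell_edges:
  assumes op: "open \<Omega>" and K: "K \<in> cells M" and E: "E \<inter> cells M = {}" "finite E"
    and D: "D \<subseteq> E" "\<And>\<sigma>. \<sigma> \<in> E \<Longrightarrow> \<sigma> \<subseteq> frontier \<Omega>"
    and h: "\<And>\<sigma>. \<sigma> \<in> cell_edges M K \<Longrightarrow> \<sigma> \<subseteq> frontier \<Omega> \<Longrightarrow> \<sigma> \<notin> D \<Longrightarrow> h \<sigma> = 0"
  shows "(\<Sum>\<sigma>\<in>cell_edges M K. transmissibility \<Omega> M K \<sigma> * h (if \<sigma> \<subseteq> frontier \<Omega> then \<sigma> else neighbour M K \<sigma>)) =
    (\<Sum>y\<in>cells M \<union> D. mesh_weight E K y * h y)"
proof -
  let ?t = "\<lambda>\<sigma>. transmissibility \<Omega> M K \<sigma> * h (if \<sigma> \<subseteq> frontier \<Omega> then \<sigma> else neighbour M K \<sigma>)"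
  define S where "S = {\<sigma>. \<sigma> \<in> cell_edges M K \<and> \<not> \<sigma> \<subseteq> frontier \<Omega>}"
  define R where "R = {\<sigma>. \<sigma> \<in> cell_edges M K \<and> \<sigma> \<subseteq> frontier \<Omega>}"
  have finD: "finite D" using D(1) E(2) finite_subset by blast
  have "sum ?t (cell_edges M K) = sum ?t S + sum ?t R"
    using finite_cell_edges[of K] by (subst sum.union_disjoint[symmetric]) (auto simp: S_def R_def intro!: sum.cong)
  also have "sum ?t S = (\<Sum>L\<in>cells M. mesh_weight E K L * h L)"
    unfolding sum_interior_edges[OF op K E(1), symmetric] S_def by (intro sum.cong) auto
  also have "sum ?t R = (\<Sum>\<sigma>\<in>R. transmissibility \<Omega> M K \<sigma> * h \<sigma>)"
    by (intro sum.cong) (auto simp: R_def)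
  also have "\<dots> = (\<Sum>\<sigma>\<in>R \<inter> D. transmissibility \<Omega> M K \<sigma> * h \<sigma>)"
    using finite_cell_edges[of K] h by (intro sum.mono_neutral_right) (auto simp: R_def)
  also have "\<dots> = (\<Sum>\<sigma>\<in>R \<inter> D. mesh_weight E K \<sigma> * h \<sigma>)"
    using D(1) by (intro sum.cong refl) (auto simp: R_def mesh_weight_def)
  also have "\<dots> = (\<Sum>\<sigma>\<in>D. mesh_weight E K \<sigma> * h \<sigma>)"
    using finD D by (intro sum.mono_neutral_left) (auto simp: R_def mesh_weight_def)
  also have "(\<Sum>L\<in>cells M. mesh_weight E K L * h L) + (\<Sum>\<sigma>\<in>D. mesh_weight E K \<sigma> * h \<sigma>) =
      (\<Sum>y\<in>cells M \<union> D. mesh_weight E K y * h y)"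
    using finite_cells finD D E by (intro sum.union_disjoint[symmetric]) auto
  finally show ?thesis .
qed

end

section \<open>The scheme\<close>

lemma flux_eq_drift_flux:
  "flux \<Omega> M u (\<lambda>s. - \<psi> s) K \<sigma> = transmissibility \<Omega> M K \<sigma> *
    drift_flux \<psi> u K (if \<sigma> \<subseteq> frontier \<Omega> then \<sigma> else neighbour M K \<sigma>)"
  by (simp add: flux_def difference_def across_def drift_flux_def add.commute)

lemma edge_mean_nonneg:
  assumes "\<And>x. x \<in> \<sigma> \<Longrightarrow> 0 \<le> U x"
  shows "0 \<le> edge_mean U \<sigma>"
  unfolding edge_mean_def set_lebesgue_integral_def
  by (intro divide_nonneg_nonneg Bochner_Integration.integral_nonneg)
    (auto simp: indicator_def assms)

context admissible_mesh begin

text \<open>The graph problem fixes the values at cells and Dirichlet edges only. The remaining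
  boundary edge values are filled in afterwards so that the prescribed fluxes vanish, which leaves
  the cell equations intact.\<close>

lemma scheme_time_step:
  assumes op: "open \<Omega>" and conn: "connected \<Omega>"
    and fr: "frontier \<Omega> = \<Gamma>D \<union> \<Gamma>N" "\<Gamma>D \<inter> \<Gamma>N = {}"
    and pos: "emeasure surface_measure \<Gamma>D > 0"
    and edge: "\<And>\<sigma>. \<sigma> \<in> edges M \<Longrightarrow> \<sigma> \<subseteq> frontier \<Omega> \<Longrightarrow> \<sigma> \<subseteq> \<Gamma>D \<or> \<sigma> \<subseteq> \<Gamma>N"
    and lam: "lam \<noteq> 0" and dt: "0 < dt"
    and init: "\<And>K. K \<in> cells M \<Longrightarrow> 0 \<le> N0 K" "\<And>K. K \<in> cells M \<Longrightarrow> 0 \<le> P0 K"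
      "\<And>K. K \<in> cells M \<Longrightarrow> 0 \<le> Q0 K"
    and nontrivial: "\<exists>K\<in>cells M. 0 < N0 K" "\<exists>K\<in>cells M. 0 < P0 K" "\<exists>K\<in>cells M. 0 < Q0 K"
    and dirichlet: "\<And>x. x \<in> \<Gamma>D \<Longrightarrow> 0 \<le> ND x \<and> 0 \<le> PD x"
  shows "\<exists>N P Q V. scheme_equations \<Omega> M lam dt A N0 P0 Q0 N P Q V \<and>
    scheme_boundary \<Omega> \<Gamma>D \<Gamma>N M ND PD VD N P Q V \<and>
    (\<forall>K\<in>cells M. 0 < N K \<and> 0 < P K \<and> 0 < Q K)"
proof -
  define E where "E = {\<sigma> \<in> edges M. \<sigma> \<subseteq> frontier \<Omega> \<and> \<sigma> \<subseteq> \<Gamma>D}"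
  define w where "w = mesh_weight E"
  have E_edge: "E \<subseteq> edges M" "\<And>\<sigma>. \<sigma> \<in> E \<Longrightarrow> \<sigma> \<subseteq> frontier \<Omega>" "finite E"
    using finite_edges by (auto simp: E_def)
  have disj: "E \<inter> cells M = {}" using cell_not_edge E_edge by blast
  interpret graph: weighted_graph "cells M" E w
  proof (rule weighted_graph.intro)
    show "w x y = w y x" if "x \<in> cells M" "y \<in> cells M" for x y
      unfolding w_def using that disj by (intro mesh_weight_sym) auto
  qed (use disj E_edge(3) in \<open>auto simp: w_def finite_cells mesh_weight_nonneg[OF op]\<close>)
  have connected: "\<exists>x\<in>S. \<exists>y\<in>cells M - S. 0 < w x y" if "S \<subseteq> cells M" "S \<noteq> {}" "S \<noteq> cells M" for S
  proof -
    have "\<exists>K\<in>S. \<exists>L\<in>cells M - S. \<exists>\<sigma>. separates M \<sigma> K L"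
      by (rule cells_connected[OF op conn that])
    then obtain K L \<sigma> where "K \<in> S" "L \<in> cells M - S" "separates M \<sigma> K L" by blast
    moreover from this have "0 < w K L"
      unfolding w_def using disj by (intro mesh_weight_pos) auto
    ultimately show ?thesis by blast
  qed
  obtain e0 where e0: "e0 \<in> E"
    using exists_dirichlet_edge[OF op fr pos edge] by (auto simp: E_def)
  then have "e0 \<in> (\<Union>K\<in>cells M. cell_edges M K)"
    using E_edge(1) by (subst edges_of_cells[symmetric]) blast
  then obtain K0 where K0: "K0 \<in> cells M" "e0 \<in> cell_edges M K0" by blast
  have ground: "0 < w K0 e0"
    using e0 K0 transmissibility_pos[OF op K0] by (simp add: w_def mesh_weight_def)
  have mean: "0 \<le> edge_mean ND \<sigma>" "0 \<le> edge_mean PD \<sigma>" if "\<sigma> \<in> E" for \<sigma>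
    using that dirichlet by (auto simp: E_def intro!: edge_mean_nonneg)
  have "\<exists>N P Q V. (\<forall>\<sigma>\<in>E. N \<sigma> = edge_mean ND \<sigma> \<and> P \<sigma> = edge_mean PD \<sigma> \<and> V \<sigma> = edge_mean VD \<sigma>) \<and>
    graph.species (\<lambda>K. measure lebesgue K / dt) 0 N0 V N \<and>
    graph.species (\<lambda>K. measure lebesgue K / dt) 0 P0 (\<lambda>K. - V K) P \<and>
    weighted_graph.species (cells M) {} w (\<lambda>K. measure lebesgue K / dt) 0 Q0 (\<lambda>K. - V K) Q \<and>
    graph.poisson (lam\<^sup>2) (\<lambda>K. measure lebesgue K) 0 (\<lambda>K. N K - P K - Q K + cell_mean A K) V \<and>
    (\<forall>K\<in>cells M. 0 < N K \<and> 0 < P K \<and> 0 < Q K)"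
    by (rule graph.scheme_step_exists; fact connected K0(1) e0 ground dt init nontrivial mean
        cell_measure_pos zero_less_power2[THEN iffD2, OF lam])
  then obtain N P Q V where bd: "\<And>\<sigma>. \<sigma> \<in> E \<Longrightarrow> N \<sigma> = edge_mean ND \<sigma> \<and> P \<sigma> = edge_mean PD \<sigma> \<and> V \<sigma> = edge_mean VD \<sigma>"
    and sol: "graph.species (\<lambda>K. measure lebesgue K / dt) 0 N0 V N"
      "graph.species (\<lambda>K. measure lebesgue K / dt) 0 P0 (\<lambda>K. - V K) P"
      "weighted_graph.species (cells M) {} w (\<lambda>K. measure lebesgue K / dt) 0 Q0 (\<lambda>K. - V K) Q"
      "graph.poisson (lam\<^sup>2) (\<lambda>K. measure lebesgue K) 0 (\<lambda>K. N K - P K - Q K + cell_mean A K) V"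
    and sol_pos: "\<And>K. K \<in> cells M \<Longrightarrow> 0 < N K \<and> 0 < P K \<and> 0 < Q K"
    by blast
  interpret insulated: weighted_graph "cells M" "{}" w
  proof (rule weighted_graph.intro)
    show "w x y = w y x" if "x \<in> cells M" "y \<in> cells M" for x y
      by (rule graph.w_sym[OF that])
  qed (auto simp: finite_cells graph.w_nonneg)
  define owner where "owner = (\<lambda>\<sigma>. SOME K. K \<in> cells M \<and> \<sigma> \<in> cell_edges M K)"
  have owner: "owner \<sigma> = K" if "K \<in> cells M" "\<sigma> \<in> cell_edges M K" "\<sigma> \<subseteq> frontier \<Omega>" for K \<sigma>
  proof -
    have "owner \<sigma> \<in> cells M \<and> \<sigma> \<in> cell_edges M (owner \<sigma>)"
      unfolding owner_def by (rule someI) (use that in blast)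
    then show ?thesis
      using boundary_edge_unique_cell[OF op, of "owner \<sigma>" K \<sigma>] that by blast
  qed
  \<comment> \<open>On a Neumann edge the cell value is copied. V then has no jump, the two
    Bernoulli weights agree, and equal densities give zero flux.\<close>
  define extend where "extend = (\<lambda>u s. if s \<in> edges M \<and> s \<notin> E then u (owner s) else u s :: real)"
  define N' where "N' = extend N"
  define P' where "P' = extend P"
  define V' where "V' = extend V"
  \<comment> \<open>The zero-flux condition solved for the edge value. A copy would not do for Q,
    which is insulated also on Dirichlet edges, where V may jump.\<close>
  define Q' where "Q' = (\<lambda>s. if s \<in> edges M then
      bernoulli_fun (V' s - V (owner s)) / bernoulli_fun (V (owner s) - V' s) * Q (owner s) else Q s)"
  have ext_node: "extend u y = u y" if "y \<in> cells M \<union> E" for u y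
    using that cell_not_edge by (auto simp: extend_def)
  have Q'_cell: "Q' K = Q K" if "K \<in> cells M" for K
    using that cell_not_edge by (auto simp: Q'_def)
  have ext_neumann: "extend u \<sigma> = u K"
    if "K \<in> cells M" "\<sigma> \<in> cell_edges M K" "\<sigma> \<subseteq> frontier \<Omega>" "\<sigma> \<notin> E" for u K \<sigma>
    using that owner[OF that(1-3)] by (simp add: extend_def cell_edges_def)
  \<comment> \<open>The factor \<open>c\<close> is 1 for N and -1 for P.\<close>
  have drift_neumann: "drift_flux (\<lambda>s. c * V' s) (extend u) K \<sigma> = 0"
    if "K \<in> cells M" "\<sigma> \<in> cell_edges M K" "\<sigma> \<subseteq> frontier \<Omega>" "\<sigma> \<notin> E" for u K \<sigma> c
    using ext_neumann[OF that] that(1) ext_node[of K]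
    by (simp add: drift_flux_def V'_def)
  have drift_Q: "drift_flux (\<lambda>s. - V' s) Q' K \<sigma> = 0"
    if "K \<in> cells M" "\<sigma> \<in> cell_edges M K" "\<sigma> \<subseteq> frontier \<Omega>" for K \<sigma>
  proof -
    have "Q' \<sigma> = bernoulli_fun (V' \<sigma> - V K) / bernoulli_fun (V K - V' \<sigma>) * Q K"
      using owner[OF that] that(2) by (simp add: Q'_def cell_edges_def)
    moreover have "V' K = V K" "Q' K = Q K"
      using that(1) ext_node[of K] Q'_cell by (simp_all add: V'_def)
    ultimately show ?thesis
      using bernoulli_fun_pos[of "V K - V' \<sigma>"] by (simp add: drift_flux_def)
  qed
  have fluxes: "flux \<Omega> M u (\<lambda>s. - \<psi> s) K \<sigma> = transmissibility \<Omega> M K \<sigma> * drift_flux \<psi> u K \<sigma>"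
    if "\<sigma> \<subseteq> frontier \<Omega>" for u \<psi> K \<sigma>
    using that by (simp add: flux_eq_drift_flux)
  have VV: "flux \<Omega> M u V' K \<sigma> = flux \<Omega> M u (\<lambda>s. - (- V' s)) K \<sigma>" for u K \<sigma> by simp
  have node_flux: "(\<Sum>y\<in>cells M \<union> E. w K y * drift_flux (\<lambda>s. c * V s) u K y) =
      (\<Sum>y\<in>cells M \<union> E. w K y * drift_flux (\<lambda>s. c * V' s) (extend u) K y)" if "K \<in> cells M" for K u c
    using that ext_node by (intro sum.cong refl) (simp add: drift_flux_def V'_def)
  have sumE: "(\<Sum>\<sigma>\<in>cell_edges M K. transmissibility \<Omega> M K \<sigma> *
      h (if \<sigma> \<subseteq> frontier \<Omega> then \<sigma> else neighbour M K \<sigma>)) = (\<Sum>y\<in>cells M \<union> E. w K y * h y)"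
    if "K \<in> cells M" "\<And>\<sigma>. \<sigma> \<in> cell_edges M K \<Longrightarrow> \<sigma> \<subseteq> frontier \<Omega> \<Longrightarrow> \<sigma> \<notin> E \<Longrightarrow> h \<sigma> = 0" for K h
    unfolding w_def by (rule sum_cell_edges[OF op that(1) disj E_edge(3) order_refl E_edge(2) that(2)])
  have "scheme_equations \<Omega> M lam dt A N0 P0 Q0 N' P' Q' V'"
    unfolding scheme_equations_def
  proof (intro ballI conjI)
    fix K assume K: "K \<in> cells M"
    have nodes: "N' K = N K" "P' K = P K" "V' K = V K"
      using K ext_node[of K] by (simp_all add: N'_def P'_def V'_def)
    have "(\<Sum>\<sigma>\<in>cell_edges M K. flux \<Omega> M N' (\<lambda>s. - V' s) K \<sigma>) =
        (\<Sum>y\<in>cells M \<union> E. w K y * drift_flux V' N' K y)"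
      unfolding flux_eq_drift_flux
      by (rule sumE[OF K]) (use drift_neumann[OF K, of _ 1 N] in \<open>simp add: N'_def\<close>)
    also have "\<dots> = (\<Sum>y\<in>cells M \<union> E. w K y * drift_flux V N K y)"
      using node_flux[OF K, of 1 N] by (simp add: N'_def)
    also have "\<dots> = measure lebesgue K / dt * (N K - N0 K)"
      using sol(1) K by (simp add: graph.species_def)
    finally show "measure lebesgue K / dt * (N' K - N0 K)
        - (\<Sum>\<sigma>\<in>cell_edges M K. flux \<Omega> M N' (\<lambda>s. - V' s) K \<sigma>) = 0"
      using nodes by simp
    have "(\<Sum>\<sigma>\<in>cell_edges M K. flux \<Omega> M P' V' K \<sigma>) =
        (\<Sum>y\<in>cells M \<union> E. w K y * drift_flux (\<lambda>s. - V' s) P' K y)"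
      unfolding VV flux_eq_drift_flux
      by (rule sumE[OF K]) (use drift_neumann[OF K, of _ "-1" P] in \<open>simp add: P'_def\<close>)
    also have "\<dots> = (\<Sum>y\<in>cells M \<union> E. w K y * drift_flux (\<lambda>s. - V s) P K y)"
      using node_flux[OF K, of "-1" P] by (simp add: P'_def)
    also have "\<dots> = measure lebesgue K / dt * (P K - P0 K)"
      using sol(2) K by (simp add: graph.species_def)
    finally show "measure lebesgue K / dt * (P' K - P0 K)
        - (\<Sum>\<sigma>\<in>cell_edges M K. flux \<Omega> M P' V' K \<sigma>) = 0"
      using nodes by simp
    have "(\<Sum>\<sigma>\<in>cell_edges M K. flux \<Omega> M Q' V' K \<sigma>) =
        (\<Sum>y\<in>cells M \<union> {}. w K y * drift_flux (\<lambda>s. - V' s) Q' K y)"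
      unfolding VV flux_eq_drift_flux w_def
      by (rule sum_cell_edges[OF op K disj E_edge(3) empty_subsetI E_edge(2) drift_Q[OF K]])
    also have "\<dots> = (\<Sum>y\<in>cells M \<union> {}. w K y * drift_flux (\<lambda>s. - V s) Q K y)"
      using K ext_node Q'_cell by (intro sum.cong refl) (simp add: drift_flux_def V'_def)
    also have "\<dots> = measure lebesgue K / dt * (Q K - Q0 K)"
      using sol(3) K by (simp add: insulated.species_def)
    finally show "measure lebesgue K / dt * (Q' K - Q0 K)
        - (\<Sum>\<sigma>\<in>cell_edges M K. flux \<Omega> M Q' V' K \<sigma>) = 0"
      using Q'_cell[OF K] by simp
    have "(\<Sum>\<sigma>\<in>cell_edges M K. transmissibility \<Omega> M K \<sigma> * difference \<Omega> M V' K \<sigma>) =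
        (\<Sum>\<sigma>\<in>cell_edges M K. transmissibility \<Omega> M K \<sigma> *
          (V' (if \<sigma> \<subseteq> frontier \<Omega> then \<sigma> else neighbour M K \<sigma>) - V' K))"
      by (intro sum.cong refl) (simp add: difference_def across_def)
    also have "\<dots> = (\<Sum>y\<in>cells M \<union> E. w K y * (V' y - V' K))"
      by (rule sumE[OF K, where h = "\<lambda>y. V' y - V' K"])
        (use ext_neumann[OF K, of _ V] nodes in \<open>simp add: V'_def\<close>)
    also have "\<dots> = (\<Sum>y\<in>cells M \<union> E. w K y * (V y - V K))"
      using K ext_node by (intro sum.cong refl) (simp add: V'_def)
    finally show "lam\<^sup>2 * (\<Sum>\<sigma>\<in>cell_edges M K. transmissibility \<Omega> M K \<sigma> * difference \<Omega> M V' K \<sigma>)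
        = measure lebesgue K * (N' K - P' K - Q' K + cell_mean A K)"
      using sol(4) K nodes Q'_cell[OF K] by (simp add: graph.poisson_def)
  qed
  moreover have "scheme_boundary \<Omega> \<Gamma>D \<Gamma>N M ND PD VD N' P' Q' V'"
    unfolding scheme_boundary_def
  proof (intro ballI impI conjI)
    fix K \<sigma> assume K: "K \<in> cells M" and \<sigma>: "\<sigma> \<in> cell_edges M K" "\<sigma> \<subseteq> frontier \<Omega>"
    have e: "\<sigma> \<in> edges M" using \<sigma> by (simp add: cell_edges_def)
    {
      assume "\<sigma> \<subseteq> \<Gamma>D"
      with e \<sigma> have "\<sigma> \<in> E" by (simp add: E_def)
      with bd[OF this] ext_node[of \<sigma>]
      show "N' \<sigma> = edge_mean ND \<sigma>" "P' \<sigma> = edge_mean PD \<sigma>" "V' \<sigma> = edge_mean VD \<sigma>"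
        by (simp_all add: N'_def P'_def V'_def)
    next
      assume "\<sigma> \<subseteq> \<Gamma>N"
      then have "\<sigma> \<notin> E" using edge_nonempty[OF e] fr(2) by (auto simp: E_def)
      note neumann = K \<sigma> this
      show "flux \<Omega> M N' (\<lambda>s. - V' s) K \<sigma> = 0"
        unfolding fluxes[OF \<sigma>(2)] using drift_neumann[OF neumann, of 1 N] by (simp add: N'_def)
      show "flux \<Omega> M P' V' K \<sigma> = 0"
        unfolding VV fluxes[OF \<sigma>(2)] using drift_neumann[OF neumann, of "-1" P] by (simp add: P'_def)
      show "across \<Omega> M V' K \<sigma> = V' K"
        using ext_neumann[OF neumann, of V] ext_node[of K V] K \<sigma>(2) by (simp add: across_def V'_def)
    next
      show "flux \<Omega> M Q' V' K \<sigma> = 0"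
        unfolding VV fluxes[OF \<sigma>(2)] using drift_Q[OF K \<sigma>] by simp
    }
  qed
  moreover have "\<forall>K\<in>cells M. 0 < N' K \<and> 0 < P' K \<and> 0 < Q' K"
    using sol_pos ext_node Q'_cell by (simp add: N'_def P'_def)
  ultimately show ?thesis by blast
qed

end

theorem theorem1:
  fixes \<Omega> \<Gamma>D \<Gamma>N :: "'a::euclidean_space set"
    and M :: "'a fv_mesh"
    and lam T \<xi>1 \<xi>2 :: real and NT :: nat
    and Nin Pin Qin ND PD VD A :: "'a \<Rightarrow> real"
  assumes domain: "open \<Omega>" "connected \<Omega>" "bounded \<Omega>" "\<Omega> \<noteq> {}"
    and parameters: "lam > 0" "T > 0" "NT > 0"
    and boundary: "lipschitz_boundary \<Omega>" "frontier \<Omega> = \<Gamma>D \<union> \<Gamma>N" "\<Gamma>D \<inter> \<Gamma>N = {}"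
      "emeasure surface_measure \<Gamma>D > 0" "openin (top_of_set (frontier \<Omega>)) \<Gamma>N"
    and initial: "\<And>U. U \<in> {Nin, Pin, Qin} \<Longrightarrow>
      LlogL \<Omega> U \<and> (AE x in lebesgue_on \<Omega>. 0 \<le> U x) \<and> \<not> (AE x in lebesgue_on \<Omega>. U x = 0)"
    and dirichlet: "\<And>x. x \<in> \<Gamma>D \<Longrightarrow> 0 \<le> ND x \<and> 0 \<le> PD x"
      "\<And>x. x \<in> \<Omega> \<Longrightarrow> 0 < ND x \<and> 0 < PD x"
      "W1inf \<Omega> (\<lambda>x. ln (ND x) - VD x)" "W1inf \<Omega> (\<lambda>x. ln (PD x) + VD x)"
    and doping: "L2 \<Omega> A"
    and mesh: "admissible_mesh \<Omega> M"
      "\<And>\<sigma>. \<sigma> \<in> edges M \<Longrightarrow> \<sigma> \<subseteq> frontier \<Omega> \<Longrightarrow> \<sigma> \<subseteq> \<Gamma>D \<or> \<sigma> \<subseteq> \<Gamma>N"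
      "\<xi>1 > 0" "\<xi>2 > 0" "mesh_regular \<Omega> M \<xi>1 \<xi>2"
  shows "\<exists>N P Q V :: nat \<Rightarrow> 'a set \<Rightarrow> real.
    scheme_solution \<Omega> \<Gamma>D \<Gamma>N M lam T NT Nin Pin Qin ND PD VD A N P Q V \<and>
    (\<forall>K\<in>cells M. \<forall>k\<in>{1..NT}. N k K > 0 \<and> P k K > 0 \<and> Q k K > 0)"
proof -
  interpret admissible_mesh \<Omega> M by (rule mesh(1))
  \<comment> \<open>The invariant of the time iteration must be weak enough for the initial means,
    which may vanish on some cells; after one step the densities are strictly positive.\<close>
  define ok where "ok = (\<lambda>u :: 'a set \<Rightarrow> real. (\<forall>K\<in>cells M. 0 \<le> u K) \<and> (\<exists>K\<in>cells M. 0 < u K))"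
  have nonempty: "cells M \<noteq> {}"
  proof
    assume "cells M = {}"
    then have "closure \<Omega> = {}" using domain_covered by simp
    then show False using domain(4) by simp
  qed
  have ok_pos: "ok u" if "\<forall>K\<in>cells M. 0 < u K" for u
    using that nonempty by (auto simp: ok_def less_imp_le)
  have ok_init: "ok (cell_mean U)" if "U \<in> {Nin, Pin, Qin}" for U
    using cell_mean_nonneg_nontrivial[OF domain(1), of U] initial[OF that]
    by (simp add: ok_def LlogL_def)
  define step where "step = (\<lambda>(N0, P0, Q0, V0 :: 'a set \<Rightarrow> real) (N, P, Q, V).
    scheme_equations \<Omega> M lam (T / real NT) A N0 P0 Q0 N P Q V \<and>
    scheme_boundary \<Omega> \<Gamma>D \<Gamma>N M ND PD VD N P Q V \<and>
    (\<forall>K\<in>cells M. 0 < N K \<and> 0 < P K \<and> 0 < Q K))"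
  define valid where "valid = (\<lambda>(n :: nat) (N, P, Q, V :: 'a set \<Rightarrow> real). ok N \<and> ok P \<and> ok Q \<and>
    (n = 0 \<longrightarrow> N = cell_mean Nin \<and> P = cell_mean Pin \<and> Q = cell_mean Qin))"
  have "\<exists>f. \<forall>n. valid n (f n) \<and> step (f n) (f (Suc n))"
  proof (rule dependent_nat_choice)
    \<comment> \<open>The scheme has no potential at time 0, so the zero function fills that
      slot.\<close>
    show "\<exists>x. valid 0 x"
      using ok_init by (intro exI[of _ "(cell_mean Nin, cell_mean Pin, cell_mean Qin, \<lambda>_. 0)"]) (simp add: valid_def)
    fix x :: "('a set \<Rightarrow> real) \<times> ('a set \<Rightarrow> real) \<times> ('a set \<Rightarrow> real) \<times> ('a set \<Rightarrow> real)" and n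
    assume x: "valid n x"
    obtain N0 P0 Q0 V0 where xe: "x = (N0, P0, Q0, V0)" by (cases x) blast
    have "ok N0" "ok P0" "ok Q0" using x by (auto simp: valid_def xe)
    moreover have "0 < T / real NT" "lam \<noteq> 0" using parameters by auto
    ultimately have "\<exists>N P Q V. scheme_equations \<Omega> M lam (T / real NT) A N0 P0 Q0 N P Q V \<and>
      scheme_boundary \<Omega> \<Gamma>D \<Gamma>N M ND PD VD N P Q V \<and>
      (\<forall>K\<in>cells M. 0 < N K \<and> 0 < P K \<and> 0 < Q K)"
      unfolding ok_def
      by (intro scheme_time_step domain(1,2) boundary(2-4) mesh(2) dirichlet(1)) auto
    then obtain N P Q V where "step x (N, P, Q, V)" by (auto simp: step_def xe)
    moreover from this have "valid (Suc n) (N, P, Q, V)"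
      by (auto simp: step_def valid_def xe intro!: ok_pos)
    ultimately show "\<exists>y. valid (Suc n) y \<and> step x y" by blast
  qed
  then obtain f where f: "\<And>n. valid n (f n)" "\<And>n. step (f n) (f (Suc n))" by blast
  define N where "N = (\<lambda>n. fst (f n))"
  define P where "P = (\<lambda>n. fst (snd (f n)))"
  define Q where "Q = (\<lambda>n. fst (snd (snd (f n))))"
  define V where "V = (\<lambda>n. snd (snd (snd (f n))))"
  have fe: "f n = (N n, P n, Q n, V n)" for n by (simp add: N_def P_def Q_def V_def)
  \<comment> \<open>The sequence is built for all n; k >= 1 is needed for k to be the successor of k
    - 1.\<close>
  have step_k: "step (f (k - 1)) (f k)" if "k \<in> {1..NT}" for k
    using f(2)[of "k - 1"] that by simp
  have "scheme_solution \<Omega> \<Gamma>D \<Gamma>N M lam T NT Nin Pin Qin ND PD VD A N P Q V"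
    using f(1)[of 0] step_k unfolding scheme_solution_def by (simp add: fe valid_def step_def)
  moreover have "\<forall>K\<in>cells M. \<forall>k\<in>{1..NT}. N k K > 0 \<and> P k K > 0 \<and> Q k K > 0"
    using step_k by (simp add: fe step_def)
  ultimately show ?thesis by blast
qed

end
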